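(* Let $(n_k)_{k\ge0}$ be a strictly increasing sequence of positive integers. The following are equivalent: (1) there exists an uncountable subset $K\subseteq\mathbb{T}$ such that $\lambda^{n_k}\to1$ uniformly on $K$; (2) there exists a bounded linear operator $T$ on a separable complex Banach space $X$ such that $\sigma_p(T)\cap\mathbb{T}$ is uncountable and $\|T^{n_k}-I\|\to0$ as $k\to\infty$; (3) there exists a bounded linear operator $T$ on a separable complex Hilbert space $H$ admitting a non-degenerate $T$-invariant Gaussian probability measure with respect to which $T$ is weakly mixing, and such that $\|T^{n_k}-I\|\to0$ as $k\to\infty$.
   Context: $\mathbb{T}$ is the unit circle; $\sigma_p(T)$ the set of eigenvalues of $T$. A Borel probability measure $m$ on $H$ is non-degenerate if $m(U)>0$ for every non-empty open $U\subseteq H$, and $T$-invariant if $m(T^{-1}(A))=m(A)$ for all Borel $A$. A measure-preserving transformation $\varphi$ of a probability space $(X,\mathcal{F},\mu)$ is weakly mixing if $\frac1N\sum_{n=1}^N|\mu(\varphi^{-n}(A)\cap B)-\mu(A)\mu(B)|\to0$ for all $A,B\in\mathcal{F}$. *)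

theory Defs
  imports "HOL-Analysis.Analysis" "HOL-Probability.Probability"
begin

text \<open>Complex vector spaces are modelled as real vector spaces together with a
  complex structure J (multiplication by i).  Complex scalar multiplication:\<close>
definition cscale :: "('a::real_vector \<Rightarrow> 'a) \<Rightarrow> complex \<Rightarrow> 'a \<Rightarrow> 'a" where
  "cscale J c x = Re c *\<^sub>R x + Im c *\<^sub>R J x"

definition complex_banach_structure :: "('a::banach \<Rightarrow> 'a) \<Rightarrow> bool" where
  "complex_banach_structure J \<longleftrightarrow> linear J \<and> (\<forall>x. J (J x) = - x) \<and>
     (\<forall>c x. norm (cscale J c x) = cmod c * norm x)"

text \<open>J makes the real Hilbert space into a complex Hilbert space whose inner product
  has real part the given real inner product (J orthogonal, J^2 = -1).\<close>
definition complex_hilbert_structure :: "('a::{real_inner,banach} \<Rightarrow> 'a) \<Rightarrow> bool" where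
  "complex_hilbert_structure J \<longleftrightarrow> linear J \<and> (\<forall>x. J (J x) = - x) \<and>
     (\<forall>x y. inner (J x) (J y) = inner x y)"

definition separable_type :: "'a::topological_space itself \<Rightarrow> bool" where
  "separable_type _ \<longleftrightarrow> (\<exists>D::'a set. countable D \<and> closure D = UNIV)"

definition bounded_clinear_op :: "('a::real_normed_vector \<Rightarrow> 'a) \<Rightarrow> ('a \<Rightarrow> 'a) \<Rightarrow> bool" where
  "bounded_clinear_op J T \<longleftrightarrow> bounded_linear T \<and> (\<forall>x. T (J x) = J (T x))"

definition point_spectrum :: "('a::real_vector \<Rightarrow> 'a) \<Rightarrow> ('a \<Rightarrow> 'a) \<Rightarrow> complex set" where
  "point_spectrum J T = {c. \<exists>x. x \<noteq> 0 \<and> T x = cscale J c x}"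

definition centered_gaussian :: "real measure \<Rightarrow> bool" where
  "centered_gaussian \<mu> \<longleftrightarrow> \<mu> = return borel 0 \<or>
     (\<exists>\<sigma>>0. \<mu> = density lborel (normal_density 0 \<sigma>))"

definition borel_prob :: "'a::topological_space measure \<Rightarrow> bool" where
  "borel_prob m \<longleftrightarrow> prob_space m \<and> sets m = sets borel"

text \<open>Gaussian measure on a complex Hilbert space: every continuous real-linear functional
  (equivalently real and imaginary parts of continuous complex-linear functionals)
  has a centred Gaussian distribution.\<close>
definition gaussian_measure :: "'a::real_normed_vector measure \<Rightarrow> bool" where
  "gaussian_measure m \<longleftrightarrow> borel_prob m \<and>
     (\<forall>\<phi>::'a \<Rightarrow> real. bounded_linear \<phi> \<longrightarrow> centered_gaussian (distr m borel \<phi>))"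

definition non_degenerate :: "'a::topological_space measure \<Rightarrow> bool" where
  "non_degenerate m \<longleftrightarrow> (\<forall>U. open U \<and> U \<noteq> {} \<longrightarrow> emeasure m U > 0)"

definition invariant_measure :: "'a::topological_space measure \<Rightarrow> ('a \<Rightarrow> 'a) \<Rightarrow> bool" where
  "invariant_measure m T \<longleftrightarrow> (\<forall>A\<in>sets m. emeasure m (T -` A) = emeasure m A)"

definition weakly_mixing :: "'a measure \<Rightarrow> ('a \<Rightarrow> 'a) \<Rightarrow> bool" where
  "weakly_mixing m T \<longleftrightarrow> (\<forall>A\<in>sets m. \<forall>B\<in>sets m.
     (\<lambda>N. (\<Sum>n=1..N. \<bar>measure m ((T ^^ n) -` A \<inter> B) - measure m A * measure m B\<bar>) / real N)
       \<longlonglongrightarrow> 0)"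

definition unit_circle :: "complex set" where
  "unit_circle = {z. cmod z = 1}"

end

(*
  An eigenvalue z of T satisfies |z^n - 1| <= ||T^n - I||, so a rigid operator with uncountable
  unimodular point spectrum yields the set K at once.  If T is weakly mixing for a non-degenerate
  Gaussian measure m, take the spectral measure of a non-zero functional phi in L^2(m).  It has no
  atoms on the circle because of weak mixing, and the moments of |z^n - 1|^(2J) against it are
  second moments of phi((T^n - I)^J x), hence O(||T^n - I||^(2J)) for a Gaussian measure; letting J
  tend to infinity gives |z^n - 1| <= ||T^n - I|| almost everywhere, so uncountably often.

  Conversely, choose in K a binary tree of points lam_j, each extremely close to its parent, also
  after raising both to any power n_k.  With an orthonormal basis e_j put
  u_j = u_(parent j) + 4^(-j) e_j and let T be determined by T u_j = lam_j u_j.  Then T^N is the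
  diagonal operator (lam_j^N) plus a nuclear operator with coefficients
  4^j (lam_j^N - lam_(parent j)^N), so T^(n_k) tends to I in norm; the limits of u_j and lam_j along
  the branches of the tree are uncountably many eigenpairs.  Averaging the limits of the u_j over
  the uniform measure on the branches gives a T-invariant covariance, realised by a Gaussian series
  along Haar coefficients; since distinct branches have distinct eigenvalues, correlations are
  Cesaro null, and approximation of half-spaces by trigonometric polynomials turns this into weak
  mixing.
*)
theory Submission
  imports Defs
begin

section \<open>Gaussian random series\<close>

text \<open>Each \<open>e j\<close> is \<open>4 ^ j\<close> times a difference of two eigenvectors,
  so the gap between neighbouring eigenvalue powers enters the operator with the factor
  \<open>4 ^ j\<close>; holding the gaps below \<open>(1/16) ^ j\<close> leaves the summable rate
  \<open>(1/4) ^ j\<close>. Uniform convergence on K is what allows a point to be close to its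
  parent for all \<open>n k\<close> simultaneously: for large k both powers are near 1, and only
  finitely many k are left to continuity. Uncountability of K is used through condensation points,
  near which a fresh candidate is always available. In the opposite direction a single second moment
  would bound |z^n - 1| only on average; high powers J turn this into a bound almost everywhere,
  provided that the constant in the Gaussian variance bound does not depend on the functional. Weak
  mixing of the constructed measure rests on the branch measure having no atoms: all but a small
  proportion of pairs of branches have eigenvalues a fixed distance apart, and the geometric sums of
  those pairs stay bounded. Separability is a hypothesis on the type, so measurability and
  uniqueness of measures are both reduced to half-spaces.\<close>

definition halfspace_inter :: "('b::real_inner \<times> real) set \<Rightarrow> 'b set" where
  "halfspace_inter I = {z. \<forall>p\<in>I. inner (fst p) z \<le> snd p}"

lemma halfspace_inter_measurable:
  fixes I :: "('b::real_inner \<times> real) set"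
  assumes "finite I"
  shows "halfspace_inter I \<in> sets borel"
proof -
  have "closed (halfspace_inter I)"
    unfolding halfspace_inter_def Collect_ball_eq
    by (intro closed_INT ballI closed_Collect_le continuous_intros)
  then show ?thesis by simp
qed

text \<open>Half-spaces are the sets on which a measure is visible through one-dimensional
  functionals; closing them under finite intersection gives the pi-system for uniqueness and Dynkin
  arguments. The empty index set yields the whole space.\<close>

lemma Int_stable_halfspace_inter:
  "Int_stable (halfspace_inter ` {I :: ('b::real_inner \<times> real) set. finite I})"
proof (rule Int_stableI)
  fix a b :: "'b set"
  assume "a \<in> halfspace_inter ` {I. finite I}" "b \<in> halfspace_inter ` {I. finite I}"
  then obtain I J where "finite I" "finite J" "a = halfspace_inter I" "b = halfspace_inter J"
    by auto
  then have "a \<inter> b = halfspace_inter (I \<union> J)" "finite (I \<union> J)"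
    by (auto simp: halfspace_inter_def)
  then show "a \<inter> b \<in> halfspace_inter ` {I. finite I}" by blast
qed

lemma separable_typeE:
  assumes "separable_type TYPE('a::topological_space)"
  obtains D :: "'a::topological_space set" where "countable D" "closure D = UNIV"
  using assms unfolding separable_type_def by blast

text \<open>The norm of \<open>z - d\<close> is a supremum over directions \<open>y\<close>, and by
  continuity a dense set of directions suffices. Keeping the factor \<open>norm y\<close> avoids
  normalising them; the converse inclusion tests with \<open>y = z - d\<close>.\<close>

lemma cball_eq_halfspaces:
  fixes D :: "'b::real_inner set"
  assumes D: "closure D = UNIV" and "r \<ge> 0"
  shows "cball d r = (\<Inter>y\<in>D. halfspace_inter {(y, inner y d + r * norm y)})"
proof (intro equalityI subsetI)
  fix z assume "z \<in> cball d r"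
  then have *: "norm (z - d) \<le> r" by (simp add: dist_norm norm_minus_commute)
  have "inner y z \<le> inner y d + r * norm y" for y
  proof -
    have "inner y (z - d) \<le> norm y * norm (z - d)" by (rule norm_cauchy_schwarz)
    also have "\<dots> \<le> norm y * r" using * by (intro mult_left_mono) auto
    finally show ?thesis by (simp add: inner_diff_right algebra_simps)
  qed
  then show "z \<in> (\<Inter>y\<in>D. halfspace_inter {(y, inner y d + r * norm y)})"
    by (auto simp: halfspace_inter_def)
next
  fix z assume z: "z \<in> (\<Inter>y\<in>D. halfspace_inter {(y, inner y d + r * norm y)})"
  have "closed {y. inner y z \<le> inner y d + r * norm y}"
    by (intro closed_Collect_le continuous_intros)
  moreover have "D \<subseteq> {y. inner y z \<le> inner y d + r * norm y}"
    using z by (auto simp: halfspace_inter_def)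
  ultimately have "closure D \<subseteq> {y. inner y z \<le> inner y d + r * norm y}"
    by (rule closure_minimal[rotated])
  then have "inner (z - d) z \<le> inner (z - d) d + r * norm (z - d)"
    using D by auto
  then have "norm (z - d) * norm (z - d) \<le> r * norm (z - d)"
    by (simp add: inner_diff_right flip: power2_eq_square power2_norm_eq_inner)
      (simp add: power2_norm_eq_inner inner_diff_right)
  then have "norm (z - d) \<le> r"
    using \<open>r \<ge> 0\<close> by (cases "norm (z - d) = 0") (auto simp: mult_le_cancel_right)
  then show "z \<in> cball d r" by (simp add: dist_norm norm_minus_commute)
qed

text \<open>Separability enters twice: dense directions turn a closed ball into a countable
  intersection of half-spaces, and dense centres with rational radii turn an open set into a
  countable union of closed balls.\<close>

lemma sets_borel_halfspaces:
  assumes "separable_type TYPE('b::real_inner)"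
  shows "sets (borel :: 'b::real_inner measure) = sigma_sets UNIV (halfspace_inter ` {I. finite I})"
proof (rule antisym)
  obtain D :: "'b set" where D: "countable D" "closure D = UNIV"
    using assms by (rule separable_typeE)
  interpret sigma_algebra UNIV "sigma_sets UNIV (halfspace_inter ` {I :: ('b \<times> real) set. finite I})"
    by (rule sigma_algebra_sigma_sets) auto
  have cb: "cball d r \<in> sigma_sets UNIV (halfspace_inter ` {I. finite I})" if "r \<ge> 0" for d :: 'b and r
  proof -
    have "D \<noteq> {}" using D(2) by auto
    then show ?thesis
      unfolding cball_eq_halfspaces[OF D(2) that] using D(1)
      by (intro countable_INT'') (auto intro!: sigma_sets.Basic)
  qed
  have "U \<in> sigma_sets UNIV (halfspace_inter ` {I. finite I})" if "open U" for U :: "'b set"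
  proof -
    define P where "P = {p \<in> D \<times> (\<rat> \<inter> {0<..}). cball (fst p) (snd p) \<subseteq> U}"
    have "countable P" unfolding P_def
      using D(1) countable_rat by (auto intro!: countable_Collect countable_SIGMA)
    moreover have "U = (\<Union>p\<in>P. cball (fst p) (snd p))"
    proof (intro equalityI subsetI)
      fix x assume "x \<in> U"
      with \<open>open U\<close> obtain e where e: "e > 0" "ball x e \<subseteq> U" by (meson openE)
      \<comment> \<open>Below \<open>e / 2\<close>, because the ball is centred at \<open>d\<close>
        and not at \<open>x\<close>: its points lie within \<open>2 * q\<close> of
        \<open>x\<close>.\<close>
      obtain q where q: "q \<in> \<rat>" "0 < q" "q < e / 2"
        using Rats_dense_in_real[of 0 "e/2"] e by auto
      have "x \<in> closure D" using D(2) by simp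
      then obtain d where d: "d \<in> D" "dist d x < q" unfolding closure_approachable using q by blast
      have "cball d q \<subseteq> ball x e"
      proof
        fix y assume "y \<in> cball d q"
        then have "dist x y \<le> dist d x + dist d y" "dist d y \<le> q"
          by (metis dist_commute dist_triangle, simp)
        with d q show "y \<in> ball x e" by simp
      qed
      then have "(d, q) \<in> P" using d q e by (auto simp: P_def)
      moreover have "x \<in> cball d q" using d by simp
      ultimately show "x \<in> (\<Union>p\<in>P. cball (fst p) (snd p))" by force
    qed (auto simp: P_def)
    moreover have "cball (fst p) (snd p) \<in> sigma_sets UNIV (halfspace_inter ` {I. finite I})"
      if "p \<in> P" for p
      using that by (intro cb) (auto simp: P_def)
    ultimately show ?thesis
      using countable_UN''[of P "\<lambda>p. cball (fst p) (snd p)"] by simp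
  qed
  then show "sets (borel :: 'b measure) \<subseteq> sigma_sets UNIV (halfspace_inter ` {I. finite I})"
    unfolding borel_def by (subst sets_measure_of) (auto intro!: sigma_sets_mono)
next
  have "halfspace_inter ` {I. finite I} \<subseteq> sets (borel :: 'b measure)"
    by (auto simp: halfspace_inter_measurable)
  from sets.sigma_sets_subset[OF this]
  show "sigma_sets UNIV (halfspace_inter ` {I. finite I}) \<subseteq> sets (borel :: 'b measure)"
    by simp
qed

text \<open>Pettis' theorem: weak measurability suffices, since the half-spaces that generate the
  Borel sets only test inner products.\<close>

lemma borel_measurable_inner_imp:
  fixes X :: "'a \<Rightarrow> 'b::real_inner"
  assumes sep: "separable_type TYPE('b)"
    and X: "\<And>y. (\<lambda>\<omega>. inner y (X \<omega>)) \<in> borel_measurable M"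
  shows "X \<in> borel_measurable M"
proof (rule measurable_sigma_sets[OF sets_borel_halfspaces[OF sep]])
  fix A :: "'b set" assume "A \<in> halfspace_inter ` {I. finite I}"
  then obtain I where I: "finite I" "A = halfspace_inter I" by auto
  note X[measurable]
  have "X -` A \<inter> space M = {\<omega>\<in>space M. \<forall>p\<in>I. inner (fst p) (X \<omega>) \<le> snd p}"
    by (auto simp: I halfspace_inter_def)
  also have "\<dots> \<in> sets M" using I(1) by measurable
  finally show "X -` A \<inter> space M \<in> sets M" .
qed auto

section \<open>Independent standard normal variables\<close>

abbreviation gauss_seq :: "(nat \<Rightarrow> real) measure" where
  "gauss_seq \<equiv> PiM UNIV (\<lambda>_. std_normal_distribution)"

lemma prob_space_std_normal: "prob_space std_normal_distribution"
  using prob_space_normal_density[of 1 0] by simp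

interpretation gs: sequence_space std_normal_distribution
proof -
  interpret prob_space std_normal_distribution by (rule prob_space_std_normal)
  show "sequence_space std_normal_distribution"
    by unfold_locales
qed

lemma gauss_seq_coord_measurable: "(\<lambda>\<omega>. \<omega> i) \<in> borel_measurable gauss_seq"
proof -
  have "(\<lambda>\<omega>. \<omega> i) \<in> measurable gauss_seq std_normal_distribution"
    by (rule measurable_component_singleton) simp
  then show ?thesis by (simp cong: measurable_cong_sets)
qed

declare gauss_seq_coord_measurable[measurable]

lemma indep_vars_gauss_seq: "gs.P.indep_vars (\<lambda>_. borel) (\<lambda>i \<omega>. \<omega> i) (UNIV :: nat set)"
proof -
  have rv: "gs.P.random_variable borel (\<lambda>\<omega>. \<omega> i)" for i by measurable
  have d: "distr gauss_seq borel (\<lambda>\<omega>. \<omega> i) = std_normal_distribution" for i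
  proof -
    have "distr gauss_seq borel (\<lambda>\<omega>. \<omega> i) = distr gauss_seq std_normal_distribution (\<lambda>\<omega>. \<omega> i)"
      by (rule distr_cong) auto
    then show ?thesis using gs.PiM_component[of i] by simp
  qed
  have s: "sets (PiM UNIV (\<lambda>_. borel) :: (nat \<Rightarrow> real) measure) = sets gauss_seq"
    by (rule sets_PiM_cong) auto
  have "distr gauss_seq (PiM UNIV (\<lambda>_. borel)) (\<lambda>\<omega>. \<lambda>i\<in>UNIV. \<omega> i) = gauss_seq"
    using s by (simp add: restrict_def distr_id2)
  then show ?thesis
    by (subst gs.P.indep_vars_iff_distr_eq_PiM) (auto simp: d)
qed

lemma gauss_seq_char_finite:
  "(CLINT \<omega>|gauss_seq. iexp (\<Sum>i<N. \<omega> i * t i)) = exp (- (\<Sum>i<N. (t i)\<^sup>2) / 2)"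
proof -
  have iv: "gs.P.indep_vars (\<lambda>_. borel) (\<lambda>i \<omega>. \<omega> i * t i) {..<N}"
    using gs.P.indep_vars_compose2[OF gs.P.indep_vars_subset[OF indep_vars_gauss_seq, of "{..<N}"],
      of "\<lambda>i x. x * t i" "\<lambda>_. borel"] by simp
  have *: "char (distr gauss_seq borel (\<lambda>\<omega>. \<omega> i * t i)) 1 = exp (- ((t i)\<^sup>2) / 2)" for i
  proof -
    have "char (distr gauss_seq borel (\<lambda>\<omega>. \<omega> i * t i)) 1
        = (CLINT \<omega>|gauss_seq. iexp (t i * \<omega> i))"
      by (simp add: char_def integral_distr mult_ac)
    also have "\<dots> = (CLINT x|distr gauss_seq std_normal_distribution (\<lambda>\<omega>. \<omega> i). iexp (t i * x))"
      by (subst integral_distr) auto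
    also have "\<dots> = char std_normal_distribution (t i)"
      using gs.PiM_component[of i] by (simp add: char_def)
    finally show ?thesis by (simp add: char_std_normal_distribution)
  qed
  have "(CLINT \<omega>|gauss_seq. iexp (\<Sum>i<N. \<omega> i * t i))
     = char (distr gauss_seq borel (\<lambda>\<omega>. \<Sum>i<N. \<omega> i * t i)) 1"
    by (simp add: char_def integral_distr)
  also have "\<dots> = (\<Prod>i<N. exp (- ((t i)\<^sup>2) / 2))"
    by (subst gs.P.char_distr_sum[OF iv]) (simp only: * of_real_prod)
  also have "\<dots> = exp (- (\<Sum>i<N. (t i)\<^sup>2) / 2)"
    by (simp add: exp_sum[symmetric] sum_negf sum_divide_distrib[symmetric])
  finally show ?thesis .
qed

text \<open>As a measurability rule the preceding fact matches every function application,
  hence it is only switched on locally.\<close>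

declare gauss_seq_coord_measurable[measurable del]

declare gauss_seq_coord_measurable[measurable]

text \<open>An extended non-negative sum, so that the event of absolute convergence is measurable
  without prior knowledge of convergence. Off this event \<open>series_rv\<close> has the default
  value 0.\<close>

definition good_seq :: "(nat \<Rightarrow> 'b::real_normed_vector) \<Rightarrow> (nat \<Rightarrow> real) \<Rightarrow> bool" where
  "good_seq f \<omega> \<longleftrightarrow> (\<Sum>i. ennreal (\<bar>\<omega> i\<bar> * norm (f i))) < \<infinity>"

definition series_rv :: "(nat \<Rightarrow> 'b::real_normed_vector) \<Rightarrow> (nat \<Rightarrow> real) \<Rightarrow> 'b" where
  "series_rv f \<omega> = (if good_seq f \<omega> then \<Sum>i. \<omega> i *\<^sub>R f i else 0)"

lemma good_seq_summable:
  assumes "good_seq f \<omega>" shows "summable (\<lambda>i. norm (\<omega> i *\<^sub>R f i))"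
  using assms unfolding good_seq_def
  by (intro summable_suminf_not_top) (auto simp: less_top)

lemma good_seq_summable':
  fixes f :: "nat \<Rightarrow> 'b::banach"
  shows "good_seq f \<omega> \<Longrightarrow> summable (\<lambda>i. \<omega> i *\<^sub>R f i)"
  by (rule summable_norm_cancel, rule good_seq_summable)

lemma good_seq_measurable[measurable]: "Measurable.pred gauss_seq (good_seq f)"
  unfolding good_seq_def by measurable

lemma series_rv_functional:
  fixes f :: "nat \<Rightarrow> 'b::banach"
  assumes "bounded_linear \<phi>" "good_seq f \<omega>"
  shows "(\<lambda>i. \<omega> i * \<phi> (f i)) sums \<phi> (series_rv f \<omega>)"
proof -
  interpret bounded_linear \<phi> by fact
  have "(\<lambda>i. \<omega> i *\<^sub>R f i) sums series_rv f \<omega>"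
    using good_seq_summable'[OF assms(2)] assms(2) by (simp add: series_rv_def summable_sums)
  from sums[OF this] show ?thesis by (simp add: scaleR)
qed

lemma series_rv_measurable:
  fixes f :: "nat \<Rightarrow> 'b::{real_inner,banach}"
  assumes sep: "separable_type TYPE('b)"
  shows "series_rv f \<in> borel_measurable gauss_seq"
proof (rule borel_measurable_inner_imp[OF sep])
  fix y :: 'b
  have "inner y (series_rv f \<omega>) = (if good_seq f \<omega> then \<Sum>i. \<omega> i * inner y (f i) else 0)" for \<omega>
    using series_rv_functional[of "inner y" f \<omega>] bounded_linear_inner_right[of y]
    by (auto simp: sums_iff series_rv_def)
  then show "(\<lambda>\<omega>. inner y (series_rv f \<omega>)) \<in> borel_measurable gauss_seq"
    by simp
qed

definition abs_moment :: real where
  "abs_moment = (LINT x|std_normal_distribution. \<bar>x\<bar>)"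

lemma nn_integral_gauss_coord:
  "(\<integral>\<^sup>+\<omega>. ennreal \<bar>\<omega> i\<bar> \<partial>gauss_seq) = ennreal abs_moment"
proof -
  have "(\<integral>\<^sup>+\<omega>. ennreal \<bar>\<omega> i\<bar> \<partial>gauss_seq)
      = (\<integral>\<^sup>+x. ennreal \<bar>x\<bar> \<partial>distr gauss_seq std_normal_distribution (\<lambda>\<omega>. \<omega> i))"
    by (subst nn_integral_distr) auto
  also have "\<dots> = (\<integral>\<^sup>+x. ennreal \<bar>x\<bar> \<partial>std_normal_distribution)"
    using gs.PiM_component[of i] by simp
  also have "\<dots> = ennreal abs_moment"
    unfolding abs_moment_def
    using integrable_std_normal_distribution_moment[of 1]
    by (intro nn_integral_eq_integral) auto
  finally show ?thesis .
qed

text \<open>Tonelli's theorem. The finite expectation gives absolute convergence almost surely, and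
  it is for this elementary argument that the norms of \<open>f\<close> are assumed summable and not
  merely their squares.\<close>

lemma nn_integral_series_tail:
  fixes f :: "nat \<Rightarrow> 'b::real_normed_vector"
  assumes "summable (\<lambda>i. norm (f i))"
  shows "(\<integral>\<^sup>+\<omega>. (\<Sum>i. ennreal (\<bar>\<omega> i\<bar> * norm (f i))) \<partial>gauss_seq)
    = ennreal (abs_moment * (\<Sum>i. norm (f i)))"
proof -
  have "abs_moment \<ge> 0" unfolding abs_moment_def by (rule integral_nonneg_AE) auto
  have "(\<integral>\<^sup>+\<omega>. (\<Sum>i. ennreal (\<bar>\<omega> i\<bar> * norm (f i))) \<partial>gauss_seq)
     = (\<Sum>i. \<integral>\<^sup>+\<omega>. ennreal (\<bar>\<omega> i\<bar> * norm (f i)) \<partial>gauss_seq)"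
    by (rule nn_integral_suminf) measurable
  also have "\<dots> = (\<Sum>i. ennreal (abs_moment * norm (f i)))"
    by (simp add: ennreal_mult'' nn_integral_multc nn_integral_gauss_coord)
  also have "\<dots> = ennreal (\<Sum>i. abs_moment * norm (f i))"
    using assms \<open>abs_moment \<ge> 0\<close> by (intro suminf_ennreal2 summable_mult) auto
  finally show ?thesis using assms by (simp add: suminf_mult)
qed

lemma AE_good_seq:
  fixes f :: "nat \<Rightarrow> 'b::real_normed_vector"
  assumes "summable (\<lambda>i. norm (f i))"
  shows "AE \<omega> in gauss_seq. good_seq f \<omega>"
proof -
  have "AE \<omega> in gauss_seq. (\<Sum>i. ennreal (\<bar>\<omega> i\<bar> * norm (f i))) \<noteq> \<infinity>"
    using nn_integral_series_tail[OF assms] by (intro nn_integral_PInf_AE) auto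
  then show ?thesis by (auto simp: good_seq_def less_top)
qed

text \<open>Finite partial sums have an explicit characteristic function by independence; the
  integrands have modulus 1, so dominated convergence carries the formula over to the
  series.\<close>

lemma series_rv_char:
  fixes f :: "nat \<Rightarrow> 'b::{real_inner,banach}"
  assumes sep: "separable_type TYPE('b)" and f: "summable (\<lambda>i. norm (f i))"
    and phi: "bounded_linear \<phi>"
  shows "summable (\<lambda>i. (\<phi> (f i))\<^sup>2)"
    and "(CLINT \<omega>|gauss_seq. iexp (\<phi> (series_rv f \<omega>))) = exp (- (\<Sum>i. (\<phi> (f i))\<^sup>2) / 2)"
proof -
  interpret phi: bounded_linear \<phi> by fact
  obtain K where K: "\<And>x. norm (\<phi> x) \<le> norm x * K" using phi.bounded by blast
  have s1: "summable (\<lambda>i. \<bar>\<phi> (f i)\<bar>)"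
    by (rule summable_comparison_test[OF _ summable_mult2[OF f, of K]]) (use K in auto)
  have "(\<lambda>i. \<bar>\<phi> (f i)\<bar>) \<longlonglongrightarrow> 0" by (rule summable_LIMSEQ_zero[OF s1])
  then have "\<forall>\<^sub>F i in sequentially. \<bar>\<phi> (f i)\<bar> < 1" by (rule order_tendstoD) simp
  then have "\<forall>\<^sub>F i in sequentially. norm ((\<phi> (f i))\<^sup>2) \<le> \<bar>\<phi> (f i)\<bar>"
  proof eventually_elim
    case (elim i)
    then show ?case using power_decreasing[of 1 2 "\<bar>\<phi> (f i)\<bar>"] by simp
  qed
  then show s2: "summable (\<lambda>i. (\<phi> (f i))\<^sup>2)"
    by (rule summable_comparison_test_ev[OF _ s1])
  note m[measurable] = series_rv_measurable[OF sep, of f]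
  have [measurable]: "\<phi> \<in> borel_measurable borel"
    by (intro borel_measurable_continuous_onI linear_continuous_on phi)
  have lim: "AE \<omega> in gauss_seq. (\<lambda>N. iexp (\<Sum>i<N. \<omega> i * \<phi> (f i))) \<longlonglongrightarrow> iexp (\<phi> (series_rv f \<omega>))"
    using AE_good_seq[OF f]
  proof eventually_elim
    case (elim \<omega>)
    then have "(\<lambda>N. \<Sum>i<N. \<omega> i * \<phi> (f i)) \<longlonglongrightarrow> \<phi> (series_rv f \<omega>)"
      using series_rv_functional[OF phi] by (simp add: sums_def)
    then show ?case by (intro tendsto_intros)
  qed
  have "(\<lambda>N. CLINT \<omega>|gauss_seq. iexp (\<Sum>i<N. \<omega> i * \<phi> (f i)))
     \<longlonglongrightarrow> (CLINT \<omega>|gauss_seq. iexp (\<phi> (series_rv f \<omega>)))"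
    by (rule integral_dominated_convergence[where w="\<lambda>_. 1", OF _ _ _ lim]) auto
  moreover have "(\<lambda>N. complex_of_real (exp (- (\<Sum>i<N. (\<phi> (f i))\<^sup>2) / 2)))
     \<longlonglongrightarrow> exp (- (\<Sum>i. (\<phi> (f i))\<^sup>2) / 2)"
    using summable_LIMSEQ[OF s2] by (intro tendsto_intros) auto
  ultimately show "(CLINT \<omega>|gauss_seq. iexp (\<phi> (series_rv f \<omega>))) = exp (- (\<Sum>i. (\<phi> (f i))\<^sup>2) / 2)"
    unfolding gauss_seq_char_finite by (rule LIMSEQ_unique)
qed

lemma emeasure_std_normal_interval_pos:
  assumes "a < b"
  shows "emeasure std_normal_distribution {a..b} > 0"
proof -
  have "emeasure std_normal_distribution {a..b} \<noteq> 0"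
  proof
    assume "emeasure std_normal_distribution {a..b} = 0"
    then have "AE x in lborel. x \<in> {a..b} \<longrightarrow> std_normal_density x = 0"
      by (subst (asm) emeasure_density) (auto simp: nn_integral_0_iff_AE indicator_def ennreal_eq_0_iff
         normal_density_nonneg antisym split: if_splits)
    then have "AE x in lborel. x \<notin> {a..b}"
      by eventually_elim (metis normal_density_pos less_irrefl zero_less_one)
    then have "emeasure lborel {a..b} = 0"
      by (subst (asm) AE_iff_measurable[OF _ refl]) (auto simp flip: atLeastAtMost_def atLeastAtMost_iff)
    then show False using assms by simp
  qed
  then show ?thesis by (simp add: zero_less_iff_neq_zero)
qed


lemma emeasure_gauss_seq_box_pos:
  assumes "\<eta> > 0"
  shows "emeasure gauss_seq {\<omega>\<in>space gauss_seq. \<forall>i\<in>{..<N}. \<omega> i \<in> {a i - \<eta>..a i + \<eta>}} > 0"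
proof -
  have "emeasure gauss_seq {\<omega>\<in>space gauss_seq. \<forall>i\<in>{..<N}. \<omega> i \<in> {a i - \<eta>..a i + \<eta>}}
     = (\<Prod>i<N. emeasure std_normal_distribution {a i - \<eta>..a i + \<eta>})"
    by (rule gs.emeasure_PiM_Collect) auto
  also have "\<dots> \<noteq> 0"
    using emeasure_std_normal_interval_pos[of "a _ - \<eta>" "a _ + \<eta>"] assms
    by (auto simp: zero_less_iff_neq_zero)
  finally show ?thesis by (simp add: zero_less_iff_neq_zero)
qed

text \<open>A Markov argument: if the tail were at least \<open>r\<close> almost surely, its
  expectation would be at least \<open>r\<close>, whereas the expectation tends to 0 as
  \<open>N\<close> grows.\<close>

lemma gauss_seq_tail_pos:
  fixes f :: "nat \<Rightarrow> 'b::real_normed_vector"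
  assumes f: "summable (\<lambda>i. norm (f i))" and "r > 0"
  shows "\<forall>\<^sub>F N in sequentially.
    emeasure gauss_seq {\<omega>\<in>space gauss_seq. (\<Sum>i. ennreal (\<bar>\<omega> i\<bar> * norm (f (i + N)))) < ennreal r} > 0"
proof -
  have pos: "abs_moment \<ge> 0" unfolding abs_moment_def by (rule integral_nonneg_AE) auto
  have "(\<lambda>N. abs_moment * (\<Sum>i. norm (f (i + N)))) \<longlonglongrightarrow> abs_moment * 0"
    by (intro tendsto_intros suminf_exist_split2 f)
  then have "\<forall>\<^sub>F N in sequentially. abs_moment * (\<Sum>i. norm (f (i + N))) < r"
    using \<open>r > 0\<close> by (intro order_tendstoD) auto
  then show ?thesis
  proof eventually_elim
    case (elim N)
    define Y where "Y \<omega> = (\<Sum>i. ennreal (\<bar>\<omega> i\<bar> * norm (f (i + N))))" for \<omega> :: "nat \<Rightarrow> real"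
    have [measurable]: "Y \<in> borel_measurable gauss_seq" unfolding Y_def by measurable
    show "emeasure gauss_seq {\<omega>\<in>space gauss_seq. (\<Sum>i. ennreal (\<bar>\<omega> i\<bar> * norm (f (i + N)))) < ennreal r} > 0"
    proof (rule ccontr)
      assume "\<not> emeasure gauss_seq {\<omega>\<in>space gauss_seq. (\<Sum>i. ennreal (\<bar>\<omega> i\<bar> * norm (f (i + N)))) < ennreal r} > 0"
      then have "emeasure gauss_seq {\<omega>\<in>space gauss_seq. \<not> ennreal r \<le> Y \<omega>} = 0"
        by (simp add: Y_def not_le)
      then have "AE \<omega> in gauss_seq. ennreal r \<le> Y \<omega>"
        by (subst AE_iff_measurable[OF _ refl]) auto
      then have "(\<integral>\<^sup>+\<omega>. ennreal r \<partial>gauss_seq) \<le> (\<integral>\<^sup>+\<omega>. Y \<omega> \<partial>gauss_seq)"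
        by (rule nn_integral_mono_AE)
      also have "\<dots> = ennreal (abs_moment * (\<Sum>i. norm (f (i + N))))"
        unfolding Y_def using summable_ignore_initial_segment[OF f] by (intro nn_integral_series_tail)
      also have "\<dots> < ennreal r"
        using elim \<open>r > 0\<close> by (intro ennreal_lessI)
      finally show False by (simp add: gs.P.emeasure_space_1)
    qed
  qed
qed

lemma span_range_finite_comb:
  fixes f :: "nat \<Rightarrow> 'b::real_vector"
  assumes "x \<in> span (range f)"
  shows "\<exists>\<alpha> N. (\<forall>i\<ge>N. \<alpha> i = 0) \<and> x = (\<Sum>i<N. \<alpha> i *\<^sub>R f i)"
    using assms
  proof (induction rule: span_induct_alt)
    case base
    show ?case by (rule exI[of _ "\<lambda>_. 0"], rule exI[of _ 0]) simp
  next
    case (step c y x)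
    then obtain \<alpha> N j where h: "\<forall>i\<ge>N. \<alpha> i = 0" "x = (\<Sum>i<N. \<alpha> i *\<^sub>R f i)" "y = f j" by auto
    let ?M = "max N (Suc j)"
    have "x = (\<Sum>i<?M. \<alpha> i *\<^sub>R f i)"
      unfolding h(2) using h(1) by (intro sum.mono_neutral_left) auto
    moreover have "c *\<^sub>R y = (\<Sum>i<?M. (if i = j then c else 0) *\<^sub>R f i)"
      using h(3) by (subst sum.remove[of _ j]) auto
    ultimately have "c *\<^sub>R y + x = (\<Sum>i<?M. (\<alpha> i + (if i = j then c else 0)) *\<^sub>R f i)"
      by (simp add: sum.distrib scaleR_add_left)
    with h(1) show ?case
      by (intro exI[of _ "\<lambda>i. \<alpha> i + (if i = j then c else 0)"] exI[of _ ?M]) auto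
qed

text \<open>A given ball is hit when the first \<open>N\<close> coordinates are close to the
  coefficients of a nearby finite combination and the remaining tail is small. Both events have
  positive probability and involve disjoint sets of coordinates, so they are independent.\<close>

lemma series_rv_open_pos:
  fixes f :: "nat \<Rightarrow> 'b::{real_inner,banach}"
  assumes sep: "separable_type TYPE('b)" and f: "summable (\<lambda>i. norm (f i))"
    and dense: "closure (span (range f)) = UNIV" and U: "open U" "U \<noteq> {}"
  shows "emeasure gauss_seq (series_rv f -` U \<inter> space gauss_seq) > 0"
proof -
  obtain x0 e where e: "e > 0" "ball x0 e \<subseteq> U" using U by (meson ex_in_conv openE)
  have "x0 \<in> closure (span (range f))" using dense by simp
  then obtain x where x: "x \<in> span (range f)" "dist x x0 < e / 3"
    unfolding closure_approachable using e by (meson divide_pos_pos zero_less_numeral)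
  from x(1) obtain N1 \<alpha> where \<alpha>: "\<And>i. i \<ge> N1 \<Longrightarrow> \<alpha> i = 0" "x = (\<Sum>i<N1. \<alpha> i *\<^sub>R f i)"
    using span_range_finite_comb[OF x(1)] by auto
  obtain N0 where N0: "\<And>N. N \<ge> N0 \<Longrightarrow>
    emeasure gauss_seq {\<omega>\<in>space gauss_seq. (\<Sum>i. ennreal (\<bar>\<omega> i\<bar> * norm (f (i + N)))) < ennreal (e/3)} > 0"
    using gauss_seq_tail_pos[OF f, of "e/3"] e unfolding eventually_sequentially
    by (meson divide_pos_pos zero_less_numeral)
  define N where "N = max N0 N1"
  have xN: "x = (\<Sum>i<N. \<alpha> i *\<^sub>R f i)"
    unfolding \<alpha>(2) N_def using \<alpha>(1) by (intro sum.mono_neutral_left) auto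
  \<comment> \<open>Perturbing each of the first \<open>N\<close> coefficients by at most \<eta>
    moves the sum by at most \<open>e / 3\<close>; the summand 1 keeps the denominator
    positive.\<close>
  define \<eta> where "\<eta> = e / 3 / (1 + (\<Sum>i<N. norm (f i)))"
  have S0: "1 + (\<Sum>i<N. norm (f i)) > 0" by (intro add_pos_nonneg sum_nonneg) auto
  then have "\<eta> > 0" using e by (simp add: \<eta>_def)
  define A where "A = {\<omega>\<in>space gauss_seq. \<forall>i\<in>{..<N}. \<omega> i \<in> {\<alpha> i - \<eta>..\<alpha> i + \<eta>}}"
  define B where "B = {\<omega>\<in>space gauss_seq. (\<Sum>i. ennreal (\<bar>\<omega> i\<bar> * norm (f (i + N)))) < ennreal (e/3)}"
  have [measurable]: "A \<in> sets gauss_seq" "B \<in> sets gauss_seq"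
    unfolding A_def B_def by measurable
  note m[measurable] = series_rv_measurable[OF sep, of f]
  have US[measurable]: "U \<in> sets borel" using U by simp
  have sub: "series_rv f (comb_seq N \<omega> \<omega>') \<in> U" if "\<omega> \<in> A" "\<omega>' \<in> B" for \<omega> \<omega>'
  proof -
    let ?c = "comb_seq N \<omega> \<omega>'"
    have c: "?c i = (if i < N then \<omega> i else \<omega>' (i - N))" for i
      by (simp add: comb_seq_def)
    have fin: "(\<Sum>i. ennreal (\<bar>\<omega>' i\<bar> * norm (f (i + N)))) < ennreal (e/3)"
      using that by (simp add: B_def)
    have s: "summable (\<lambda>i. \<bar>\<omega>' i\<bar> * norm (f (i + N)))"
      using order.strict_trans[OF fin ennreal_less_top]
      by (intro summable_suminf_not_top) (auto simp: less_top)
    then have fin': "(\<Sum>i. \<bar>\<omega>' i\<bar> * norm (f (i + N))) < e / 3"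
      using fin e by (subst (asm) suminf_ennreal2) (auto simp: ennreal_less_iff suminf_nonneg)
    have s': "summable (\<lambda>i. \<bar>?c i\<bar> * norm (f i))"
      by (subst summable_iff_shift[of _ N, symmetric]) (use s in \<open>simp add: c\<close>)
    have good: "good_seq f ?c"
      unfolding good_seq_def using s' by (subst suminf_ennreal2) auto
    have ss: "summable (\<lambda>i. ?c i *\<^sub>R f i)" using good by (rule good_seq_summable')
    have sn: "summable (\<lambda>i. norm (\<omega>' i *\<^sub>R f (i + N)))" using s by simp
    have "series_rv f ?c = (\<Sum>i. ?c (i + N) *\<^sub>R f (i + N)) + (\<Sum>i<N. ?c i *\<^sub>R f i)"
      using good suminf_split_initial_segment[OF ss, of N] by (simp add: series_rv_def)
    then have eq: "series_rv f ?c = (\<Sum>i. \<omega>' i *\<^sub>R f (i + N)) + (\<Sum>i<N. \<omega> i *\<^sub>R f i)"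
      by (simp add: c)
    have t: "norm (\<Sum>i. \<omega>' i *\<^sub>R f (i + N)) < e / 3"
      using summable_norm[OF sn] fin' by simp
    have "norm ((\<Sum>i<N. \<omega> i *\<^sub>R f i) - x) = norm (\<Sum>i<N. (\<omega> i - \<alpha> i) *\<^sub>R f i)"
      by (simp add: xN scaleR_diff_left sum_subtractf)
    also have "\<dots> \<le> (\<Sum>i<N. \<eta> * norm (f i))"
    proof (intro sum_norm_le)
      fix i assume "i \<in> {..<N}"
      with \<open>\<omega> \<in> A\<close> have "\<alpha> i - \<eta> \<le> \<omega> i" "\<omega> i \<le> \<alpha> i + \<eta>" by (auto simp: A_def)
      then have "\<bar>\<omega> i - \<alpha> i\<bar> \<le> \<eta>" by linarith
      then show "norm ((\<omega> i - \<alpha> i) *\<^sub>R f i) \<le> \<eta> * norm (f i)" by (simp add: mult_right_mono)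
    qed
    also have "\<dots> = \<eta> * (\<Sum>i<N. norm (f i))" by (simp add: sum_distrib_left)
    also have "\<dots> \<le> \<eta> * (1 + (\<Sum>i<N. norm (f i)))" using \<open>\<eta> > 0\<close> by (intro mult_left_mono) auto
    also have "\<dots> = e / 3" 
      using \<eta>_def S0 by (metis less_irrefl nonzero_divide_eq_eq)
    finally have t2: "norm ((\<Sum>i<N. \<omega> i *\<^sub>R f i) - x) \<le> e / 3" .
    have "series_rv f ?c - x0 = (\<Sum>i. \<omega>' i *\<^sub>R f (i + N)) + (((\<Sum>i<N. \<omega> i *\<^sub>R f i) - x) + (x - x0))"
      by (simp add: eq)
    also have "norm \<dots> \<le> norm (\<Sum>i. \<omega>' i *\<^sub>R f (i + N)) + (norm ((\<Sum>i<N. \<omega> i *\<^sub>R f i) - x) + norm (x - x0))"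
      by (intro order_trans[OF norm_triangle_ineq] add_mono order_refl norm_triangle_ineq)
    also have "\<dots> < e" using t t2 x(2) by (simp add: dist_norm)
    finally have "series_rv f ?c \<in> ball x0 e" by (simp add: dist_norm norm_minus_commute)
    then show ?thesis using e by auto
  qed
  have spA: "A \<subseteq> space gauss_seq" "B \<subseteq> space gauss_seq" by (auto simp: A_def B_def)
  \<comment> \<open>Independence takes this form: gluing the first \<open>N\<close> coordinates of
    one sequence to a second sequence maps the product measure to \<open>gauss_seq\<close>.\<close>
  let ?P = "gauss_seq \<Otimes>\<^sub>M gauss_seq"
  have cm: "(\<lambda>(\<omega>, \<omega>'). comb_seq N \<omega> \<omega>') \<in> measurable ?P gauss_seq" by (rule measurable_comb_seq)
  have "0 < emeasure gauss_seq A"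
    unfolding A_def by (rule emeasure_gauss_seq_box_pos[OF \<open>\<eta> > 0\<close>])
  moreover have "0 < emeasure gauss_seq B"
    unfolding B_def by (rule N0) (simp add: N_def)
  ultimately have "0 < emeasure gauss_seq A * emeasure gauss_seq B"
    by (simp add: ennreal_zero_less_mult_iff)
  also have "\<dots> = emeasure ?P (A \<times> B)"
    by (rule gs.P.emeasure_pair_measure_Times[symmetric]) auto
  also have "\<dots> \<le> emeasure ?P ((\<lambda>(\<omega>, \<omega>'). comb_seq N \<omega> \<omega>') -` (series_rv f -` U \<inter> space gauss_seq) \<inter> space ?P)"
  proof (rule emeasure_mono)
    show "A \<times> B \<subseteq> (\<lambda>(\<omega>, \<omega>'). comb_seq N \<omega> \<omega>') -` (series_rv f -` U \<inter> space gauss_seq) \<inter> space ?P"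
      using sub spA by (auto simp: space_pair_measure space_PiM)
    show "(\<lambda>(\<omega>, \<omega>'). comb_seq N \<omega> \<omega>') -` (series_rv f -` U \<inter> space gauss_seq) \<inter> space ?P \<in> sets ?P"
      by (rule measurable_sets[OF cm]) measurable
  qed
  also have "\<dots> = emeasure (distr ?P gauss_seq (\<lambda>(\<omega>, \<omega>'). comb_seq N \<omega> \<omega>')) (series_rv f -` U \<inter> space gauss_seq)"
    by (rule emeasure_distr[symmetric, OF cm]) measurable
  also have "\<dots> = emeasure gauss_seq (series_rv f -` U \<inter> space gauss_seq)"
    by (simp only: gs.PiM_comb_seq)
  finally show ?thesis .
qed

lemma gaussian_series_measure:
  fixes f :: "nat \<Rightarrow> 'b::{real_inner,banach}"
  assumes sep: "separable_type TYPE('b)" and f: "summable (\<lambda>i. norm (f i))"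
    and dense: "closure (span (range f)) = UNIV"
  obtains m :: "'b measure" where "borel_prob m" "non_degenerate m"
    "\<And>\<phi>. bounded_linear \<phi> \<Longrightarrow>
      (CLINT z|m. iexp (\<phi> z)) = complex_of_real (exp (- (\<Sum>i. (\<phi> (f i))\<^sup>2) / 2))"
proof
  let ?m = "distr gauss_seq borel (series_rv f)"
  note m[measurable] = series_rv_measurable[OF sep, of f]
  show "borel_prob ?m" unfolding borel_prob_def by (simp add: gs.P.prob_space_distr)
  show "non_degenerate ?m"
    unfolding non_degenerate_def using series_rv_open_pos[OF sep f dense]
    by (auto simp: emeasure_distr)
  fix \<phi> :: "'b \<Rightarrow> real" assume phi: "bounded_linear \<phi>"
  have [measurable]: "\<phi> \<in> borel_measurable borel"
    by (intro borel_measurable_continuous_onI linear_continuous_on phi)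
  show "(CLINT z|?m. iexp (\<phi> z)) = complex_of_real (exp (- (\<Sum>i. (\<phi> (f i))\<^sup>2) / 2))"
    by (subst integral_distr) (use series_rv_char(2)[OF sep f phi] in auto)
qed

text \<open>Homogeneity of \<open>Q\<close> makes the characteristic function of \<phi> at
  \<open>t\<close> equal to \<open>exp (- (t\<^sup>2 * Q \<phi>) / 2)\<close>, and Levy's uniqueness
  theorem identifies the law. The case \<open>Q \<phi> = 0\<close> is treated apart, since the law
  then has no density.\<close>

lemma char_functional_gaussian:
  fixes m :: "'b::real_normed_vector measure" and Q :: "('b \<Rightarrow> real) \<Rightarrow> real"
  assumes m: "borel_prob m" and Q: "\<And>\<phi>. bounded_linear \<phi> \<Longrightarrow> Q \<phi> \<ge> 0"
    and char: "\<And>\<phi>. bounded_linear \<phi> \<Longrightarrow> (CLINT z|m. iexp (\<phi> z)) = complex_of_real (exp (- Q \<phi> / 2))"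
    and scale: "\<And>\<phi> t. bounded_linear \<phi> \<Longrightarrow> Q (\<lambda>z. t * \<phi> z) = t\<^sup>2 * Q \<phi>"
  shows "gaussian_measure m"
  unfolding gaussian_measure_def
proof (intro conjI allI impI m)
  fix \<phi> :: "'b \<Rightarrow> real" assume phi: "bounded_linear \<phi>"
  interpret prob_space m using m by (simp add: borel_prob_def)
  have sets: "sets m = sets borel" using m by (simp add: borel_prob_def)
  have "\<phi> \<in> borel_measurable borel"
    by (intro borel_measurable_continuous_onI linear_continuous_on phi)
  then have phim[measurable]: "\<phi> \<in> borel_measurable m" using sets by (simp cong: measurable_cong_sets)
  let ?D = "distr m borel \<phi>"
  have rd: "real_distribution ?D"
    by (rule real_distribution_distr) measurable
  have ch: "char ?D t = complex_of_real (exp (- (t\<^sup>2 * Q \<phi>) / 2))" for t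
  proof -
    have "char ?D t = (CLINT z|m. iexp (t * \<phi> z))"
      by (simp add: char_def integral_distr)
    also have "\<dots> = complex_of_real (exp (- (t\<^sup>2 * Q \<phi>) / 2))"
      using char[OF bounded_linear_const_mult[OF phi, of t]] scale[OF phi, of t] by simp
    finally show ?thesis .
  qed
  show "centered_gaussian ?D"
  proof (cases "Q \<phi> = 0")
    case True
    have "?D = return borel 0"
    proof (rule Levy_uniqueness[OF rd])
      show "real_distribution (return borel (0::real))"
        by (simp add: real_distribution_def real_distribution_axioms_def prob_space_return)
      show "char ?D = char (return borel 0)"
        by (rule ext, subst ch) (simp add: True char_def integral_return)
    qed
    then show ?thesis by (simp add: centered_gaussian_def)
  next
    case False
    define \<sigma> where "\<sigma> = sqrt (Q \<phi>)"
    have \<sigma>: "\<sigma> > 0" "\<sigma>\<^sup>2 = Q \<phi>" using False Q[OF phi] by (auto simp: \<sigma>_def)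
    have N: "distr std_normal_distribution borel (\<lambda>x. \<sigma> * x) = density lborel (normal_density 0 \<sigma>)"
    proof -
      have d: "distributed std_normal_distribution lborel (\<lambda>x. x) std_normal_density"
        by (auto simp: distributed_def distr_id2)
      have "distributed std_normal_distribution lborel (\<lambda>x. 0 + \<sigma> * x) (normal_density (0 + \<sigma> * 0) (\<bar>\<sigma>\<bar> * 1))"
        by (rule prob_space.normal_density_affine[OF prob_space_std_normal d]) (use \<sigma> in auto)
      then have "distr std_normal_distribution lborel (\<lambda>x. \<sigma> * x) = density lborel (normal_density 0 \<sigma>)"
        using \<sigma> by (simp add: distributed_def)
      moreover have "distr std_normal_distribution lborel (\<lambda>x. \<sigma> * x)
          = distr std_normal_distribution borel (\<lambda>x. \<sigma> * x)"
        by (rule distr_cong) auto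
      ultimately show ?thesis by simp
    qed
    have "?D = distr std_normal_distribution borel (\<lambda>x. \<sigma> * x)"
    proof (rule Levy_uniqueness[OF rd])
      show "real_distribution (distr std_normal_distribution borel (\<lambda>x. \<sigma> * x))"
        by (rule prob_space.real_distribution_distr[OF prob_space_std_normal]) auto
      show "char ?D = char (distr std_normal_distribution borel (\<lambda>x. \<sigma> * x))"
      proof
        fix t
        have "char (distr std_normal_distribution borel (\<lambda>x. \<sigma> * x)) t = char std_normal_distribution (t * \<sigma>)"
          by (simp add: char_def integral_distr mult_ac)
        also have "\<dots> = complex_of_real (exp (- (t\<^sup>2 * Q \<phi>) / 2))"
          unfolding char_std_normal_distribution using \<sigma> by (simp add: power_mult_distrib)
        finally show "char ?D t = char (distr std_normal_distribution borel (\<lambda>x. \<sigma> * x)) t"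
          by (simp add: ch)
      qed
    qed
    then show ?thesis unfolding centered_gaussian_def N using \<sigma> by blast
  qed
qed

declare gauss_seq_coord_measurable[measurable del]

section \<open>Trigonometric polynomials and weak mixing\<close>

text \<open>The span of the characters, generated inductively so that bilinear statements about
  characters extend by induction. Products stay inside because a product of two characters is a
  character.\<close>

inductive trig_poly :: "('b::real_normed_vector \<Rightarrow> complex) \<Rightarrow> bool" where
  char: "bounded_linear \<phi> \<Longrightarrow> trig_poly (\<lambda>z. iexp (\<phi> z))"
| add: "trig_poly f \<Longrightarrow> trig_poly g \<Longrightarrow> trig_poly (\<lambda>z. f z + g z)"
| cmult: "trig_poly f \<Longrightarrow> trig_poly (\<lambda>z. c * f z)"

lemma trig_poly_const: "trig_poly (\<lambda>z. c)"
  using trig_poly.cmult[OF trig_poly.char[OF bounded_linear_zero], of c] by simp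

lemma trig_poly_mult_char:
  assumes "trig_poly f" "bounded_linear \<phi>"
  shows "trig_poly (\<lambda>z. iexp (\<phi> z) * f z)"
  using assms
proof (induction rule: trig_poly.induct)
  case (char \<psi>)
  then show ?case
    using trig_poly.char[OF bounded_linear_add[of \<phi> \<psi>]] by (simp add: exp_add distrib_left)
next
  case (add f g)
  then show ?case using trig_poly.add[of "\<lambda>z. iexp (\<phi> z) * f z" "\<lambda>z. iexp (\<phi> z) * g z"]
    by (simp add: distrib_left)
next
  case (cmult f c)
  then show ?case using trig_poly.cmult[of "\<lambda>z. iexp (\<phi> z) * f z" c] by (simp add: mult_ac)
qed

lemma trig_poly_mult:
  assumes "trig_poly f" "trig_poly g"
  shows "trig_poly (\<lambda>z. f z * g z)"
  using assms
proof (induction rule: trig_poly.induct)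
  case (char \<phi>)
  then show ?case using trig_poly_mult_char by blast
next
  case (add f f')
  then show ?case using trig_poly.add[of "\<lambda>z. f z * g z" "\<lambda>z. f' z * g z"]
    by (simp add: distrib_right)
next
  case (cmult f c)
  then show ?case using trig_poly.cmult[of "\<lambda>z. f z * g z" c] by (simp add: mult_ac)
qed

lemma trig_poly_measurable:
  "trig_poly f \<Longrightarrow> f \<in> borel_measurable borel"
proof (induction rule: trig_poly.induct)
  case (char \<phi>)
  have [measurable]: "\<phi> \<in> borel_measurable borel"
    by (intro borel_measurable_continuous_onI linear_continuous_on char)
  show ?case by measurable
qed auto

lemma trig_poly_bounded: "trig_poly f \<Longrightarrow> \<exists>B. \<forall>z. cmod (f z) \<le> B"
proof (induction rule: trig_poly.induct)
  case (char \<phi>)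
  show ?case by (rule exI[of _ 1]) simp
next
  case (add f g)
  then obtain A B where "\<forall>z. cmod (f z) \<le> A" "\<forall>z. cmod (g z) \<le> B" by blast
  then show ?case by (intro exI[of _ "A + B"]) (auto intro: norm_triangle_le add_mono)
next
  case (cmult f c)
  then obtain A where "\<forall>z. cmod (f z) \<le> A" by blast
  then show ?case by (intro exI[of _ "cmod c * A"]) (auto simp: norm_mult intro: mult_left_mono)
qed

lemma trig_poly_sin:
  assumes "bounded_linear \<phi>"
  shows "trig_poly (\<lambda>z. complex_of_real (sin (\<phi> z)))"
proof -
  have "trig_poly (\<lambda>z. (1 / (2 * \<i>)) * iexp (\<phi> z) + (- 1 / (2 * \<i>)) * iexp (- \<phi> z))"
    by (intro trig_poly.add trig_poly.cmult trig_poly.char assms bounded_linear_minus)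
  moreover have "(1 / (2 * \<i>)) * iexp (\<phi> z) + (- 1 / (2 * \<i>)) * iexp (- \<phi> z) = complex_of_real (sin (\<phi> z))" for z
    by (simp add: sin_of_real[symmetric] sin_exp_eq field_simps)
  ultimately show ?thesis by simp
qed

lemma trig_poly_polynomial:
  assumes "real_polynomial_function p" "trig_poly (\<lambda>z. complex_of_real (s z))"
  shows "trig_poly (\<lambda>z. complex_of_real (p (s z :: real)))"
  using assms(1)
proof (induction rule: real_polynomial_function.induct)
  case (linear h)
  then interpret bounded_linear h by simp
  have "h (s z) = h 1 * s z" for z using scaleR[of "s z" 1] by simp
  then show ?case using trig_poly.cmult[OF assms(2), of "h 1"] by simp
next
  case (const c)
  show ?case by (rule trig_poly_const)
next
  case (add f g)
  then show ?case using trig_poly.add by fastforce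
next
  case (mult f g)
  then show ?case using trig_poly_mult by fastforce
qed

text \<open>The bound \<open>M\<close> on the approximants is what makes products of approximable functions
  approximable in \<open>L\<^sup>1\<close>.\<close>

definition trig_approx :: "'b::real_normed_vector measure \<Rightarrow> 'b measure \<Rightarrow> real \<Rightarrow> ('b \<Rightarrow> complex) \<Rightarrow> bool" where
  "trig_approx m1 m2 M f \<longleftrightarrow> f \<in> borel_measurable borel \<and> (\<forall>z. cmod (f z) \<le> M) \<and>
     (\<forall>\<epsilon>>0. \<exists>p. trig_poly p \<and> (\<forall>z. cmod (p z) \<le> M) \<and>
        (LINT z|m1. cmod (f z - p z)) \<le> \<epsilon> \<and> (LINT z|m2. cmod (f z - p z)) \<le> \<epsilon>)"

lemma borel_prob_integrable_bounded:
  fixes f :: "'b::topological_space \<Rightarrow> 'c::{banach, second_countable_topology}"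
  assumes "borel_prob m" "f \<in> borel_measurable borel" "\<And>z. norm (f z) \<le> B"
  shows "integrable m f"
proof -
  interpret prob_space m using assms by (simp add: borel_prob_def)
  have "f \<in> borel_measurable m" using assms by (simp add: borel_prob_def cong: measurable_cong_sets)
  then show ?thesis using assms(3) by (intro integrable_const_bound[where B=B]) auto
qed

lemma borel_prob_integral_le:
  fixes f :: "'b::topological_space \<Rightarrow> real"
  assumes "borel_prob m" "f \<in> borel_measurable borel" "\<And>z. 0 \<le> f z" "\<And>z. f z \<le> B"
  shows "integral\<^sup>L m f \<le> B"
proof -
  interpret prob_space m using assms by (simp add: borel_prob_def)
  have "0 \<le> B" using assms(3,4)[of undefined] by linarith
  then have "integral\<^sup>L m f \<le> (LINT z|m. B)"
    using assms by (intro integral_mono borel_prob_integrable_bounded[of m _ B]) auto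
  then show ?thesis by (simp add: prob_space)
qed

lemma borel_prob_integrable_norm_diff:
  fixes f g :: "'b::topological_space \<Rightarrow> 'c::{banach, second_countable_topology}"
  assumes "borel_prob m" "f \<in> borel_measurable borel" "g \<in> borel_measurable borel"
    "\<And>z. norm (f z) \<le> B" "\<And>z. norm (g z) \<le> B"
  shows "integrable m (\<lambda>z. norm (f z - g z))"
proof (rule borel_prob_integrable_bounded[OF assms(1)])
  show "(\<lambda>z. norm (f z - g z)) \<in> borel_measurable borel" using assms(2,3) by simp
  show "norm (norm (f z - g z)) \<le> B + B" for z
    using norm_triangle_ineq4[of "f z" "g z"] assms(4,5)[of z] by simp
qed

text \<open>Bounded pointwise convergence implies convergence in the mean for both measures; the
  bound \<open>M\<close> survives because it is imposed on every approximant.\<close>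

lemma trig_approx_lim:
  assumes m: "borel_prob m1" "borel_prob m2"
    and f: "\<And>k::nat. trig_approx m1 m2 M (f k)" and lim: "\<And>z. (\<lambda>k. f k z) \<longlonglongrightarrow> g z"
  shows "trig_approx m1 m2 M g"
proof -
  have fm: "\<And>k. f k \<in> borel_measurable borel" and fb: "\<And>k z. cmod (f k z) \<le> M"
    using f by (auto simp: trig_approx_def)
  have gm: "g \<in> borel_measurable borel" by (rule borel_measurable_LIMSEQ_metric[OF fm]) (use lim in auto)
  have gb: "cmod (g z) \<le> M" for z
    by (rule LIMSEQ_le_const2[OF tendsto_norm[OF lim]]) (use fb in auto)
  have L: "(\<lambda>k. LINT z|m. cmod (g z - f k z)) \<longlonglongrightarrow> 0" if m: "borel_prob m" for m
  proof -
    interpret prob_space m using m by (simp add: borel_prob_def)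
    have [measurable]: "g \<in> borel_measurable m" "\<And>k. f k \<in> borel_measurable m"
      using m gm fm by (simp_all add: borel_prob_def cong: measurable_cong_sets)
    have "(\<lambda>k. LINT z|m. cmod (g z - f k z)) \<longlonglongrightarrow> (LINT z|m. 0)"
    proof (rule integral_dominated_convergence[where w="\<lambda>_. 2 * M"])
      show "AE z in m. (\<lambda>k. cmod (g z - f k z)) \<longlonglongrightarrow> 0"
      proof (rule AE_I2)
        fix z
        show "(\<lambda>k. cmod (g z - f k z)) \<longlonglongrightarrow> 0"
          using tendsto_norm[OF tendsto_diff[OF tendsto_const[of "g z"] lim[of z]]] by simp
      qed
      show "AE z in m. norm (cmod (g z - f k z)) \<le> 2 * M" for k
        by (rule AE_I2) (use gb fb in \<open>smt (verit) norm_triangle_ineq4 real_norm_def norm_ge_zero\<close>)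
    qed auto
    then show ?thesis by simp
  qed
  show ?thesis unfolding trig_approx_def
  proof (intro conjI allI impI gm gb)
    fix \<epsilon> :: real assume "\<epsilon> > 0"
    then have "\<forall>\<^sub>F k in sequentially. (LINT z|m1. cmod (g z - f k z)) < \<epsilon>/2 \<and> (LINT z|m2. cmod (g z - f k z)) < \<epsilon>/2"
      by (intro eventually_conj order_tendstoD(2)[OF L] m) auto
    then obtain k where k: "(LINT z|m1. cmod (g z - f k z)) < \<epsilon>/2" "(LINT z|m2. cmod (g z - f k z)) < \<epsilon>/2"
      by (auto simp: eventually_sequentially)
    obtain p where p: "trig_poly p" "\<And>z. cmod (p z) \<le> M"
      "(LINT z|m1. cmod (f k z - p z)) \<le> \<epsilon>/2" "(LINT z|m2. cmod (f k z - p z)) \<le> \<epsilon>/2"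
      using f[of k] \<open>\<epsilon> > 0\<close> unfolding trig_approx_def by (meson half_gt_zero)
    have t: "(LINT z|m. cmod (g z - p z)) \<le> (LINT z|m. cmod (g z - f k z)) + (LINT z|m. cmod (f k z - p z))"
      if "borel_prob m" for m
    proof -
      note [measurable] = gm fm trig_poly_measurable[OF p(1)]
      have i: "integrable m (\<lambda>z. cmod (g z - f k z))" "integrable m (\<lambda>z. cmod (f k z - p z))"
        "integrable m (\<lambda>z. cmod (g z - p z))"
        using gb fb p(2) by (auto intro!: borel_prob_integrable_norm_diff[OF that, where B=M])
      have "(LINT z|m. cmod (g z - p z)) \<le> (LINT z|m. cmod (g z - f k z) + cmod (f k z - p z))"
        using i by (intro integral_mono) (auto intro: norm_triangle_le simp: dist_norm[symmetric] dist_triangle)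
      then show ?thesis using i by simp
    qed
    show "\<exists>p. trig_poly p \<and> (\<forall>z. cmod (p z) \<le> M) \<and>
        (LINT z|m1. cmod (g z - p z)) \<le> \<epsilon> \<and> (LINT z|m2. cmod (g z - p z)) \<le> \<epsilon>"
      using p k t[OF m(1)] t[OF m(2)] by (intro exI[of _ p]) auto
  qed
qed

lemma trig_approx_mult:
  assumes m: "borel_prob m1" "borel_prob m2"
    and f: "trig_approx m1 m2 M f" and g: "trig_approx m1 m2 N g"
  shows "trig_approx m1 m2 (M * N) (\<lambda>z. f z * g z)"
proof -
  have fm[measurable]: "f \<in> borel_measurable borel" and fb: "\<And>z. cmod (f z) \<le> M"
    and gm[measurable]: "g \<in> borel_measurable borel" and gb: "\<And>z. cmod (g z) \<le> N"
    using f g by (auto simp: trig_approx_def)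
  have MN: "M \<ge> 0" "N \<ge> 0" using fb[of undefined] gb[of undefined] norm_ge_zero order_trans by blast+
  show ?thesis unfolding trig_approx_def
  proof (intro conjI allI impI)
    show "cmod (f z * g z) \<le> M * N" for z
      using fb gb MN by (simp add: norm_mult mult_mono)
    fix \<epsilon> :: real assume "\<epsilon> > 0"
    \<comment> \<open>The product costs \<open>N * \<delta> + M * \<delta>\<close>; the extra 1
      covers the case \<open>M = N = 0\<close>.\<close>
    define \<delta> where "\<delta> = \<epsilon> / (M + N + 1)"
    have \<delta>: "\<delta> > 0" "(M + N) * \<delta> \<le> \<epsilon>" using \<open>\<epsilon> > 0\<close> MN by (auto simp: \<delta>_def field_simps)
    obtain p where p: "trig_poly p" "\<And>z. cmod (p z) \<le> M"
      "(LINT z|m1. cmod (f z - p z)) \<le> \<delta>" "(LINT z|m2. cmod (f z - p z)) \<le> \<delta>"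
      using f \<delta>(1) unfolding trig_approx_def by meson
    obtain q where q: "trig_poly q" "\<And>z. cmod (q z) \<le> N"
      "(LINT z|m1. cmod (g z - q z)) \<le> \<delta>" "(LINT z|m2. cmod (g z - q z)) \<le> \<delta>"
      using g \<delta>(1) unfolding trig_approx_def by meson
    note [measurable] = trig_poly_measurable[OF p(1)] trig_poly_measurable[OF q(1)]
    have t: "(LINT z|m. cmod (f z * g z - p z * q z)) \<le> N * (LINT z|m. cmod (f z - p z)) + M * (LINT z|m. cmod (g z - q z))"
      if m: "borel_prob m" for m
    proof -
      have i: "integrable m (\<lambda>z. cmod (f z - p z))"
        using fb p(2) by (auto intro!: borel_prob_integrable_norm_diff[OF m, where B=M])
      have i': "integrable m (\<lambda>z. cmod (g z - q z))"
        using gb q(2) by (auto intro!: borel_prob_integrable_norm_diff[OF m, where B=N])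
      have i'': "integrable m (\<lambda>z. cmod (f z * g z - p z * q z))"
        using fb gb p(2) q(2) MN
        by (auto intro!: borel_prob_integrable_norm_diff[OF m, where B="M*N"] mult_mono simp: norm_mult)
      have "(LINT z|m. cmod (f z * g z - p z * q z)) \<le> (LINT z|m. N * cmod (f z - p z) + M * cmod (g z - q z))"
      proof (intro integral_mono i'')
        show "integrable m (\<lambda>z. N * cmod (f z - p z) + M * cmod (g z - q z))" using i i' by simp
        fix z
        have "f z * g z - p z * q z = (f z - p z) * g z + p z * (g z - q z)" by (simp add: algebra_simps)
        then have "cmod (f z * g z - p z * q z) \<le> cmod (f z - p z) * cmod (g z) + cmod (p z) * cmod (g z - q z)"
          by (metis norm_mult norm_triangle_ineq)
        also have "\<dots> \<le> cmod (f z - p z) * N + M * cmod (g z - q z)"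
          using gb p(2) by (intro add_mono mult_mono) (auto intro: order_trans[OF norm_ge_zero])
        finally show "cmod (f z * g z - p z * q z) \<le> N * cmod (f z - p z) + M * cmod (g z - q z)"
          by (simp add: mult_ac)
      qed
      then show ?thesis using i i' by simp
    qed
    have b: "N * a + M * b \<le> \<epsilon>" if "a \<le> \<delta>" "b \<le> \<delta>" for a b
      using mult_left_mono[OF that(1) MN(2)] mult_left_mono[OF that(2) MN(1)] \<delta>(2)
      by (simp add: algebra_simps)
    show "\<exists>p. trig_poly p \<and> (\<forall>z. cmod (p z) \<le> M * N) \<and>
        (LINT z|m1. cmod (f z * g z - p z)) \<le> \<epsilon> \<and> (LINT z|m2. cmod (f z * g z - p z)) \<le> \<epsilon>"
      using p(2) q(2) MN
      by (intro exI[of _ "\<lambda>z. p z * q z"] conjI trig_poly_mult p q allI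
          order_trans[OF t[OF m(1)] b] order_trans[OF t[OF m(2)] b])
        (auto simp: norm_mult intro: mult_mono)
  qed measurable
qed

text \<open>Since \<open>n sin (x / n)\<close> is bounded and tends to \<open>x\<close>, Weierstrass approximation in the variable
  \<open>sin (x / n)\<close> reaches all bounded continuous functions of \<open>\<phi>\<close>.\<close>

lemma trig_approx_sin:
  assumes m: "borel_prob m1" "borel_prob m2" and phi: "bounded_linear \<phi>"
    and G: "continuous_on UNIV G" "\<And>x. 0 \<le> G x" "\<And>x. G x \<le> (1::real)"
  shows "trig_approx m1 m2 2 (\<lambda>z. complex_of_real (G (real n * sin (\<phi> z / real n))))"
proof -
  have [measurable]: "\<phi> \<in> borel_measurable borel"
    by (intro borel_measurable_continuous_onI linear_continuous_on phi)
  have [measurable]: "G \<in> borel_measurable borel" using G(1) by (rule borel_measurable_continuous_onI)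
  show ?thesis unfolding trig_approx_def
  proof (intro conjI allI impI)
    show "cmod (complex_of_real (G (real n * sin (\<phi> z / real n)))) \<le> 2" for z
      using G(2,3)[of "real n * sin (\<phi> z / real n)"] by simp
    fix \<epsilon> :: real assume "\<epsilon> > 0"
    \<comment> \<open>Capped at 1 so that the polynomial stays within 1 of \<open>G\<close>, whose
      values lie between 0 and 1; this is the source of the bound 2.\<close>
    define \<delta> where "\<delta> = min \<epsilon> 1"
    have "\<delta> > 0" using \<open>\<epsilon> > 0\<close> by (simp add: \<delta>_def)
    have c: "continuous_on {-1..1} (\<lambda>x. G (real n * x))"
      by (rule continuous_on_compose2[OF G(1)]) (auto intro!: continuous_intros)
    have "\<exists>P. real_polynomial_function P \<and> (\<forall>x\<in>{-1..1}. \<bar>G (real n * x) - P x\<bar> < \<delta>)" (is ?P)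
    proof (rule Stone_Weierstrass_real_polynomial_function[OF compact_Icc c \<open>\<delta> > 0\<close>])
      fix g :: "real \<Rightarrow> real"
      assume "real_polynomial_function g" "\<And>x. x \<in> {-1..1} \<Longrightarrow> \<bar>G (real n * x) - g x\<bar> < \<delta>"
      then show ?P by blast
    qed
    then obtain P where P: "real_polynomial_function P" "\<And>x. x \<in> {-1..1} \<Longrightarrow> \<bar>G (real n * x) - P x\<bar> < \<delta>"
      by blast
    define p where "p z = complex_of_real (P (sin (\<phi> z / real n)))" for z
    have "bounded_linear (\<lambda>z. \<phi> z / real n)"
      using bounded_linear_compose[OF bounded_linear_divide[of "real n"] phi] by simp
    then have p: "trig_poly p" unfolding p_def
      by (rule trig_poly_polynomial[OF P(1) trig_poly_sin])
    note [measurable] = trig_poly_measurable[OF p]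
    have d: "cmod (complex_of_real (G (real n * sin (\<phi> z / real n))) - p z) \<le> \<delta>" for z
      using P(2)[of "sin (\<phi> z / real n)"] by (simp add: p_def flip: of_real_diff)
    have pb: "cmod (p z) \<le> 2" for z
    proof -
      have "\<bar>G (real n * sin (\<phi> z / real n)) - P (sin (\<phi> z / real n))\<bar> < 1"
        using P(2)[of "sin (\<phi> z / real n)"] by (simp add: \<delta>_def)
      then have "\<bar>P (sin (\<phi> z / real n))\<bar> \<le> 2"
        using G(2,3)[of "real n * sin (\<phi> z / real n)"] by linarith
      then show ?thesis by (simp add: p_def)
    qed
    have "(LINT z|m. cmod (complex_of_real (G (real n * sin (\<phi> z / real n))) - p z)) \<le> \<epsilon>"
      if "borel_prob m" for m
    proof -
      have "(LINT z|m. cmod (complex_of_real (G (real n * sin (\<phi> z / real n))) - p z)) \<le> \<delta>"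
        by (rule borel_prob_integral_le[OF that _ _ d]) simp_all
      then show ?thesis by (simp add: \<delta>_def)
    qed
    with p pb m show "\<exists>p. trig_poly p \<and> (\<forall>z. cmod (p z) \<le> 2) \<and>
       (LINT z|m1. cmod (complex_of_real (G (real n * sin (\<phi> z / real n))) - p z)) \<le> \<epsilon> \<and>
       (LINT z|m2. cmod (complex_of_real (G (real n * sin (\<phi> z / real n))) - p z)) \<le> \<epsilon>"
      by blast
  qed measurable
qed

lemma tendsto_n_sin: "(\<lambda>n. real n * sin (x / real n)) \<longlonglongrightarrow> x"
proof (cases "x = 0")
  case False
  have "((\<lambda>y. sin y / y) \<longlongrightarrow> 1) (at (0::real))"
    using DERIV_sin[of 0] by (simp add: DERIV_def)
  moreover have "filterlim (\<lambda>n. x / real n) (at 0) sequentially"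
    unfolding filterlim_at using False
    by (auto intro!: lim_const_over_n eventually_sequentiallyI[of 1])
  ultimately have "(\<lambda>n. sin (x / real n) / (x / real n)) \<longlonglongrightarrow> 1"
    by (rule filterlim_compose)
  then have "(\<lambda>n. x * (sin (x / real n) / (x / real n))) \<longlonglongrightarrow> x * 1"
    by (intro tendsto_intros)
  moreover have "x * (sin (x / real n) / (x / real n)) = real n * sin (x / real n)" for n
    using False by simp
  ultimately show ?thesis by simp
qed simp

lemma trig_approx_halfspace:
  fixes a :: real
  assumes m: "borel_prob m1" "borel_prob m2" and phi: "bounded_linear \<phi>"
  shows "trig_approx m1 m2 2 (\<lambda>z. of_bool (\<phi> z \<le> a))"
proof -
  \<comment> \<open>A ramp that is 1 up to \<open>a\<close> and, for positive \<open>k\<close>, 0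
    from \<open>a + 1 / k\<close> on. The limit in \<open>n\<close> of the sine approximation is
    taken for fixed \<open>k\<close>, the limit in \<open>k\<close> afterwards.\<close>
  define G where "G k x = max 0 (min 1 (1 - real k * (x - a)))" for k :: nat and x :: real
  have "trig_approx m1 m2 2 (\<lambda>z. complex_of_real (G k (\<phi> z)))" for k
  proof (rule trig_approx_lim[OF m])
    show "trig_approx m1 m2 2 (\<lambda>z. complex_of_real (G k (real n * sin (\<phi> z / real n))))" for n
      by (rule trig_approx_sin[OF m phi]) (auto simp: G_def intro!: continuous_intros)
    show "(\<lambda>n. complex_of_real (G k (real n * sin (\<phi> z / real n)))) \<longlonglongrightarrow> complex_of_real (G k (\<phi> z))" for z
      unfolding G_def by (intro tendsto_intros tendsto_n_sin)
  qed
  then show ?thesis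
  proof (rule trig_approx_lim[OF m])
    fix z
    have "(\<lambda>k. G k (\<phi> z)) \<longlonglongrightarrow> of_bool (\<phi> z \<le> a)"
    proof (cases "\<phi> z \<le> a")
      case True
      then have "real k * (\<phi> z - a) \<le> 0" for k by (simp add: mult_le_0_iff)
      then have "G k (\<phi> z) = 1" for k by (simp add: G_def)
      with True show ?thesis by simp
    next
      case False
      then obtain k0 :: nat where k0: "real k0 * (\<phi> z - a) \<ge> 1"
        using reals_Archimedean3[of "\<phi> z - a"] by (metis less_eq_real_def diff_gt_0_iff_gt not_le)
      have "G k (\<phi> z) = 0" if "k \<ge> k0" for k
      proof -
        have "real k0 * (\<phi> z - a) \<le> real k * (\<phi> z - a)"
          using that False by (intro mult_right_mono) auto
        then show ?thesis using k0 by (simp add: G_def)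
      qed
      then have "\<forall>\<^sub>F k in sequentially. G k (\<phi> z) = 0" by (auto simp: eventually_sequentially)
      then show ?thesis using False by (simp add: tendsto_eventually)
    qed
    then show "(\<lambda>k. complex_of_real (G k (\<phi> z))) \<longlonglongrightarrow> of_bool (\<phi> z \<le> a)"
      using tendsto_of_real by fastforce
  qed
qed

lemma trig_approx_halfspace_inter:
  fixes I :: "('b::real_inner \<times> real) set"
  assumes m: "borel_prob m1" "borel_prob m2" and "finite I"
  shows "trig_approx m1 m2 (2 ^ card I) (\<lambda>z. of_bool (z \<in> halfspace_inter I))"
  using \<open>finite I\<close>
proof (induction I)
  case empty
  have "\<exists>p. trig_poly p \<and> (\<forall>z. cmod (p z) \<le> 1) \<and>
        (LINT z|m1. cmod (1 - p z)) \<le> \<epsilon> \<and> (LINT z|m2. cmod (1 - p z)) \<le> \<epsilon>" if "\<epsilon> > 0" for \<epsilon>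
    using that by (intro exI[of _ "\<lambda>_. 1"]) (auto intro: trig_poly_const)
  then show ?case by (simp add: trig_approx_def halfspace_inter_def)
next
  case (insert x I)
  have "trig_approx m1 m2 (2 * 2 ^ card I)
     (\<lambda>z. of_bool (inner (fst x) z \<le> snd x) * of_bool (z \<in> halfspace_inter I))"
    by (intro trig_approx_mult m insert trig_approx_halfspace bounded_linear_inner_right)
  moreover have "of_bool (inner (fst x) z \<le> snd x) * of_bool (z \<in> halfspace_inter I)
     = (of_bool (z \<in> halfspace_inter (insert x I)) :: complex)" for z
    by (auto simp: halfspace_inter_def)
  ultimately show ?case using insert by simp
qed

section \<open>Uniqueness of the characteristic functional\<close>

lemma integral_of_bool:
  assumes "borel_prob m" "A \<in> sets borel"
  shows "(CLINT z|m. of_bool (z \<in> A)) = measure m A"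
proof -
  interpret prob_space m using assms by (simp add: borel_prob_def)
  have A: "A \<in> sets m" using assms by (simp add: borel_prob_def)
  have "(CLINT z|m. of_bool (z \<in> A)) = (CLINT z|m. complex_of_real (indicator A z))"
    by (intro Bochner_Integration.integral_cong) (auto simp: indicator_def)
  also have "\<dots> = complex_of_real (LINT z|m. indicator A z)" by (rule integral_complex_of_real)
  finally show ?thesis using A by (simp add: Int_absorb2 sets.sets_into_space)
qed

text \<open>By linearity the two measures agree on trigonometric polynomials. One polynomial
  approximates the indicator of a half-space intersection for both measures simultaneously, which is
  why \<open>trig_approx\<close> carries two of them.\<close>

lemma measure_eq_of_char_functional:
  fixes m1 m2 :: "'b::{real_inner} measure"
  assumes sep: "separable_type TYPE('b)" and m: "borel_prob m1" "borel_prob m2"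
    and char: "\<And>\<phi>. bounded_linear \<phi> \<Longrightarrow> (CLINT z|m1. iexp (\<phi> z)) = (CLINT z|m2. iexp (\<phi> z))"
  shows "m1 = m2"
proof -
  interpret m1: prob_space m1 using m by (simp add: borel_prob_def)
  interpret m2: prob_space m2 using m by (simp add: borel_prob_def)
  have sets: "sets m1 = sets borel" "sets m2 = sets borel" using m by (auto simp: borel_prob_def)
  have int: "integrable m1 p \<and> integrable m2 p" if p: "trig_poly p" for p :: "'b \<Rightarrow> complex"
  proof -
    obtain B where "\<forall>z. cmod (p z) \<le> B" using trig_poly_bounded[OF p] by blast
    then show ?thesis using borel_prob_integrable_bounded trig_poly_measurable[OF p] m by blast
  qed
  have tp: "integral\<^sup>L m1 p = integral\<^sup>L m2 p" if "trig_poly p" for p :: "'b \<Rightarrow> complex"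
    using that
  proof (induction rule: trig_poly.induct)
    case (add f g)
    then show ?case using int by simp
  qed (simp_all add: char)
  have "measure m1 (halfspace_inter I) = measure m2 (halfspace_inter I)" if "finite I" for I :: "('b \<times> real) set"
  proof -
    let ?f = "\<lambda>z. of_bool (z \<in> halfspace_inter I) :: complex"
    have ta: "trig_approx m1 m2 (2 ^ card I) ?f" by (rule trig_approx_halfspace_inter[OF m that])
    have "cmod (integral\<^sup>L m1 ?f - integral\<^sup>L m2 ?f) \<le> \<epsilon>" if "\<epsilon> > 0" for \<epsilon>
    proof -
      have "\<exists>p. trig_poly p \<and> (\<forall>z. cmod (p z) \<le> 2 ^ card I) \<and>
        (LINT z|m1. cmod (?f z - p z)) \<le> \<epsilon>/2 \<and> (LINT z|m2. cmod (?f z - p z)) \<le> \<epsilon>/2"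
        using ta \<open>\<epsilon> > 0\<close> unfolding trig_approx_def by (meson half_gt_zero)
      then obtain p where p: "trig_poly p" "(LINT z|m1. cmod (?f z - p z)) \<le> \<epsilon>/2" "(LINT z|m2. cmod (?f z - p z)) \<le> \<epsilon>/2"
        by blast
      have fm: "?f \<in> borel_measurable borel" "\<And>z. cmod (?f z) \<le> 2 ^ card I" using ta by (auto simp: trig_approx_def)
      have fi: "integrable m1 ?f" "integrable m2 ?f"
        using borel_prob_integrable_bounded[OF _ fm] m by blast+
      have "cmod (integral\<^sup>L m1 ?f - integral\<^sup>L m1 p) \<le> \<epsilon>/2"
        using integral_norm_bound[of m1 "\<lambda>z. ?f z - p z"] fi int[OF p(1)] p(2) by simp
      moreover have "cmod (integral\<^sup>L m2 ?f - integral\<^sup>L m2 p) \<le> \<epsilon>/2"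
        using integral_norm_bound[of m2 "\<lambda>z. ?f z - p z"] fi int[OF p(1)] p(3) by simp
      ultimately show ?thesis using tp[OF p(1)]
        by (smt (verit, ccfv_SIG) field_sum_of_halves norm_diff_triangle_le norm_minus_commute)
    qed
    then have "cmod (integral\<^sup>L m1 ?f - integral\<^sup>L m2 ?f) \<le> 0"
      by (rule field_le_epsilon[of _ 0, simplified])
    then show ?thesis
      using halfspace_inter_measurable[OF that] by (simp add: integral_of_bool[OF m(1)] integral_of_bool[OF m(2)])
  qed
  then have eq: "emeasure m1 A = emeasure m2 A" if "A \<in> halfspace_inter ` {I. finite I}" for A
    using that by (auto simp: m1.emeasure_eq_measure m2.emeasure_eq_measure)
  show ?thesis
  proof (rule measure_eqI_generator_eq[OF Int_stable_halfspace_inter _ eq, of UNIV])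
    show "sets m1 = sigma_sets UNIV (halfspace_inter ` {I. finite I})"
      "sets m2 = sigma_sets UNIV (halfspace_inter ` {I. finite I})"
      using sets sets_borel_halfspaces[OF sep] by auto
    have "UNIV = halfspace_inter ({} :: ('b \<times> real) set)" by (simp add: halfspace_inter_def)
    then show "range (\<lambda>i::nat. UNIV :: 'b set) \<subseteq> halfspace_inter ` {I. finite I}" by auto
  qed auto
qed

section \<open>Sequences with vanishing absolute Cesaro means\<close>

definition cesaro_null :: "(nat \<Rightarrow> real) \<Rightarrow> bool" where
  "cesaro_null a \<longleftrightarrow> (\<lambda>N. (\<Sum>n=1..N. \<bar>a n\<bar>) / real N) \<longlonglongrightarrow> 0"

text \<open>The form in which limits are taken: it is enough to dominate up to an arbitrarily small
  constant, and the dominating sequence may depend on that constant.\<close>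

lemma cesaro_null_approx:
  assumes "\<And>\<epsilon>. \<epsilon> > 0 \<Longrightarrow> \<exists>b. cesaro_null b \<and> (\<forall>n. \<bar>a n\<bar> \<le> \<bar>b n\<bar> + \<epsilon>)"
  shows "cesaro_null a"
  unfolding cesaro_null_def
proof (rule LIMSEQ_I)
  fix r :: real assume "r > 0"
  then obtain b where b: "cesaro_null b" "\<And>n. \<bar>a n\<bar> \<le> \<bar>b n\<bar> + r/2" using assms[of "r/2"] by auto
  have "\<forall>\<^sub>F N in sequentially. (\<Sum>n=1..N. \<bar>b n\<bar>) / real N < r/2"
    using b(1) \<open>r > 0\<close> unfolding cesaro_null_def by (intro order_tendstoD) auto
  then obtain N0 where N0: "\<And>N. N \<ge> N0 \<Longrightarrow> (\<Sum>n=1..N. \<bar>b n\<bar>) / real N < r/2"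
    by (auto simp: eventually_sequentially)
  have "(\<Sum>n=1..N. \<bar>a n\<bar>) / real N < r" if "N \<ge> N0" for N
  proof -
    have "(\<Sum>n=1..N. \<bar>a n\<bar>) / real N \<le> (\<Sum>n=1..N. \<bar>b n\<bar> + r/2) / real N"
      by (intro divide_right_mono sum_mono b) auto
    also have "\<dots> = (\<Sum>n=1..N. \<bar>b n\<bar>) / real N + real N * (r/2) / real N"
      by (simp add: sum.distrib add_divide_distrib)
    also have "\<dots> \<le> (\<Sum>n=1..N. \<bar>b n\<bar>) / real N + r/2" using \<open>r > 0\<close> by simp
    finally show ?thesis using N0[OF that] by linarith
  qed
  moreover have "0 \<le> (\<Sum>n=1..N. \<bar>a n\<bar>) / real N" for N by (intro divide_nonneg_nonneg sum_nonneg) auto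
  ultimately show "\<exists>no. \<forall>N\<ge>no. norm ((\<Sum>n=1..N. \<bar>a n\<bar>) / real N - 0) < r"
    by (intro exI[of _ N0]) auto
qed

lemma cesaro_null_mono:
  assumes "cesaro_null b" "\<And>n. \<bar>a n\<bar> \<le> \<bar>b n\<bar>" shows "cesaro_null a"
  using assms by (intro cesaro_null_approx) (auto intro!: exI[of _ b] add_increasing2)

lemma cesaro_null_add:
  assumes "cesaro_null a" "cesaro_null b" shows "cesaro_null (\<lambda>n. \<bar>a n\<bar> + \<bar>b n\<bar>)"
  using tendsto_add[OF assms[unfolded cesaro_null_def]]
  by (simp add: cesaro_null_def sum.distrib add_divide_distrib)

lemma cesaro_null_cmult:
  assumes "cesaro_null a" shows "cesaro_null (\<lambda>n. c * a n)"
  using tendsto_mult_left[OF assms[unfolded cesaro_null_def], of "\<bar>c\<bar>"]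
  by (simp add: cesaro_null_def abs_mult sum_distrib_left)

lemma cesaro_null_zero: "cesaro_null (\<lambda>n. 0)"
  by (simp add: cesaro_null_def)

lemma cesaro_null_sum:
  assumes "\<And>i. i < (k::nat) \<Longrightarrow> cesaro_null (a i)" shows "cesaro_null (\<lambda>n. \<Sum>i<k. \<bar>a i n\<bar>)"
  using assms
proof (induction k)
  case (Suc k)
  then have "cesaro_null (\<lambda>n. \<bar>\<Sum>i<k. \<bar>a i n\<bar>\<bar> + \<bar>a k n\<bar>)"
    by (intro cesaro_null_add) auto
  then show ?case by (rule cesaro_null_mono) (auto simp: sum_nonneg)
qed (simp add: cesaro_null_zero)

lemma norm_product_diff_le:
  fixes a b c d :: complex
  shows "cmod (a * b - c * d) \<le> cmod (a - c) * cmod b + cmod c * cmod (b - d)"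
proof -
  have "a * b - c * d = (a - c) * b + c * (b - d)" by (simp add: algebra_simps)
  then show ?thesis by (metis norm_mult norm_triangle_ineq)
qed

section \<open>Correlations under a measure-preserving map\<close>

locale measure_dynamics =
  fixes m :: "'b::real_inner measure" and T :: "'b \<Rightarrow> 'b"
  assumes bp: "borel_prob m" and Tm: "T \<in> borel_measurable borel"
    and inv: "invariant_measure m T"
begin

lemma sets_m: "sets m = sets borel" using bp by (simp add: borel_prob_def)

lemma space_m: "space m = UNIV" using sets_eq_imp_space_eq[OF sets_m] by simp

sublocale prob_space m using bp by (simp add: borel_prob_def)

lemma Tn_measurable[measurable]: "(T ^^ n) \<in> borel_measurable borel"
  by (induction n) (auto intro: measurable_compose[OF _ Tm] simp: comp_def Tm)

lemma distr_T: "distr m borel T = m"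
proof (rule measure_eqI)
  show "sets (distr m borel T) = sets m" by (simp add: sets_m)
  fix A assume "A \<in> sets (distr m borel T)"
  then show "emeasure (distr m borel T) A = emeasure m A"
    using inv Tm by (subst emeasure_distr) (auto simp: invariant_measure_def sets_m space_m cong: measurable_cong_sets)
qed

lemma distr_Tn: "distr m borel (T ^^ n) = m"
proof (induction n)
  case 0
  show ?case using distr_id2[of borel m] sets_m by (simp add: id_def)
next
  case (Suc n)
  have "distr m borel (T \<circ> (T ^^ n)) = distr (distr m borel (T ^^ n)) borel T"
    by (rule distr_distr[symmetric]) (use Tm in \<open>auto simp: sets_m cong: measurable_cong_sets\<close>)
  then show ?case by (simp only: funpow.simps Suc distr_T)
qed

lemma borel_m: "f \<in> borel_measurable borel \<Longrightarrow> f \<in> borel_measurable m"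
  using sets_m by (simp cong: measurable_cong_sets)

lemma integral_Tn:
  fixes f :: "'b \<Rightarrow> 'c::{banach, second_countable_topology}"
  assumes "f \<in> borel_measurable borel"
  shows "(LINT z|m. f ((T ^^ n) z)) = integral\<^sup>L m f"
  using integral_distr[of "T ^^ n" m borel f] borel_m[OF Tn_measurable, of n] assms
  by (simp add: distr_Tn)

lemma measure_Tn:
  assumes "A \<in> sets borel" shows "measure m ((T ^^ n) -` A) = measure m A"
  using measure_distr[of "T ^^ n" m borel A] borel_m[OF Tn_measurable, of n] assms
  by (simp add: distr_Tn space_m)

lemma Tn_vimage: "A \<in> sets borel \<Longrightarrow> (T ^^ n) -` A \<in> sets m"
  using measurable_sets[OF Tn_measurable, of A n] by (simp add: sets_m)

definition corr :: "('b \<Rightarrow> complex) \<Rightarrow> ('b \<Rightarrow> complex) \<Rightarrow> nat \<Rightarrow> complex" where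
  "corr f g n = (CLINT z|m. f ((T ^^ n) z) * g z) - integral\<^sup>L m f * integral\<^sup>L m g"

lemma bounded_integrable:
  fixes f :: "'b \<Rightarrow> complex"
  assumes "f \<in> borel_measurable borel" "\<And>z. cmod (f z) \<le> B"
  shows "integrable m f"
  using borel_prob_integrable_bounded[OF bp assms] .

lemma corr_integrable:
  assumes [measurable]: "f \<in> borel_measurable borel" "g \<in> borel_measurable borel"
    and "\<And>z. cmod (f z) \<le> M" "\<And>z. cmod (g z) \<le> N"
  shows "integrable m (\<lambda>z. f ((T ^^ n) z) * g z)"
proof (rule bounded_integrable)
  show "cmod (f ((T ^^ n) z) * g z) \<le> M * N" for z
    unfolding norm_mult using assms(3,4) by (intro mult_mono) (auto intro: order_trans[OF norm_ge_zero])
qed measurable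

text \<open>The joint integral and the product of means each move by at most \<open>M\<close> times
  the sum of the two mean distances. The bound is uniform in \<open>n\<close> because
  \<open>T ^^ n\<close> preserves the measure, so composing with it does not change the distance
  between \<open>f\<close> and \<open>f'\<close>.\<close>

lemma corr_approx:
  assumes m: "f \<in> borel_measurable borel" "g \<in> borel_measurable borel"
     "f' \<in> borel_measurable borel" "g' \<in> borel_measurable borel"
    and b: "\<And>z. cmod (f z) \<le> M" "\<And>z. cmod (g z) \<le> M" "\<And>z. cmod (f' z) \<le> M" "\<And>z. cmod (g' z) \<le> M"
  shows "cmod (corr f g n) \<le> cmod (corr f' g' n)
    + 2 * M * (LINT z|m. cmod (f z - f' z)) + 2 * M * (LINT z|m. cmod (g z - g' z))"
proof -
  note [measurable] = m
  have M: "M \<ge> 0" using b(1)[of undefined] norm_ge_zero order_trans by blast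
  have i: "integrable m f" "integrable m g" "integrable m f'" "integrable m g'"
    using m b by (simp_all add: bounded_integrable[where B=M])
  have ci: "integrable m (\<lambda>z. f ((T ^^ n) z) * g z)" "integrable m (\<lambda>z. f' ((T ^^ n) z) * g' z)"
    using m b by (simp_all add: corr_integrable[where M=M and N=M])
  have df: "integrable m (\<lambda>z. cmod (f z - f' z))" and dg: "integrable m (\<lambda>z. cmod (g z - g' z))"
    using i by auto
  have dfT: "integrable m (\<lambda>z. cmod (f ((T ^^ n) z) - f' ((T ^^ n) z)))"
    by (rule borel_prob_integrable_norm_diff[OF bp, where B=M]) (use b in auto)
  define F where "F = (LINT z|m. cmod (f z - f' z))"
  define G where "G = (LINT z|m. cmod (g z - g' z))"
  have "cmod ((CLINT z|m. f ((T ^^ n) z) * g z) - (CLINT z|m. f' ((T ^^ n) z) * g' z))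
     = cmod (CLINT z|m. f ((T ^^ n) z) * g z - f' ((T ^^ n) z) * g' z)"
    using ci by simp
  also have "\<dots> \<le> (LINT z|m. cmod (f ((T ^^ n) z) * g z - f' ((T ^^ n) z) * g' z))"
    by (rule integral_norm_bound)
  also have "\<dots> \<le> (LINT z|m. M * cmod (f ((T ^^ n) z) - f' ((T ^^ n) z)) + M * cmod (g z - g' z))"
  proof (rule integral_mono)
    fix z
    let ?y = "(T ^^ n) z"
    have "cmod (f ?y * g z - f' ?y * g' z) \<le> cmod (f ?y - f' ?y) * cmod (g z) + cmod (f' ?y) * cmod (g z - g' z)"
      by (rule norm_product_diff_le)
    also have "\<dots> \<le> cmod (f ?y - f' ?y) * M + M * cmod (g z - g' z)"
      using b M by (intro add_mono mult_mono) auto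
    finally show "cmod (f ?y * g z - f' ?y * g' z) \<le> M * cmod (f ?y - f' ?y) + M * cmod (g z - g' z)"
      by (simp add: mult_ac)
  qed (use ci dg dfT in auto)
  also have "\<dots> = M * F + M * G"
    using dg dfT integral_Tn[of "\<lambda>z. cmod (f z - f' z)" n] by (simp add: F_def G_def)
  finally have 1: "cmod ((CLINT z|m. f ((T ^^ n) z) * g z) - (CLINT z|m. f' ((T ^^ n) z) * g' z)) \<le> M * F + M * G" .
  have le: "cmod (integral\<^sup>L m h) \<le> M" if "h \<in> borel_measurable borel" "\<And>z. cmod (h z) \<le> M" for h
    by (rule order_trans[OF integral_norm_bound borel_prob_integral_le[OF bp]]) (use that in auto)
  have "cmod (integral\<^sup>L m f * integral\<^sup>L m g - integral\<^sup>L m f' * integral\<^sup>L m g')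
     \<le> cmod (CLINT z|m. f z - f' z) * cmod (integral\<^sup>L m g) + cmod (integral\<^sup>L m f') * cmod (CLINT z|m. g z - g' z)"
    using norm_product_diff_le[of "integral\<^sup>L m f" "integral\<^sup>L m g"] i by simp
  also have "\<dots> \<le> F * M + M * G"
    unfolding F_def G_def using le[OF m(2) b(2)] le[OF m(3) b(3)] M
    by (intro add_mono mult_mono integral_norm_bound) (auto intro: integral_nonneg_AE)
  finally have 2: "cmod (integral\<^sup>L m f * integral\<^sup>L m g - integral\<^sup>L m f' * integral\<^sup>L m g') \<le> M * F + M * G"
    by (simp add: mult_ac)
  have "corr f g n = corr f' g' n
     + (((CLINT z|m. f ((T ^^ n) z) * g z) - (CLINT z|m. f' ((T ^^ n) z) * g' z))
     - (integral\<^sup>L m f * integral\<^sup>L m g - integral\<^sup>L m f' * integral\<^sup>L m g'))"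
    by (simp add: corr_def)
  also have "cmod \<dots> \<le> cmod (corr f' g' n) + ((M * F + M * G) + (M * F + M * G))"
    by (intro order_trans[OF norm_triangle_ineq] add_left_mono order_trans[OF norm_triangle_ineq4] add_mono 1 2)
  finally show ?thesis by (simp add: F_def G_def)
qed

text \<open>Correlations are bilinear, hence the hypothesis passes to trigonometric polynomials, and
  continuous in the mean uniformly in time, hence it passes to half-space intersections. Arbitrary
  Borel sets follow by a Dynkin argument in one set while the other is fixed.\<close>

lemma weakly_mixing_of_characters:
  assumes sep: "separable_type TYPE('b)"
    and ch: "\<And>\<phi> \<psi>. bounded_linear \<phi> \<Longrightarrow> bounded_linear \<psi> \<Longrightarrow>
       cesaro_null (\<lambda>n. cmod (corr (\<lambda>z. iexp (\<phi> z)) (\<lambda>z. iexp (\<psi> z)) n))"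
  shows "weakly_mixing m T"
proof -
  have tint: "integrable m (\<lambda>z. f ((T ^^ n) z) * g z)" "integrable m f" "integrable m g"
    if f: "trig_poly f" and g: "trig_poly g" for f g n
  proof -
    obtain A where A: "\<forall>z. cmod (f z) \<le> A" using trig_poly_bounded[OF f] by blast
    obtain B where B: "\<forall>z. cmod (g z) \<le> B" using trig_poly_bounded[OF g] by blast
    show "integrable m (\<lambda>z. f ((T ^^ n) z) * g z)" "integrable m f" "integrable m g"
      using A B by (auto intro: corr_integrable bounded_integrable trig_poly_measurable f g)
  qed
  have add1: "corr (\<lambda>z. f z + f' z) g n = corr f g n + corr f' g n"
    if "trig_poly f" "trig_poly f'" "trig_poly g" for f f' g n
    using tint[OF that(1,3)] tint[OF that(2,3)] by (simp add: corr_def distrib_right)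
  have add2: "corr f (\<lambda>z. g z + g' z) n = corr f g n + corr f g' n"
    if "trig_poly f" "trig_poly g" "trig_poly g'" for f g g' n
    using tint[OF that(1,2)] tint[OF that(1,3)] by (simp add: corr_def distrib_left)
  have cm1: "corr (\<lambda>z. c * f z) g n = c * corr f g n" for c f g n
    by (simp add: corr_def mult.assoc right_diff_distrib)
  have cm2: "corr f (\<lambda>z. c * g z) n = c * corr f g n" for c f g n
    by (simp add: corr_def mult.left_commute right_diff_distrib)
  have t1: "cesaro_null (\<lambda>n. cmod (corr f (\<lambda>z. iexp (\<psi> z)) n))"
    if f: "trig_poly f" and psi: "bounded_linear \<psi>" for f \<psi>
    using f
  proof (induction rule: trig_poly.induct)
    case (char \<phi>)
    then show ?case using ch psi by blast
  next
    case (add f f')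
    show ?case
      by (rule cesaro_null_mono[OF cesaro_null_add[OF add.IH]])
        (simp add: add1[OF add.hyps trig_poly.char[OF psi]] norm_triangle_ineq)
  next
    case (cmult f c)
    show ?case using cesaro_null_cmult[OF cmult.IH, of "cmod c"] by (simp add: cm1 norm_mult)
  qed
  have t2: "cesaro_null (\<lambda>n. cmod (corr f g n))" if f: "trig_poly f" and g: "trig_poly g" for f g
    using g
  proof (induction rule: trig_poly.induct)
    case (char \<phi>)
    then show ?case using t1[OF f] by blast
  next
    case (add g g')
    show ?case
      by (rule cesaro_null_mono[OF cesaro_null_add[OF add.IH]])
        (simp add: add2[OF f add.hyps] norm_triangle_ineq)
  next
    case (cmult g c)
    show ?case using cesaro_null_cmult[OF cmult.IH, of "cmod c"] by (simp add: cm2 norm_mult)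
  qed
  define d where "d A B n = measure m ((T ^^ n) -` A \<inter> B) - measure m A * measure m B" for A B n
  have d_corr: "complex_of_real (d A B n) = corr (\<lambda>z. of_bool (z \<in> A)) (\<lambda>z. of_bool (z \<in> B)) n"
    if "A \<in> sets borel" "B \<in> sets borel" for A B n
  proof -
    have "(T ^^ n) -` A \<inter> B \<in> sets borel" using Tn_vimage[OF that(1), of n] that(2) sets_m by auto
    then have "(CLINT z|m. of_bool (z \<in> (T ^^ n) -` A \<inter> B)) = measure m ((T ^^ n) -` A \<inter> B)"
      by (rule integral_of_bool[OF bp])
    moreover have "of_bool (z \<in> (T ^^ n) -` A \<inter> B) = (of_bool ((T ^^ n) z \<in> A) * of_bool (z \<in> B) :: complex)" for z
      by auto
    ultimately show ?thesis
      using that by (simp add: d_def corr_def integral_of_bool[OF bp])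
  qed
  have base: "cesaro_null (d (halfspace_inter I) (halfspace_inter I'))"
    if I: "finite I" "finite I'" for I I'
  proof (rule cesaro_null_approx)
    fix \<epsilon> :: real assume "\<epsilon> > 0"
    let ?f = "\<lambda>z. of_bool (z \<in> halfspace_inter I) :: complex"
    let ?g = "\<lambda>z. of_bool (z \<in> halfspace_inter I') :: complex"
    define M :: real where "M = max (2 ^ card I) (2 ^ card I')"
    have M: "M > 0" by (simp add: M_def less_max_iff_disj)
    \<comment> \<open>\<open>corr_approx\<close> multiplies each of the two errors by
      \<open>2 * M\<close>, which yields \<open>\<epsilon> / 2\<close> each.\<close>
    have "\<epsilon> / (4 * M) > 0" using M \<open>\<epsilon> > 0\<close> by simp
    then have "\<exists>p. trig_poly p \<and> (\<forall>z. cmod (p z) \<le> 2 ^ card I) \<and> (LINT z|m. cmod (?f z - p z)) \<le> \<epsilon> / (4 * M)"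
      "\<exists>p. trig_poly p \<and> (\<forall>z. cmod (p z) \<le> 2 ^ card I') \<and> (LINT z|m. cmod (?g z - p z)) \<le> \<epsilon> / (4 * M)"
      using trig_approx_halfspace_inter[OF bp bp I(1)] trig_approx_halfspace_inter[OF bp bp I(2)]
      unfolding trig_approx_def by meson+
    then obtain p q where p: "trig_poly p" "\<And>z. cmod (p z) \<le> 2 ^ card I" "(LINT z|m. cmod (?f z - p z)) \<le> \<epsilon> / (4 * M)"
      and q: "trig_poly q" "\<And>z. cmod (q z) \<le> 2 ^ card I'" "(LINT z|m. cmod (?g z - q z)) \<le> \<epsilon> / (4 * M)"
      by blast
    have pM: "cmod (p z) \<le> M" "cmod (q z) \<le> M" for z
      using p(2)[of z] q(2)[of z] by (auto simp: M_def)
    have fM: "cmod (?f z) \<le> M" "cmod (?g z) \<le> M" for z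
      by (auto simp: M_def le_max_iff_disj)
    note hm = halfspace_inter_measurable[OF I(1)] halfspace_inter_measurable[OF I(2)]
    have bnd: "2 * M * x \<le> \<epsilon> / 2" if "x \<le> \<epsilon> / (4 * M)" for x
      using that M by (simp add: field_simps)
    show "\<exists>b. cesaro_null b \<and> (\<forall>n. \<bar>d (halfspace_inter I) (halfspace_inter I') n\<bar> \<le> \<bar>b n\<bar> + \<epsilon>)"
    proof (intro exI[of _ "\<lambda>n. cmod (corr p q n)"] conjI allI t2 p q)
      fix n
      have "cmod (corr ?f ?g n) \<le> cmod (corr p q n)
          + 2 * M * (LINT z|m. cmod (?f z - p z)) + 2 * M * (LINT z|m. cmod (?g z - q z))"
        by (rule corr_approx[OF _ _ trig_poly_measurable[OF p(1)] trig_poly_measurable[OF q(1)] fM pM])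
          (use hm in simp_all)
      also have "\<dots> \<le> cmod (corr p q n) + \<epsilon> / 2 + \<epsilon> / 2"
        by (intro add_mono order_refl bnd p q)
      finally show "\<bar>d (halfspace_inter I) (halfspace_inter I') n\<bar> \<le> \<bar>cmod (corr p q n)\<bar> + \<epsilon>"
        using d_corr[OF hm, of n] by (metis add.assoc abs_norm_cancel field_sum_of_halves norm_of_real)
    qed
  qed
  have d_compl1: "\<bar>d (UNIV - A) B n\<bar> = \<bar>d A B n\<bar>" if "A \<in> sets borel" "B \<in> sets borel" for A B n
  proof -
    have "(T ^^ n) -` (UNIV - A) \<inter> B = B - (T ^^ n) -` A \<inter> B" by auto
    then have 1: "measure m ((T ^^ n) -` (UNIV - A) \<inter> B) = measure m B - measure m ((T ^^ n) -` A \<inter> B)"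
      using that Tn_vimage[OF that(1), of n] by (auto simp: sets_m intro!: finite_measure_Diff)
    have 2: "measure m (UNIV - A) = 1 - measure m A"
      using prob_compl[of A] that by (simp add: sets_m space_m)
    have "d (UNIV - A) B n = - d A B n"
      unfolding d_def 1 2 by (simp add: algebra_simps)
    then show ?thesis by simp
  qed
  have d_compl2: "\<bar>d A (UNIV - B) n\<bar> = \<bar>d A B n\<bar>" if "A \<in> sets borel" "B \<in> sets borel" for A B n
  proof -
    have "(T ^^ n) -` A \<inter> (UNIV - B) = (T ^^ n) -` A - (T ^^ n) -` A \<inter> B" by auto
    then have 1: "measure m ((T ^^ n) -` A \<inter> (UNIV - B)) = measure m A - measure m ((T ^^ n) -` A \<inter> B)"
      using that Tn_vimage[OF that(1), of n] measure_Tn[OF that(1), of n]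
        finite_measure_Diff[of "(T ^^ n) -` A" "(T ^^ n) -` A \<inter> B"]
      by (auto simp: sets_m)
    have 2: "measure m (UNIV - B) = 1 - measure m B"
      using prob_compl[of B] that by (simp add: sets_m space_m)
    have "d A (UNIV - B) n = - d A B n"
      unfolding d_def 1 2 by (simp add: algebra_simps)
    then show ?thesis by simp
  qed
  have split1: "d (A \<union> A') B n = d A B n + d A' B n" if "A \<in> sets borel" "A' \<in> sets borel" "B \<in> sets borel" "A \<inter> A' = {}" for A A' B n
  proof -
    have "(T ^^ n) -` (A \<union> A') \<inter> B = ((T ^^ n) -` A \<inter> B) \<union> ((T ^^ n) -` A' \<inter> B)" by auto
    moreover have "((T ^^ n) -` A \<inter> B) \<inter> ((T ^^ n) -` A' \<inter> B) = {}" using that(4) by auto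
    ultimately have "measure m ((T ^^ n) -` (A \<union> A') \<inter> B) = measure m ((T ^^ n) -` A \<inter> B) + measure m ((T ^^ n) -` A' \<inter> B)"
      using that Tn_vimage[OF that(1), of n] Tn_vimage[OF that(2), of n]
      by (simp add: sets_m finite_measure_Union)
    then show ?thesis using that by (simp add: d_def sets_m finite_measure_Union algebra_simps)
  qed
  have split2: "d A (B \<union> B') n = d A B n + d A B' n" if "A \<in> sets borel" "B \<in> sets borel" "B' \<in> sets borel" "B \<inter> B' = {}" for A B B' n
  proof -
    have "(T ^^ n) -` A \<inter> (B \<union> B') = ((T ^^ n) -` A \<inter> B) \<union> ((T ^^ n) -` A \<inter> B')" by auto
    moreover have "((T ^^ n) -` A \<inter> B) \<inter> ((T ^^ n) -` A \<inter> B') = {}" using that(4) by auto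
    ultimately have "measure m ((T ^^ n) -` A \<inter> (B \<union> B')) = measure m ((T ^^ n) -` A \<inter> B) + measure m ((T ^^ n) -` A \<inter> B')"
      using that Tn_vimage[OF that(1), of n]
      by (simp add: sets_m finite_measure_Union)
    then show ?thesis using that by (simp add: d_def sets_m finite_measure_Union algebra_simps)
  qed
  \<comment> \<open>Domination by the measure of a single set, uniformly in \<open>n\<close>; it
    lets the tail of a disjoint union be dropped.\<close>
  have small: "\<bar>d A B n\<bar> \<le> measure m A" "\<bar>d A B n\<bar> \<le> measure m B" if "A \<in> sets borel" "B \<in> sets borel" for A B n
  proof -
    have 1: "measure m ((T ^^ n) -` A \<inter> B) \<le> measure m A"
      using finite_measure_mono[of "(T ^^ n) -` A \<inter> B" "(T ^^ n) -` A"] Tn_vimage[OF that(1), of n]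
        measure_Tn[OF that(1), of n] by auto
    have 2: "measure m ((T ^^ n) -` A \<inter> B) \<le> measure m B"
      using finite_measure_mono[of "(T ^^ n) -` A \<inter> B" B] that by (auto simp: sets_m)
    have "0 \<le> measure m A * measure m B" "measure m A * measure m B \<le> measure m A" "measure m A * measure m B \<le> measure m B"
      by (auto intro!: mult_left_le mult_left_le_one_le)
    then show "\<bar>d A B n\<bar> \<le> measure m A" "\<bar>d A B n\<bar> \<le> measure m B"
      using 1 2 measure_nonneg[of m "(T ^^ n) -` A \<inter> B"] unfolding d_def by linarith+
  qed
  \<comment> \<open>Stated for an abstract \<open>D\<close>, since it serves once for the first set
    and once for the second. A finite part of the union carries all but \<epsilon> of its
    measure.\<close>
  have dynkin: "cesaro_null (D (\<Union>i. A i))"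
    if D: "\<And>A A' n. A \<in> sets borel \<Longrightarrow> A' \<in> sets borel \<Longrightarrow> A \<inter> A' = {} \<Longrightarrow> D (A \<union> A') n = D A n + D A' n"
      "\<And>A n. A \<in> sets borel \<Longrightarrow> \<bar>D A n\<bar> \<le> measure m A"
      and A: "disjoint_family A" "\<And>i::nat. A i \<in> sets borel" "\<And>i. cesaro_null (D (A i))" for D :: "'b set \<Rightarrow> nat \<Rightarrow> real" and A
  proof (rule cesaro_null_approx)
    fix \<epsilon> :: real assume "\<epsilon> > 0"
    have "(\<lambda>k. measure m (\<Union>i<k. A i)) \<longlonglongrightarrow> measure m (\<Union>k. \<Union>i<k. A i)"
    proof (intro finite_Lim_measure_incseq)
      show "range (\<lambda>k. \<Union>i<k. A i) \<subseteq> sets m" using A(2) by (auto simp: sets_m)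
      show "incseq (\<lambda>k. \<Union>i<k. A i)" by (intro monoI UN_mono) auto
    qed
    also have "(\<Union>k. \<Union>i<k. A i) = (\<Union>i. A i)" by blast
    finally have "\<forall>\<^sub>F k in sequentially. measure m (\<Union>i. A i) - \<epsilon> < measure m (\<Union>i<k. A i)"
      using \<open>\<epsilon> > 0\<close> by (intro order_tendstoD) auto
    then obtain k where k: "measure m (\<Union>i. A i) - \<epsilon> < measure m (\<Union>i<k. A i)"
      by (auto simp: eventually_sequentially)
    define R where "R = (\<Union>i. A i) - (\<Union>i<k. A i)"
    have ms: "(\<Union>i<k. A i) \<in> sets borel" "R \<in> sets borel" for k unfolding R_def using A(2) by auto
    have "measure m R = measure m (\<Union>i. A i) - measure m (\<Union>i<k. A i)"
      unfolding R_def using A(2) by (intro finite_measure_Diff) (auto simp: sets_m)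
    then have mR: "measure m R < \<epsilon>" using k by simp
    have emp: "D {} n = 0" for n using D(2)[of "{}" n] by simp
    have fin: "D (\<Union>i<j. A i) n = (\<Sum>i<j. D (A i) n)" for j n
    proof (induction j)
      case (Suc j)
      have "(\<Union>i<j. A i) \<inter> A j = {}"
        using A(1) by (auto simp: disjoint_family_on_def) (metis disjoint_iff less_irrefl)
      then have "D ((\<Union>i<j. A i) \<union> A j) n = D (\<Union>i<j. A i) n + D (A j) n"
        using D(1) ms(1) A(2) by blast
      moreover have "(\<Union>i<Suc j. A i) = (\<Union>i<j. A i) \<union> A j" by (auto simp: less_Suc_eq)
      ultimately show ?case by (simp add: Suc)
    qed (simp add: emp)
    have "(\<Union>i. A i) = (\<Union>i<k. A i) \<union> R" "(\<Union>i<k. A i) \<inter> R = {}" by (auto simp: R_def)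
    then have eq: "D (\<Union>i. A i) n = (\<Sum>i<k. D (A i) n) + D R n" for n
      using D(1)[OF ms(1) ms(2), of k n] fin by simp
    have "\<bar>D (\<Union>i. A i) n\<bar> \<le> \<bar>\<Sum>i<k. \<bar>D (A i) n\<bar>\<bar> + \<epsilon>" for n
    proof -
      have "\<bar>D R n\<bar> \<le> \<epsilon>" using D(2)[OF ms(2), of n] mR by simp
      moreover have "\<bar>\<Sum>i<k. D (A i) n\<bar> \<le> (\<Sum>i<k. \<bar>D (A i) n\<bar>)" by (rule sum_abs)
      ultimately show ?thesis unfolding eq by linarith
    qed
    then show "\<exists>b. cesaro_null b \<and> (\<forall>n. \<bar>D (\<Union>i. A i) n\<bar> \<le> \<bar>b n\<bar> + \<epsilon>)"
      using cesaro_null_sum[of k "\<lambda>i. D (A i)"] A(3) by blast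
  qed
  let ?G = "halfspace_inter ` {I :: ('b \<times> real) set. finite I}"
  have sb: "sets (borel :: 'b measure) = sigma_sets UNIV ?G" by (rule sets_borel_halfspaces[OF sep])
  have GP: "?G \<subseteq> Pow UNIV" by auto
  have step1: "cesaro_null (d A (halfspace_inter I))" if A: "A \<in> sigma_sets UNIV ?G" and I: "finite I" for A I
    using A
  proof (induction rule: sigma_sets_induct_disjoint[OF Int_stable_halfspace_inter GP,
      consumes 1, case_names basic empty compl union])
    case (basic A)
    then show ?case using base I by blast
  next
    case empty
    show ?case by (simp add: d_def cesaro_null_def)
  next
    case (compl A)
    then show ?case
      by (elim cesaro_null_mono) (use d_compl1 halfspace_inter_measurable[OF I] sb in auto)
  next
    case (union A)
    then have "A i \<in> sets borel" for i using sb by auto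
    then show ?case
      using union split1 small(1) halfspace_inter_measurable[OF I]
      by (intro dynkin[of "\<lambda>A. d A (halfspace_inter I)"]) auto
  qed
  have step2: "cesaro_null (d A B)" if B: "B \<in> sigma_sets UNIV ?G" and A: "A \<in> sets borel" for A B
    using B
  proof (induction rule: sigma_sets_induct_disjoint[OF Int_stable_halfspace_inter GP,
      consumes 1, case_names basic empty compl union])
    case (basic B)
    then show ?case using step1 A sb by blast
  next
    case empty
    show ?case by (simp add: d_def cesaro_null_def)
  next
    case (compl B)
    then show ?case
      by (elim cesaro_null_mono) (use d_compl2 A sb in auto)
  next
    case (union B)
    then have "B i \<in> sets borel" for i using sb by auto
    then show ?case
      using union split2 small(2) A
      by (intro dynkin[of "\<lambda>B. d A B"]) auto
  qed
  show ?thesis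
    unfolding weakly_mixing_def using step2 sb by (auto simp: sets_m cesaro_null_def d_def)
qed

end

section \<open>Spectral measures\<close>

lemma norm_geometric_sum_le:
  fixes w :: complex
  assumes "cmod w = 1" "w \<noteq> 1"
  shows "cmod (\<Sum>n=1..N. w ^ n) \<le> 2 / cmod (1 - w)"
proof -
  have "(\<Sum>n=1..N. w ^ n) * (1 - w) = w - w ^ Suc N"
  proof (induction N)
    case (Suc N)
    have "(\<Sum>n=1..Suc N. w ^ n) * (1 - w) = (\<Sum>n=1..N. w ^ n) * (1 - w) + w ^ Suc N * (1 - w)"
      by (simp add: distrib_right)
    then show ?case unfolding Suc.IH by (simp add: right_diff_distrib)
  qed simp
  then have "cmod (\<Sum>n=1..N. w ^ n) * cmod (1 - w) = cmod (w - w ^ Suc N)"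
    by (metis norm_mult)
  also have "\<dots> \<le> 2"
    using norm_triangle_ineq4[of w "w ^ Suc N"] assms(1) by (simp add: norm_mult norm_power)
  finally show ?thesis using assms(2) by (simp add: pos_le_divide_eq)
qed

lemma iexp_power: "iexp t ^ k = iexp (real k * t)"
  by (simp add: exp_of_nat_mult[symmetric] mult_ac)

lemma iexp_cnj: "cnj (iexp t) = iexp (- t)"
  by (simp add: exp_cnj)

lemma iexp_add: "iexp (a + b) = iexp a * iexp b"
  by (simp add: exp_add distrib_left)

lemma fourier_orthogonality:
  fixes s :: int
  shows "has_bochner_integral lborel (\<lambda>t. indicator {0..2*pi} t *\<^sub>R iexp (s * t)) (if s = 0 then complex_of_real (2 * pi) else 0)"
proof (cases "s = 0")
  case True
  have "has_bochner_integral lborel (\<lambda>t. indicator {0..2*pi} t *\<^sub>R (1::complex)) (2 * pi)"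
    using has_bochner_integral_indicator[of "{0..2*pi}" lborel "1::complex"]
    by (simp add: scaleR_conv_of_real)
  then show ?thesis using True by simp
next
  case False
  let ?F = "\<lambda>t::real. iexp (s * t) / (\<i> * s)"
  have "has_bochner_integral lborel (\<lambda>t. indicator {0..2*pi} t *\<^sub>R iexp (s * t)) (?F (2*pi) - ?F 0)"
  proof (rule has_bochner_integral_FTC_Icc)
    fix t :: real
    have "((\<lambda>t. iexp (s * t)) has_vector_derivative (\<i> * s) * iexp (s * t)) (at t within {0..2*pi})"
    proof -
      have "((\<lambda>z. exp (\<i> * (s * z))) has_field_derivative (\<i> * s) * iexp (s * t)) (at (of_real t))"
        by (auto intro!: derivative_eq_intros simp: mult_ac)
      from has_vector_derivative_real_field[OF this] show ?thesis by simp
    qed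
    then have "((\<lambda>t. iexp (s * t) / (\<i> * s)) has_vector_derivative ((\<i> * s) * iexp (s * t)) / (\<i> * s)) (at t within {0..2*pi})"
      by (rule has_vector_derivative_divide)
    then show "(?F has_vector_derivative iexp (s * t)) (at t within {0..2*pi})"
      using False by simp
  qed (auto intro!: continuous_intros)
  moreover have "iexp (s * (2 * pi)) = 1"
    using exp_integer_2pi[of "of_int s"] by (simp add: mult_ac)
  ultimately show ?thesis using False by simp
qed

text \<open>The measure is a weak limit of the Fejer densities
  \<open>\<integral> |\<Sum>j<N. X\<^sub>j e\<^bsup>ijt\<^esup>|\<^sup>2 / (2 \<pi> N)\<close> on \<open>[0, 2 \<pi>]\<close>.\<close>

lemma herglotz:
  fixes X :: "nat \<Rightarrow> 'a \<Rightarrow> real" and c :: "nat \<Rightarrow> real"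
  assumes int: "\<And>i j. integrable m (\<lambda>x. X i x * X j x)"
    and cov: "\<And>i j. (LINT x|m. X i x * X (i + j) x) = c j" and c0: "c 0 = 1"
  obtains M where "real_distribution M" "\<And>r::nat. char M r = c r"
proof -
  define e where "e s t = iexp (of_int s * t)" for s :: int and t
  have e_mult: "e a t * cnj (e b t) = e (a - b) t" for a b t
    by (simp add: e_def exp_cnj exp_add[symmetric] algebra_simps)
  \<comment> \<open>Stationarity: a covariance depends only on the distance of the two indices. The
    case distinction stands in for an absolute value on natural numbers.\<close>
  define C where "C j k = c (if j \<le> k then k - j else j - k)" for j k
  have C: "(LINT x|m. X j x * X k x) = C j k" for j k
  proof (cases "j \<le> k")
    case True
    then show ?thesis using cov[of j "k - j"] by (simp add: C_def)
  next
    case False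
    then show ?thesis using cov[of k "j - k"] by (simp add: C_def mult.commute)
  qed
  define D where "D N t = (\<Sum>j<N. \<Sum>k<N. C j k * e (int j - int k) t)" for N t
  define f where "f N t = indicator {0..2*pi} t * (Re (D N t) / (2 * pi * real N))" for N t
  \<comment> \<open>Identifies \<open>D N t\<close> with the mean squared modulus of a trigonometric
    sum with coefficients \<open>X j\<close>; this shows that it is real and non-negative.\<close>
  have D_eq: "D N t = of_real ((LINT x|m. (\<Sum>j<N. X j x * cos (j * t))\<^sup>2 + (\<Sum>j<N. X j x * sin (j * t))\<^sup>2))" for N t
  proof -
    have "complex_of_real ((\<Sum>j<N. X j x * cos (j * t))\<^sup>2 + (\<Sum>j<N. X j x * sin (j * t))\<^sup>2)
       = (\<Sum>j<N. \<Sum>k<N. (X j x * X k x) * e (int j - int k) t)" (is "?l = ?r") for x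
    proof -
      let ?z = "\<Sum>j<N. complex_of_real (X j x) * e (int j) t"
      have "?z = Complex (\<Sum>j<N. X j x * cos (j * t)) (\<Sum>j<N. X j x * sin (j * t))"
        by (simp add: complex_eq_iff e_def Re_exp Im_exp)
      then have "?l = ?z * cnj ?z"
        by (simp add: complex_mult_cnj)
      also have "\<dots> = ?r"
        unfolding cnj_sum sum_product by (intro sum.cong refl) (simp add: e_mult[symmetric])
      finally show ?thesis .
    qed
    moreover have ic: "integrable m (\<lambda>x. complex_of_real (X j x * X k x) * z)" for j k z
      using int by (intro integrable_mult_left integrable_of_real)
    ultimately have "of_real ((LINT x|m. (\<Sum>j<N. X j x * cos (j * t))\<^sup>2 + (\<Sum>j<N. X j x * sin (j * t))\<^sup>2))
      = (CLINT x|m. (\<Sum>j<N. \<Sum>k<N. (X j x * X k x) * e (int j - int k) t))"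
      by (simp only: flip: integral_complex_of_real)
    also have "\<dots> = (\<Sum>j<N. \<Sum>k<N. CLINT x|m. complex_of_real (X j x * X k x) * e (int j - int k) t)"
      using ic by (simp add: Bochner_Integration.integral_sum del: of_real_mult)
    also have "\<dots> = D N t"
      unfolding D_def by (simp only: integral_mult_left_zero integral_complex_of_real C)
    finally show ?thesis by simp
  qed
  have D_nonneg: "0 \<le> Re (D N t)" and D_Re: "complex_of_real (Re (D N t)) = D N t" for N t
    unfolding D_eq by (auto intro!: integral_nonneg_AE)
  have Dc: "continuous_on UNIV (D N)" for N
    unfolding D_def e_def by (intro continuous_intros)
  have f0: "f N t \<ge> 0" for N t using D_nonneg by (simp add: f_def)
  have fm[measurable]: "f N \<in> borel_measurable borel" for N
  proof -
    have [measurable]: "D N \<in> borel_measurable borel" by (rule borel_measurable_continuous_onI[OF Dc])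
    show ?thesis unfolding f_def by measurable
  qed
  \<comment> \<open>Orthogonality leaves the pairs with \<open>k = j + r\<close>, of which there are
    \<open>N - r\<close>; truncated subtraction gives the right value for \<open>r\<close> beyond
    \<open>N\<close> as well.\<close>
  have f_int: "has_bochner_integral lborel (\<lambda>t. f N t *\<^sub>R iexp (r * t)) ((real (N - r) / N) * c r)"
    if N: "N > 0" for N and r :: nat
  proof -
    have "has_bochner_integral lborel (\<lambda>t. (\<Sum>j<N. \<Sum>k<N. (C j k / (2 * pi * real N)) *\<^sub>R
        (indicator {0..2*pi} t *\<^sub>R iexp (of_int (int j - int k + int r) * t))))
      (\<Sum>j<N. \<Sum>k<N. (C j k / (2 * pi * real N)) *\<^sub>R (if int j - int k + int r = 0 then complex_of_real (2 * pi) else 0))"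
      by (intro has_bochner_integral_sum has_bochner_integral_scaleR_right fourier_orthogonality)
    moreover have "(\<Sum>j<N. \<Sum>k<N. (C j k / (2 * pi * real N)) *\<^sub>R
        (indicator {0..2*pi} t *\<^sub>R iexp (of_int (int j - int k + int r) * t))) = f N t *\<^sub>R iexp (r * t)" for t :: real
    proof -
      have "f N t *\<^sub>R iexp (r * t) = (indicator {0..2*pi} t / (2 * pi * real N)) *\<^sub>R (D N t * iexp (r * t))"
        by (simp add: f_def scaleR_conv_of_real D_Re)
      also have "\<dots> = (\<Sum>j<N. \<Sum>k<N. (C j k / (2 * pi * real N)) *\<^sub>R
        (indicator {0..2*pi} t *\<^sub>R iexp (of_int (int j - int k + int r) * t)))"
        unfolding D_def sum_distrib_right scaleR_sum_right e_def
        by (intro sum.cong refl) (simp add: scaleR_conv_of_real distrib_right distrib_left exp_add)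
      finally show ?thesis by simp
    qed
    moreover have "(\<Sum>j<N. \<Sum>k<N. (C j k / (2 * pi * real N)) *\<^sub>R (if int j - int k + int r = 0 then complex_of_real (2 * pi) else 0))
      = (complex_of_real ((real (N - r) / N) * c r))"
    proof -
      have "(\<Sum>j<N. \<Sum>k<N. (C j k / (2 * pi * real N)) *\<^sub>R (if int j - int k + int r = 0 then complex_of_real (2 * pi) else 0))
        = (\<Sum>j<N. \<Sum>k<N. if k = j + r then complex_of_real (c r / N) else 0)"
        by (intro sum.cong refl) (auto simp: C_def scaleR_conv_of_real)
      also have "\<dots> = (\<Sum>j<N. if j + r < N then complex_of_real (c r / N) else 0)"
        by (intro sum.cong refl) (simp add: sum.delta)
      also have "\<dots> = (\<Sum>j\<in>{..<N-r}. complex_of_real (c r / N))"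
        by (intro sum.mono_neutral_cong_right) auto
      finally show ?thesis by simp
    qed
    ultimately show ?thesis by (simp only:)
  qed
  define \<mu> where "\<mu> n = density lborel (f (Suc n))" for n
  have nn: "(\<integral>\<^sup>+t. ennreal (f (Suc n) t) \<partial>lborel) = 1" for n
  proof -
    have "has_bochner_integral lborel (\<lambda>t. complex_of_real (f (Suc n) t)) 1"
      using f_int[of "Suc n" 0] c0 by (simp add: scaleR_conv_of_real del: of_nat_Suc)
    then have "has_bochner_integral lborel (\<lambda>t. f (Suc n) t) 1"
      using has_bochner_integral_Re by fastforce
    then show ?thesis
      using nn_integral_eq_integral[of lborel "f (Suc n)"] f0
      by (simp add: has_bochner_integral_iff)
  qed
  have rd: "real_distribution (\<mu> n)" for n
    unfolding real_distribution_def real_distribution_axioms_def \<mu>_def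
    using nn[of n] by (auto intro!: prob_spaceI simp: emeasure_density)
  have ch: "char (\<mu> n) r = (real (Suc n - r) / Suc n) * c r" for n and r :: nat
  proof -
    have "char (\<mu> n) r = (CLINT t|lborel. f (Suc n) t *\<^sub>R iexp (r * t))"
      unfolding char_def \<mu>_def by (subst integral_density) (auto simp: f0)
    then show ?thesis using f_int[of "Suc n" r] by (simp add: has_bochner_integral_iff)
  qed
  have tight: "tight \<mu>"
    unfolding tight_def
  proof (intro conjI allI impI rd)
    fix \<epsilon> :: real assume "\<epsilon> > 0"
    \<comment> \<open>Tightness is immediate: all densities vanish outside the interval from 0 to 2
      pi, which lies inside this one.\<close>
    have "measure (\<mu> n) {-1<..7} = 1" for n
    proof -
      interpret real_distribution "\<mu> n" by (rule rd)
      have "emeasure (\<mu> n) {-1<..7} = (\<integral>\<^sup>+t. ennreal (f (Suc n) t) * indicator {-1<..7} t \<partial>lborel)"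
        unfolding \<mu>_def by (subst emeasure_density) auto
      also have "\<dots> = (\<integral>\<^sup>+t. ennreal (f (Suc n) t) \<partial>lborel)"
        using pi_less_4 pi_approx by (intro nn_integral_cong) (auto simp: f_def indicator_def)
      finally show ?thesis by (simp add: nn emeasure_eq_measure)
    qed
    then show "\<exists>a b. a < b \<and> (\<forall>n. measure (\<mu> n) {a<..b} > 1 - \<epsilon>)"
      using \<open>\<epsilon> > 0\<close> by (intro exI[of _ "-1"] exI[of _ 7]) auto
  qed
  obtain s M where s: "strict_mono s" and M: "real_distribution M" "weak_conv_m (\<mu> \<circ> id \<circ> s) M"
    using tight_imp_convergent_subsubsequence[OF tight strict_mono_id] by blast
  have "char M r = c r" for r :: nat
  proof (rule LIMSEQ_unique)
    show "(\<lambda>n. char (\<mu> (s n)) r) \<longlonglongrightarrow> char M r"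
      using levy_continuity1[of "\<mu> \<circ> id \<circ> s" M "real r"] rd M by simp
    have "(\<lambda>n. real (Suc n - r) / Suc n) \<longlonglongrightarrow> 1"
    proof -
      have "\<forall>\<^sub>F n in sequentially. real (Suc n - r) / Suc n = 1 - real r / Suc n"
        using eventually_ge_at_top[of r] by eventually_elim (simp add: of_nat_diff field_simps)
      moreover have "(\<lambda>n. 1 - real r / Suc n) \<longlonglongrightarrow> 1"
        using tendsto_diff[OF tendsto_const[of 1] LIMSEQ_Suc[OF lim_const_over_n[of "real r"]]] by simp
      ultimately show ?thesis by (rule tendsto_cong[THEN iffD2])
    qed
    from LIMSEQ_subseq_LIMSEQ[OF this s]
    have "(\<lambda>n. complex_of_real (real (Suc (s n) - r) / Suc (s n)) * c r) \<longlonglongrightarrow> complex_of_real 1 * complex_of_real (c r)"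
      unfolding comp_def by (intro tendsto_mult tendsto_of_real tendsto_const)
    then show "(\<lambda>n. char (\<mu> (s n)) r) \<longlonglongrightarrow> c r" by (simp add: ch)
  qed
  with M(1) show ?thesis by (rule that)
qed

text \<open>Wiener's argument: the averages of \<open>(cnj \<zeta> * iexp t) ^ n\<close> are bounded
  by 1 and converge to the indicator of the set, while their integrals are dominated by the Cesaro
  means of \<open>\<bar>c n\<bar>\<close>. The atom is a set of parameters \<open>t\<close>, since
  \<open>M\<close> lives on the line and \<open>iexp\<close> is periodic.\<close>

lemma spectral_no_atoms:
  fixes c :: "nat \<Rightarrow> real"
  assumes M: "real_distribution M" and ch: "\<And>r::nat. char M r = complex_of_real (c r)"
    and ces: "cesaro_null c" and lam: "cmod \<zeta> = 1"
  shows "measure M {t. iexp t = \<zeta>} = 0"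
proof -
  interpret real_distribution M by fact
  define E where "E = {t. iexp t = \<zeta>}"
  have E: "E \<in> sets borel"
  proof -
    have "closed E" unfolding E_def by (intro closed_Collect_eq continuous_intros)
    then show ?thesis by simp
  qed
  define g where "g N t = (\<Sum>n=1..N. (cnj \<zeta> * iexp t) ^ n) / of_nat N" for N t
  have gm[measurable]: "g N \<in> borel_measurable borel" for N
    unfolding g_def by measurable
  have l1: "\<zeta> * cnj \<zeta> = 1" using complex_norm_square[of \<zeta>] lam by simp
  have w1: "cmod (cnj \<zeta> * iexp t) = 1" for t using lam by (simp add: norm_mult)
  have g1: "cmod (g N t) \<le> 1" for N t
  proof -
    have "cmod (\<Sum>n=1..N. (cnj \<zeta> * iexp t) ^ n) \<le> (\<Sum>n=1..N. 1)"
      by (intro sum_norm_le) (simp add: norm_power norm_mult lam)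
    then show ?thesis by (cases "N = 0") (auto simp: g_def norm_divide divide_le_eq_1)
  qed
  have lim: "(\<lambda>N. g N t) \<longlonglongrightarrow> complex_of_real (indicator E t)" for t
  proof (cases "t \<in> E")
    case True
    then have "cnj \<zeta> * iexp t = 1" using l1 by (simp add: E_def mult.commute)
    then have "g N t = 1" if "N \<ge> 1" for N using that by (simp add: g_def)
    then have "\<forall>\<^sub>F N in sequentially. g N t = 1" by (auto simp: eventually_sequentially)
    then show ?thesis using True by (simp add: tendsto_eventually)
  next
    case False
    have ne: "cnj \<zeta> * iexp t \<noteq> 1"
    proof
      assume "cnj \<zeta> * iexp t = 1"
      then have "\<zeta> * cnj \<zeta> * iexp t = \<zeta>" by (simp add: mult.assoc)
      then show False using False l1 by (simp add: E_def)
    qed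
    have "(\<lambda>N. (2 / cmod (1 - cnj \<zeta> * iexp t)) / real N) \<longlonglongrightarrow> 0" by (rule lim_const_over_n)
    then have "(\<lambda>N. g N t) \<longlonglongrightarrow> 0"
    proof (rule Lim_null_comparison[OF always_eventually, rotated], intro allI)
      fix N
      show "norm (g N t) \<le> (2 / cmod (1 - cnj \<zeta> * iexp t)) / real N"
        unfolding g_def norm_divide norm_of_nat
        by (intro divide_right_mono norm_geometric_sum_le w1 ne) auto
    qed
    then show ?thesis using False by simp
  qed
  have "(\<lambda>N. CLINT t|M. g N t) \<longlonglongrightarrow> (CLINT t|M. complex_of_real (indicator E t))"
    by (rule integral_dominated_convergence[where w="\<lambda>_. 1"]) (use E lim g1 in auto)
  moreover have "(CLINT t|M. complex_of_real (indicator E t)) = measure M E"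
    unfolding integral_complex_of_real using E by simp
  moreover have "(\<lambda>N. CLINT t|M. g N t) \<longlonglongrightarrow> 0"
  proof (rule Lim_null_comparison[OF always_eventually ces[unfolded cesaro_null_def]], rule allI)
    fix N
    have i: "integrable M (\<lambda>t. (cnj \<zeta> * iexp t) ^ n)" for n
      by (rule integrable_const_bound[where B=1]) (auto simp: norm_power norm_mult lam)
    have v: "(CLINT t|M. (cnj \<zeta> * iexp t) ^ n) = cnj \<zeta> ^ n * c n" for n
      using ch[of n] by (simp add: power_mult_distrib iexp_power char_def)
    have "(CLINT t|M. g N t) = (\<Sum>n=1..N. cnj \<zeta> ^ n * c n) / of_nat N"
      unfolding g_def using i by (simp add: v)
    also have "cmod \<dots> \<le> (\<Sum>n=1..N. \<bar>c n\<bar>) / real N"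
      unfolding norm_divide norm_of_nat
      by (intro divide_right_mono sum_norm_le) (auto simp: norm_mult norm_power lam)
    finally show "norm (CLINT t|M. g N t) \<le> (\<Sum>n=1..N. \<bar>c n\<bar>) / real N" .
  qed
  ultimately show ?thesis unfolding E_def[symmetric]
    using LIMSEQ_unique by (metis of_real_eq_0_iff)
qed

section \<open>Second moments of Gaussian functionals\<close>

lemma centered_gaussian_moments:
  assumes "centered_gaussian \<nu>"
  shows "integrable \<nu> (\<lambda>x. x)" "integral\<^sup>L \<nu> (\<lambda>x. x) = 0" "integrable \<nu> (\<lambda>x. x\<^sup>2)"
    "R \<ge> 0 \<Longrightarrow> measure \<nu> {-R..R} \<ge> 1/2 \<Longrightarrow> integral\<^sup>L \<nu> (\<lambda>x. x\<^sup>2) \<le> 16 * R\<^sup>2"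
proof -
  have "integrable \<nu> (\<lambda>x. x) \<and> integral\<^sup>L \<nu> (\<lambda>x. x) = 0 \<and> integrable \<nu> (\<lambda>x. x\<^sup>2) \<and>
     (R \<ge> 0 \<longrightarrow> measure \<nu> {-R..R} \<ge> 1/2 \<longrightarrow> integral\<^sup>L \<nu> (\<lambda>x. x\<^sup>2) \<le> 16 * R\<^sup>2)"
    using assms unfolding centered_gaussian_def
  proof (elim disjE exE conjE)
    assume \<nu>: "\<nu> = return borel 0"
    interpret prob_space \<nu> unfolding \<nu> by (rule prob_space_return) simp
    have AE0: "AE x in \<nu>. x = 0" unfolding \<nu> by (simp add: AE_return)
    have [measurable_cong]: "sets \<nu> = sets borel" by (simp add: \<nu>)
    have i: "integrable \<nu> h \<and> integral\<^sup>L \<nu> h = 0"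
      if [measurable]: "h \<in> borel_measurable borel" and h: "h 0 = 0" for h :: "real \<Rightarrow> real"
    proof -
      have "AE x in \<nu>. h x = 0" using AE0 h by (auto elim!: eventually_mono)
      moreover have "h \<in> borel_measurable \<nu>" using that(1) by (simp add: \<nu>)
      ultimately have "integrable \<nu> h \<longleftrightarrow> integrable \<nu> (\<lambda>x. 0::real)" "integral\<^sup>L \<nu> h = integral\<^sup>L \<nu> (\<lambda>x. 0)"
        using integrable_cong_AE[of h \<nu> "\<lambda>x. 0"] integral_cong_AE[of h \<nu> "\<lambda>x. 0"] by auto
      then show ?thesis by simp
    qed
    show ?thesis using i[of "\<lambda>x. x"] i[of "\<lambda>x. x\<^sup>2"] by simp
  next
    fix \<sigma> :: real assume \<sigma>: "\<sigma> > 0" and \<nu>: "\<nu> = density lborel (normal_density 0 \<sigma>)"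
    have nn: "AE x in lborel. 0 \<le> normal_density 0 \<sigma> x" by simp
    have h1: "has_bochner_integral lborel (\<lambda>x. normal_density 0 \<sigma> x *\<^sub>R x) 0"
      using normal_moment_nz_1[OF \<sigma>, of 0] by simp
    have h2: "has_bochner_integral lborel (\<lambda>x. normal_density 0 \<sigma> x *\<^sub>R x\<^sup>2) (\<sigma>\<^sup>2)"
      using normal_moment_even[OF \<sigma>, of 0 1] by (simp add: fact_numeral)
    have i: "integrable \<nu> (\<lambda>x. x)" "integral\<^sup>L \<nu> (\<lambda>x. x) = 0" "integrable \<nu> (\<lambda>x. x\<^sup>2)" "integral\<^sup>L \<nu> (\<lambda>x. x\<^sup>2) = \<sigma>\<^sup>2"
      using h1 h2 unfolding \<nu> has_bochner_integral_iff
      by (auto simp: integrable_density integral_density nn)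
    have "\<sigma>\<^sup>2 \<le> 16 * R\<^sup>2" if R: "R \<ge> 0" "measure \<nu> {-R..R} \<ge> 1/2"
    proof -
      \<comment> \<open>With this bound on the density the interval has mass at most
        \<open>2 * R / \<sigma>\<close>; mass at least 1/2 then forces
        \<open>\<sigma> \<le> 4 * R\<close>, whence the constant 16.\<close>
      have "normal_density 0 \<sigma> x \<le> 1 / \<sigma>" for x
      proof -
        have "1 \<le> 2 * pi" using pi_gt3 by simp
        then have "\<sigma> * 1 \<le> sqrt (2 * pi) * \<sigma>" using \<sigma> by simp
        then have "\<sigma> \<le> sqrt (2 * pi * \<sigma>\<^sup>2)" using \<sigma> by (simp add: real_sqrt_mult)
        then have "1 / sqrt (2 * pi * \<sigma>\<^sup>2) \<le> 1 / \<sigma>" using \<sigma> by (intro divide_left_mono) auto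
        moreover have "exp (- (x - 0)\<^sup>2 / (2 * \<sigma>\<^sup>2)) \<le> 1" by simp
        ultimately show ?thesis unfolding normal_density_def
          using \<sigma> by (intro order_trans[OF mult_right_le_one_le]) auto
      qed
      then have "emeasure \<nu> {-R..R} \<le> (\<integral>\<^sup>+x. ennreal (1/\<sigma>) * indicator {-R..R} x \<partial>lborel)"
        unfolding \<nu> by (subst emeasure_density) (auto intro!: nn_integral_mono mult_right_mono ennreal_leI)
      also have "\<dots> = ennreal (2 * R / \<sigma>)"
        using R(1) \<sigma> by (subst nn_integral_cmult_indicator) (auto simp: ennreal_mult[symmetric])
      finally have "measure \<nu> {-R..R} \<le> 2 * R / \<sigma>"
        using R(1) \<sigma> unfolding measure_def by (intro enn2real_leI) auto
      with R(2) have "1/2 \<le> 2 * R / \<sigma>" by linarith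
      then have "\<sigma> \<le> 4 * R" using \<sigma> by (simp add: field_simps)
      then have "\<sigma>\<^sup>2 \<le> (4 * R)\<^sup>2" using \<sigma> by (intro power_mono) auto
      then show ?thesis by (simp add: power_mult_distrib)
    qed
    then show ?thesis using i by simp
  qed
  then show "integrable \<nu> (\<lambda>x. x)" "integral\<^sup>L \<nu> (\<lambda>x. x) = 0" "integrable \<nu> (\<lambda>x. x\<^sup>2)"
    "R \<ge> 0 \<Longrightarrow> measure \<nu> {-R..R} \<ge> 1/2 \<Longrightarrow> integral\<^sup>L \<nu> (\<lambda>x. x\<^sup>2) \<le> 16 * R\<^sup>2"
    by blast+
qed

lemma gaussian_functional:
  fixes m :: "'b::real_normed_vector measure" and \<phi> :: "'b \<Rightarrow> real"
  assumes m: "gaussian_measure m" and phi: "bounded_linear \<phi>"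
  shows "integrable m \<phi>" "integral\<^sup>L m \<phi> = 0" "integrable m (\<lambda>z. (\<phi> z)\<^sup>2)"
proof -
  have sets: "sets m = sets borel" using m by (simp add: gaussian_measure_def borel_prob_def)
  have "\<phi> \<in> borel_measurable borel"
    by (intro borel_measurable_continuous_onI linear_continuous_on phi)
  then have [measurable]: "\<phi> \<in> borel_measurable m" using sets by (simp cong: measurable_cong_sets)
  have cg: "centered_gaussian (distr m borel \<phi>)" using m phi by (simp add: gaussian_measure_def)
  note c = centered_gaussian_moments(1-3)[OF cg]
  show "integrable m \<phi>" "integral\<^sup>L m \<phi> = 0" "integrable m (\<lambda>z. (\<phi> z)\<^sup>2)"
    using c by (simp_all add: integrable_distr_eq integral_distr)
qed

text \<open>A centred Gaussian variable that lies in \<open>[-R, R]\<close> with probability at least \<open>1/2\<close> has variance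
  at most \<open>16 R\<^sup>2\<close>, so a ball of measure at least \<open>1/2\<close> controls all second moments.\<close>

lemma gaussian_second_moment_bound:
  fixes m :: "'b::real_normed_vector measure"
  assumes m: "gaussian_measure m"
  obtains C where "C \<ge> 0" "\<And>\<phi> K. bounded_linear \<phi> \<Longrightarrow> K \<ge> 0 \<Longrightarrow> (\<And>z. \<bar>\<phi> z\<bar> \<le> K * norm z) \<Longrightarrow>
    (LINT z|m. (\<phi> z)\<^sup>2) \<le> C * K\<^sup>2"
proof -
  have bp: "borel_prob m" using m by (simp add: gaussian_measure_def)
  interpret prob_space m using bp by (simp add: borel_prob_def)
  have sets: "sets m = sets borel" using bp by (simp add: borel_prob_def)
  have "(\<lambda>k. prob (cball 0 (real k))) \<longlonglongrightarrow> prob (\<Union>k. cball 0 (real k))"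
    by (intro finite_Lim_measure_incseq) (auto simp: sets incseq_def intro: order_trans)
  also have "(\<Union>k. cball 0 (real k)) = space m"
    using sets_eq_imp_space_eq[OF sets] real_arch_simple by (auto simp: dist_norm)
  finally have "\<forall>\<^sub>F k in sequentially. prob (cball 0 (real k)) > 1/2"
    by (intro order_tendstoD) (auto simp: prob_space)
  then obtain k where k: "prob (cball 0 (real k)) > 1/2" by (auto simp: eventually_sequentially)
  have "(LINT z|m. (\<phi> z)\<^sup>2) \<le> (16 * (real k)\<^sup>2) * K\<^sup>2"
    if phi: "bounded_linear \<phi>" and K: "K \<ge> 0" "\<And>z. \<bar>\<phi> z\<bar> \<le> K * norm z" for \<phi> K
  proof -
    have "\<phi> \<in> borel_measurable borel"
      by (intro borel_measurable_continuous_onI linear_continuous_on phi)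
    then have pm[measurable]: "\<phi> \<in> borel_measurable m" using sets by (simp cong: measurable_cong_sets)
    have cg: "centered_gaussian (distr m borel \<phi>)" using m phi by (simp add: gaussian_measure_def)
    let ?R = "K * real k"
    have "cball 0 (real k) \<subseteq> \<phi> -` {-?R..?R} \<inter> space m"
    proof
      fix z :: 'b assume "z \<in> cball 0 (real k)"
      then have "norm z \<le> real k" by simp
      then have "K * norm z \<le> ?R" using K by (intro mult_left_mono) auto
      then have "\<bar>\<phi> z\<bar> \<le> ?R" using K(2)[of z] by linarith
      then show "z \<in> \<phi> -` {-?R..?R} \<inter> space m"
        using sets_eq_imp_space_eq[OF sets] by (auto simp: abs_le_iff)
    qed
    then have "prob (cball 0 (real k)) \<le> prob (\<phi> -` {-?R..?R} \<inter> space m)"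
      by (intro finite_measure_mono) auto
    also have "\<dots> = measure (distr m borel \<phi>) {-?R..?R}" by (simp add: measure_distr)
    finally have "measure (distr m borel \<phi>) {-?R..?R} \<ge> 1/2" using k by linarith
    then have "integral\<^sup>L (distr m borel \<phi>) (\<lambda>x. x\<^sup>2) \<le> 16 * ?R\<^sup>2"
      using K by (intro centered_gaussian_moments(4)[OF cg]) auto
    then show ?thesis by (simp add: integral_distr power_mult_distrib mult_ac)
  qed
  then show ?thesis by (intro that[of "16 * (real k)\<^sup>2"]) auto
qed

lemma (in prob_space) integral_square_le:
  fixes X :: "'a \<Rightarrow> real"
  assumes "integrable M X" "integrable M (\<lambda>x. (X x)\<^sup>2)"
  shows "(integral\<^sup>L M X)\<^sup>2 \<le> (LINT x|M. (X x)\<^sup>2)"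
  using variance_eq[OF assms] variance_positive[of X] by simp

lemma product_integrable:
  fixes f g :: "'a \<Rightarrow> real"
  assumes [measurable]: "f \<in> borel_measurable M" "g \<in> borel_measurable M"
    and "integrable M (\<lambda>x. (f x)\<^sup>2)" "integrable M (\<lambda>x. (g x)\<^sup>2)"
  shows "integrable M (\<lambda>x. f x * g x)"
proof (rule Bochner_Integration.integrable_bound)
  show "integrable M (\<lambda>x. (f x)\<^sup>2 + (g x)\<^sup>2)" using assms by simp
  have "\<bar>f x * g x\<bar> \<le> (f x)\<^sup>2 + (g x)\<^sup>2" for x
  proof -
    have "2 * (\<bar>f x\<bar> * \<bar>g x\<bar>) \<le> (f x)\<^sup>2 + (g x)\<^sup>2" "0 \<le> \<bar>f x\<bar> * \<bar>g x\<bar>"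
      using sum_squares_bound[of "\<bar>f x\<bar>" "\<bar>g x\<bar>"] by simp_all
    then show ?thesis unfolding abs_mult by linarith
  qed
  then show "AE x in M. norm (f x * g x) \<le> norm ((f x)\<^sup>2 + (g x)\<^sup>2)" by simp
qed measurable

section \<open>Autocovariances of a weakly mixing map\<close>

context measure_dynamics
begin

text \<open>Expanding \<open>F\<close> over its level sets turns the expression into a finite linear
  combination of the set correlations in the definition of weak mixing.\<close>

lemma cesaro_null_simple:
  assumes wm: "weakly_mixing m T" and F: "simple_function m (F :: 'b \<Rightarrow> real)"
  shows "cesaro_null (\<lambda>n. (LINT z|m. F ((T ^^ n) z) * F z) - (integral\<^sup>L m F)\<^sup>2)"
proof -
  define A where "A y = F -` {y}" for y
  have finY: "finite (F ` UNIV)" using F by (simp add: simple_function_def space_m)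
  have A: "A y \<in> sets borel" for y
    using measurable_sets[OF borel_measurable_simple_function[OF F], of "{y}"] by (simp add: A_def sets_m space_m)
  define Y where "Y = F ` UNIV"
  have Y: "finite Y" using finY by (simp add: Y_def)
  have rep: "F z = (\<Sum>y\<in>Y. y * indicator (A y) z)" for z
  proof -
    have "(\<Sum>y\<in>Y. y * indicator (A y) z) = (\<Sum>y\<in>Y. if y = F z then y else 0)"
      by (intro sum.cong refl) (auto simp: A_def)
    also have "\<dots> = F z" using Y by (simp add: Y_def)
    finally show ?thesis by simp
  qed
  define d where "d A B n = measure m ((T ^^ n) -` A \<inter> B) - measure m A * measure m B" for A B n
  have d0: "cesaro_null (d A B)" if "A \<in> sets borel" "B \<in> sets borel" for A B
    using wm that by (auto simp: weakly_mixing_def cesaro_null_def d_def sets_m)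
  have I1: "integral\<^sup>L m F = (\<Sum>y\<in>Y. y * measure m (A y))"
  proof -
    have "integral\<^sup>L m F = (LINT z|m. (\<Sum>y\<in>Y. y * indicator (A y) z))"
      by (rule Bochner_Integration.integral_cong) (use rep in auto)
    moreover have Am: "A y \<in> sets m" for y using A by (simp add: sets_m)
    moreover have "integrable m (\<lambda>z. y * indicator (A y) z)" for y
      using Am by (intro integrable_mult_right integrable_real_indicator) (auto simp: emeasure_eq_measure)
    ultimately show ?thesis using sets.sets_into_space[OF Am] by (simp add: Int_absorb2)
  qed
  have I2: "(LINT z|m. F ((T ^^ n) z) * F z) = (\<Sum>y\<in>Y. \<Sum>y'\<in>Y. y * y' * measure m ((T ^^ n) -` A y \<inter> A y'))" for n
  proof -
    have TA: "(T ^^ n) -` A y \<inter> A y' \<in> sets m" for y y' using A Tn_vimage[OF A, of n] by (auto simp: sets_m)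
    have "F ((T ^^ n) z) * F z = (\<Sum>y\<in>Y. \<Sum>y'\<in>Y. y * y' * indicator ((T ^^ n) -` A y \<inter> A y') z)" for z
      by (subst (1 2) rep) (auto simp: sum_product indicator_def intro!: sum.cong)
    moreover have "integrable m (\<lambda>z. y * y' * indicator ((T ^^ n) -` A y \<inter> A y') z)" for y y'
      using TA by (intro integrable_mult_right integrable_real_indicator) (auto simp: emeasure_eq_measure)
    ultimately show ?thesis using sets.sets_into_space[OF TA] by (simp add: Int_absorb2)
  qed
  have eq: "(LINT z|m. F ((T ^^ n) z) * F z) - (integral\<^sup>L m F)\<^sup>2 = (\<Sum>y\<in>Y. \<Sum>y'\<in>Y. (y * y') * d (A y) (A y') n)" for n
    unfolding I1 I2 power2_eq_square sum_product sum_subtractf[symmetric] d_def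
    by (intro sum.cong refl) (simp add: algebra_simps)
  have fs: "cesaro_null (\<lambda>n. \<Sum>y\<in>S. g y n)" if "finite S" "\<And>y. y \<in> S \<Longrightarrow> cesaro_null (g y)" for S :: "real set" and g
    using that
  proof (induction S)
    case (insert x S)
    show ?case
      by (rule cesaro_null_mono[OF cesaro_null_add[of "g x" "\<lambda>n. \<Sum>y\<in>S. g y n"]]) (use insert in auto)
  qed (simp add: cesaro_null_zero)
  show ?thesis unfolding eq
    by (intro fs Y cesaro_null_cmult d0 A)
qed

text \<open>As \<phi> may be unbounded, it is approximated in mean square by a simple function
  \<open>G\<close>. Young's inequality with weight \<eta> bounds the error in the correlations
  uniformly in time, and the mean of \<open>G\<close> is small because that of \<phi>
  vanishes.\<close>

lemma cesaro_null_autocovariance: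
  assumes wm: "weakly_mixing m T" and phim[measurable]: "\<phi> \<in> borel_measurable borel"
    and sq: "integrable m (\<lambda>z. (\<phi> z :: real)\<^sup>2)" and mean: "integrable m \<phi>" "integral\<^sup>L m \<phi> = 0"
  shows "cesaro_null (\<lambda>n. LINT z|m. \<phi> ((T ^^ n) z) * \<phi> z)"
proof (rule cesaro_null_approx)
  fix \<epsilon> :: real assume "\<epsilon> > 0"
  define V where "V = (LINT z|m. (\<phi> z)\<^sup>2)"
  have V: "V \<ge> 0" unfolding V_def by (rule integral_nonneg_AE) auto
  \<comment> \<open>The Young terms with factor \<eta> add up to at most
    \<open>\<eta> * (V + 4 * V)\<close>, because the approximants are bounded by
    \<open>2 * \<bar>\<phi> z\<bar>\<close>; the extra 1 covers \<open>V = 0\<close>.\<close>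
  define \<eta> where "\<eta> = \<epsilon> / (2 * (5 * V + 1))"
  have \<eta>: "\<eta> > 0" "\<eta> * (5 * V) \<le> \<epsilon> / 2" using \<open>\<epsilon> > 0\<close> V by (auto simp: \<eta>_def field_simps)
  have phim': "\<phi> \<in> borel_measurable m" using phim by (rule borel_m)
  obtain F where F: "\<And>i. simple_function m (F i)" "\<And>z. (\<lambda>i. F i z) \<longlonglongrightarrow> \<phi> z" "\<And>i z. \<bar>F i z\<bar> \<le> 2 * \<bar>\<phi> z\<bar>"
    using borel_measurable_implies_sequence_metric[OF phim', of 0] by (auto simp: space_m)
  have Fm[measurable]: "F i \<in> borel_measurable borel" for i
    using borel_measurable_simple_function[OF F(1)] sets_m by (simp cong: measurable_cong_sets)
  have Fsq: "(F i z)\<^sup>2 \<le> 4 * (\<phi> z)\<^sup>2" for i z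
    using power_mono[OF F(3)[of i z], of 2] by (simp add: power_mult_distrib)
  have dsq: "(\<phi> z - F i z)\<^sup>2 \<le> 9 * (\<phi> z)\<^sup>2" for i z
  proof -
    have "\<bar>\<phi> z - F i z\<bar> \<le> 3 * \<bar>\<phi> z\<bar>" using F(3)[of i z] by linarith
    from power_mono[OF this, of 2] show ?thesis by (simp add: power_mult_distrib)
  qed
  have "(\<lambda>i. LINT z|m. (\<phi> z - F i z)\<^sup>2) \<longlonglongrightarrow> (LINT z|m. 0)"
  proof (rule integral_dominated_convergence[where w="\<lambda>z. 9 * (\<phi> z)\<^sup>2"])
    show "AE z in m. (\<lambda>i. (\<phi> z - F i z)\<^sup>2) \<longlonglongrightarrow> 0"
    proof (rule AE_I2)
      fix z
      have "(\<lambda>i. (\<phi> z - F i z)\<^sup>2) \<longlonglongrightarrow> (\<phi> z - \<phi> z)\<^sup>2" by (intro tendsto_intros F)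
      then show "(\<lambda>i. (\<phi> z - F i z)\<^sup>2) \<longlonglongrightarrow> 0" by simp
    qed
    show "(\<lambda>z. (\<phi> z - F i z)\<^sup>2) \<in> borel_measurable m" for i
      by (rule borel_m) measurable
  qed (use sq dsq in auto)
  then have "\<forall>\<^sub>F i in sequentially. (LINT z|m. (\<phi> z - F i z)\<^sup>2) < min (\<eta> * \<epsilon> / 8) (\<epsilon> / 4)"
    using \<eta> \<open>\<epsilon> > 0\<close> by (intro order_tendstoD) auto
  then obtain i where i: "(LINT z|m. (\<phi> z - F i z)\<^sup>2) < min (\<eta> * \<epsilon> / 8) (\<epsilon> / 4)"
    by (auto simp: eventually_sequentially)
  \<comment> \<open>Of the two bounds in \<open>i\<close>, the first makes
    \<open>2 * (\<delta> / \<eta>)\<close> at most \<open>\<epsilon> / 4\<close>, the second does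
    the same for the squared mean of \<open>G\<close>; with \<open>\<epsilon> / 2\<close> from the
    choice of \<eta> the total is \<epsilon>.\<close>
  define \<delta> where "\<delta> = (LINT z|m. (\<phi> z - F i z)\<^sup>2)"
  define G where "G = F i"
  have Gm[measurable]: "G \<in> borel_measurable borel" by (simp add: G_def)
  note mm = borel_m[OF phim] borel_m[OF Gm]
  have sqG: "integrable m (\<lambda>z. (G z)\<^sup>2)"
    by (rule Bochner_Integration.integrable_bound[of _ "\<lambda>z. 4 * (\<phi> z)\<^sup>2"]) (use sq Fsq mm in \<open>auto simp: G_def\<close>)
  have sqD: "integrable m (\<lambda>z. (\<phi> z - G z)\<^sup>2)"
    by (rule Bochner_Integration.integrable_bound[of _ "\<lambda>z. 9 * (\<phi> z)\<^sup>2"]) (use sq dsq mm in \<open>auto simp: G_def\<close>)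
  have GV: "(LINT z|m. (G z)\<^sup>2) \<le> 4 * V"
    using integral_mono[OF sqG, of "\<lambda>z. 4 * (\<phi> z)\<^sup>2"] sq Fsq[of i] by (simp add: V_def G_def)
  have IG: "integrable m G" by (rule square_integrable_imp_integrable[OF mm(2) sqG])
  have sqT: "integrable m (\<lambda>z. (f ((T ^^ n) z))\<^sup>2)"
    if "integrable m (\<lambda>z. (f z :: real)\<^sup>2)" "f \<in> borel_measurable borel" for f n
  proof -
    have "integrable (distr m borel (T ^^ n)) (\<lambda>z. (f z)\<^sup>2)" using that distr_Tn by simp
    then show ?thesis using that borel_m[OF Tn_measurable] by (subst (asm) integrable_distr_eq) auto
  qed
  show "\<exists>b. cesaro_null b \<and> (\<forall>n. \<bar>LINT z|m. \<phi> ((T ^^ n) z) * \<phi> z\<bar> \<le> \<bar>b n\<bar> + \<epsilon>)"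
  proof (intro exI conjI allI)
    show "cesaro_null (\<lambda>n. (LINT z|m. G ((T ^^ n) z) * G z) - (integral\<^sup>L m G)\<^sup>2)"
      unfolding G_def by (rule cesaro_null_simple[OF wm F(1)])
    fix n
    let ?S = "T ^^ n"
    have Sm[measurable]: "?S \<in> borel_measurable borel" by (rule Tn_measurable)
    have mT: "(\<lambda>z. f (?S z)) \<in> borel_measurable m" if "f \<in> borel_measurable borel" for f :: "'b \<Rightarrow> real"
      using measurable_compose[OF Sm that] by (rule borel_m)
    have i1: "integrable m (\<lambda>z. \<phi> (?S z) * \<phi> z)" and i2: "integrable m (\<lambda>z. G (?S z) * G z)"
      using sq sqG by (auto intro!: product_integrable sqT mT mm)
    have pw: "\<bar>\<phi> (?S z) * \<phi> z - G (?S z) * G z\<bar>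
       \<le> (\<phi> (?S z) - G (?S z))\<^sup>2 / \<eta> + \<eta> * (\<phi> z)\<^sup>2 + (\<phi> z - G z)\<^sup>2 / \<eta> + \<eta> * (G (?S z))\<^sup>2" for z
    proof -
      have yg: "\<bar>a * b\<bar> \<le> a\<^sup>2 / \<eta> + \<eta> * b\<^sup>2" for a b :: real
      proof -
        have "2 * \<bar>a\<bar> * (\<eta> * \<bar>b\<bar>) \<le> \<bar>a\<bar>\<^sup>2 + (\<eta> * \<bar>b\<bar>)\<^sup>2" by (rule sum_squares_bound)
        then have "\<eta> * (2 * \<bar>a * b\<bar>) \<le> \<eta> * (a\<^sup>2 / \<eta> + \<eta> * b\<^sup>2)"
          using \<eta>(1) by (simp add: abs_mult algebra_simps power2_eq_square)
        then have "2 * \<bar>a * b\<bar> \<le> a\<^sup>2 / \<eta> + \<eta> * b\<^sup>2" using \<eta>(1) by (simp only: mult_le_cancel_left_pos)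
        then show ?thesis by linarith
      qed
      have "\<phi> (?S z) * \<phi> z - G (?S z) * G z = (\<phi> (?S z) - G (?S z)) * \<phi> z + (\<phi> z - G z) * G (?S z)"
        by (simp add: algebra_simps)
      then show ?thesis using yg[of "\<phi> (?S z) - G (?S z)" "\<phi> z"] yg[of "\<phi> z - G z" "G (?S z)"]
        by linarith
    qed
    have iT: "integrable m (\<lambda>z. (\<phi> (?S z) - G (?S z))\<^sup>2)" "integrable m (\<lambda>z. (G (?S z))\<^sup>2)"
      using sqT[of "\<lambda>z. \<phi> z - G z" n] sqT[of G n] sqD sqG by auto
    have "\<bar>(LINT z|m. \<phi> (?S z) * \<phi> z) - (LINT z|m. G (?S z) * G z)\<bar>
       = \<bar>LINT z|m. \<phi> (?S z) * \<phi> z - G (?S z) * G z\<bar>" using i1 i2 by simp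
    also have "\<dots> \<le> (LINT z|m. \<bar>\<phi> (?S z) * \<phi> z - G (?S z) * G z\<bar>)" by (rule integral_abs_bound)
    also have "\<dots> \<le> (LINT z|m. (\<phi> (?S z) - G (?S z))\<^sup>2 / \<eta> + \<eta> * (\<phi> z)\<^sup>2 + (\<phi> z - G z)\<^sup>2 / \<eta> + \<eta> * (G (?S z))\<^sup>2)"
      using i1 i2 iT sq sqD by (intro integral_mono pw) auto
    also have "\<dots> = \<delta> / \<eta> + \<eta> * V + \<delta> / \<eta> + \<eta> * (LINT z|m. (G z)\<^sup>2)"
      using iT sq sqD integral_Tn[of "\<lambda>z. (\<phi> z - G z)\<^sup>2" n] integral_Tn[of "\<lambda>z. (G z)\<^sup>2" n]
      by (simp add: \<delta>_def V_def G_def)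
    also have "\<dots> \<le> 2 * (\<delta> / \<eta>) + \<eta> * (5 * V)"
      using mult_left_mono[OF GV, of \<eta>] \<eta>(1) by (simp add: algebra_simps)
    also have "\<dots> \<le> 2 * (\<delta> / \<eta>) + \<epsilon> / 2" using \<eta>(2) by simp
    finally have a: "\<bar>(LINT z|m. \<phi> (?S z) * \<phi> z) - (LINT z|m. G (?S z) * G z)\<bar> \<le> 2 * (\<delta> / \<eta>) + \<epsilon> / 2" .
    have "\<delta> / \<eta> \<le> \<epsilon> / 8"
    proof -
      have "(LINT z|m. (\<phi> z - F i z)\<^sup>2) \<le> \<eta> * \<epsilon> / 8" using i by simp
      then show ?thesis using \<eta>(1) by (simp add: \<delta>_def field_simps)
    qed
    have "(integral\<^sup>L m G)\<^sup>2 = (LINT z|m. \<phi> z - G z)\<^sup>2" using mean IG by simp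
    also have "\<dots> \<le> \<delta>"
      unfolding \<delta>_def using integral_square_le[of "\<lambda>z. \<phi> z - G z"] mean IG sqD by (simp add: G_def)
    also have "\<dots> \<le> \<epsilon> / 4" using i by (simp add: \<delta>_def)
    finally have "(integral\<^sup>L m G)\<^sup>2 \<le> \<epsilon> / 4" .
    moreover have "(integral\<^sup>L m G)\<^sup>2 \<ge> 0" by simp
    ultimately show "\<bar>LINT z|m. \<phi> (?S z) * \<phi> z\<bar> \<le> \<bar>(LINT z|m. G (?S z) * G z) - (integral\<^sup>L m G)\<^sup>2\<bar> + \<epsilon>"
      using a \<open>\<delta> / \<eta> \<le> \<epsilon> / 8\<close> by linarith
  qed
qed

end

text \<open>One coefficient sequence serves scalars and linear operators at once. Thereby a moment
  of |z^n - 1| under the spectral measure and a second moment of a functional composed with a power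
  of T^n - I become the same quadratic form in the covariances.\<close>

lemma difference_power_coefficients:
  "\<exists>b :: nat \<Rightarrow> real. (\<forall>w::complex. (w - 1) ^ J = (\<Sum>s\<le>J. complex_of_real (b s) * w ^ s)) \<and>
     (\<forall>S :: 'b::real_vector \<Rightarrow> 'b. linear S \<longrightarrow> (\<forall>z. ((\<lambda>x. S x - x) ^^ J) z = (\<Sum>s\<le>J. b s *\<^sub>R (S ^^ s) z)))"
proof (induction J)
  case 0
  show ?case by (intro exI[of _ "\<lambda>_. 1"]) simp
next
  case (Suc J)
  then obtain b :: "nat \<Rightarrow> real" where
    b1: "\<And>w::complex. (w - 1) ^ J = (\<Sum>s\<le>J. complex_of_real (b s) * w ^ s)" and
    b2: "\<And>(S :: 'b \<Rightarrow> 'b) z. linear S \<Longrightarrow> ((\<lambda>x. S x - x) ^^ J) z = (\<Sum>s\<le>J. b s *\<^sub>R (S ^^ s) z)"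
    by blast
  \<comment> \<open>The signed Pascal rule, from multiplying by \<open>w - 1\<close>.\<close>
  define b' where "b' s = (if s = 0 then 0 else b (s - 1)) - (if s \<le> J then b s else 0)" for s
  have "(w - 1) ^ Suc J = (\<Sum>s\<le>Suc J. complex_of_real (b' s) * w ^ s)" for w
  proof -
    have "(\<Sum>s\<le>Suc J. complex_of_real (b' s) * w ^ s)
      = (\<Sum>s\<le>Suc J. (if s = 0 then 0 else complex_of_real (b (s - 1)) * w ^ s))
       - (\<Sum>s\<le>Suc J. (if s \<le> J then complex_of_real (b s) * w ^ s else 0))"
      unfolding sum_subtractf[symmetric] b'_def by (intro sum.cong refl) (auto simp: algebra_simps)
    also have "(\<Sum>s\<le>Suc J. (if s = 0 then 0 else complex_of_real (b (s - 1)) * w ^ s)) = w * (w - 1) ^ J"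
      unfolding b1 sum_distrib_left by (subst sum.atMost_Suc_shift) (simp add: mult_ac)
    also have "(\<Sum>s\<le>Suc J. (if s \<le> J then complex_of_real (b s) * w ^ s else 0)) = (w - 1) ^ J"
      unfolding b1 by simp
    finally show ?thesis by (simp add: algebra_simps)
  qed
  moreover have "((\<lambda>x. S x - x) ^^ Suc J) z = (\<Sum>s\<le>Suc J. b' s *\<^sub>R (S ^^ s) z)" if S: "linear S" for S :: "'b \<Rightarrow> 'b" and z
  proof -
    interpret linear S by (rule S)
    have "(\<Sum>s\<le>Suc J. b' s *\<^sub>R (S ^^ s) z)
      = (\<Sum>s\<le>Suc J. (if s = 0 then 0 else b (s - 1) *\<^sub>R (S ^^ s) z))
       - (\<Sum>s\<le>Suc J. (if s \<le> J then b s *\<^sub>R (S ^^ s) z else 0))"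
      unfolding sum_subtractf[symmetric] b'_def by (intro sum.cong refl) (auto simp: algebra_simps)
    also have "(\<Sum>s\<le>Suc J. (if s = 0 then 0 else b (s - 1) *\<^sub>R (S ^^ s) z)) = S (((\<lambda>x. S x - x) ^^ J) z)"
      unfolding b2[OF S] sum scale by (subst sum.atMost_Suc_shift) simp
    also have "(\<Sum>s\<le>Suc J. (if s \<le> J then b s *\<^sub>R (S ^^ s) z else 0)) = ((\<lambda>x. S x - x) ^^ J) z"
      unfolding b2[OF S] by simp
    finally show ?thesis by simp
  qed
  ultimately show ?case by blast
qed

lemma funpow_bounded_linear:
  fixes T :: "'a::real_normed_vector \<Rightarrow> 'a"
  assumes "bounded_linear T" shows "bounded_linear (T ^^ n)"
proof (induction n)
  case (Suc n)
  then show ?case using bounded_linear_compose[OF assms Suc] by (simp add: comp_def)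
qed (simp add: bounded_linear_ident id_def)

lemma onorm_funpow_le:
  fixes D :: "'a::real_normed_vector \<Rightarrow> 'a"
  assumes "bounded_linear D"
  shows "norm ((D ^^ J) z) \<le> onorm D ^ J * norm z"
proof (induction J)
  case (Suc J)
  have "norm (D ((D ^^ J) z)) \<le> onorm D * norm ((D ^^ J) z)" by (rule onorm[OF assms])
  also have "\<dots> \<le> onorm D * (onorm D ^ J * norm z)"
    by (intro mult_left_mono Suc onorm_pos_le assms)
  finally show ?case by (simp add: mult_ac)
qed simp

text \<open>Chebyshev's inequality at any level above \<epsilon> gives a probability of at most
  \<open>B\<close> times a power of a ratio below 1, and the exponent \<open>2 * J\<close> is
  arbitrary. It matters that \<open>B\<close> does not depend on \<open>J\<close>.\<close>

lemma AE_le_of_power_integral_bound: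
  fixes a :: "'a \<Rightarrow> real"
  assumes M: "prob_space M" and am[measurable]: "a \<in> borel_measurable M" and a0: "\<And>t. a t \<ge> 0"
    and int: "\<And>J. integrable M (\<lambda>t. a t ^ (2 * J))" and e0: "\<epsilon> \<ge> 0"
    and bound: "\<And>J. (LINT t|M. a t ^ (2 * J)) \<le> B * \<epsilon> ^ (2 * J)"
  shows "AE t in M. a t \<le> \<epsilon>"
proof -
  interpret prob_space M by (rule M)
  have "AE t in M. a t < \<epsilon> + 1 / Suc k" for k
  proof -
    let ?e = "\<epsilon> + 1 / Suc k"
    have e: "?e > 0" "\<epsilon> < ?e" using e0 by (auto intro: add_nonneg_pos)
    let ?A = "{t\<in>space M. ?e \<le> a t}"
    have A: "?A \<in> sets M" by measurable
    have "prob ?A \<le> B * (\<epsilon> / ?e) ^ (2 * J)" for J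
    proof -
      have "prob ?A * ?e ^ (2 * J) = (LINT t|M. indicator ?A t * ?e ^ (2 * J))"
        using A by simp
      also have "\<dots> \<le> (LINT t|M. a t ^ (2 * J))"
      proof (rule integral_mono[OF _ int])
        show "integrable M (\<lambda>t. indicator ?A t * ?e ^ (2 * J))"
          using A by (intro integrable_mult_left integrable_real_indicator) (simp_all add: emeasure_eq_measure)
        show "indicator ?A t * ?e ^ (2 * J) \<le> a t ^ (2 * J)" for t
          using e(1) a0[of t] power_mono[of ?e "a t" "2 * J"] by (simp add: indicator_def)
      qed
      also have "\<dots> \<le> B * \<epsilon> ^ (2 * J)" by (rule bound)
      finally have "prob ?A \<le> B * \<epsilon> ^ (2 * J) / ?e ^ (2 * J)" using e by (simp add: pos_le_divide_eq)
      then show ?thesis by (simp add: power_divide)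
    qed
    moreover have "(\<lambda>J. B * (\<epsilon> / ?e) ^ (2 * J)) \<longlonglongrightarrow> B * 0"
    proof (intro tendsto_mult tendsto_const)
      have "\<bar>\<epsilon> / ?e\<bar> < 1" using e e0 by simp
      then have "(\<lambda>J. ((\<epsilon> / ?e)\<^sup>2) ^ J) \<longlonglongrightarrow> 0"
        by (intro LIMSEQ_realpow_zero) (auto simp: abs_square_less_1)
      then show "(\<lambda>J. (\<epsilon> / ?e) ^ (2 * J)) \<longlonglongrightarrow> 0" by (simp add: power_mult)
    qed
    ultimately have "prob ?A \<le> 0" using LIMSEQ_le_const by fastforce
    then have "prob ?A = 0" using measure_nonneg[of M ?A] by linarith
    then have "AE t in M. \<not> ?e \<le> a t" using A by (subst AE_iff_measurable[of ?A]) (auto simp: emeasure_eq_measure)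
    then show ?thesis by (simp add: not_le)
  qed
  then have "AE t in M. \<forall>k. a t < \<epsilon> + 1 / Suc k" by (subst AE_all_countable) blast
  then show ?thesis
  proof eventually_elim
    case (elim t)
    have "(\<lambda>k. \<epsilon> + 1 / Suc k) \<longlonglongrightarrow> \<epsilon> + 0"
      by (intro tendsto_add tendsto_const LIMSEQ_Suc[OF lim_const_over_n])
    then show ?case using elim by (intro LIMSEQ_le_const[of _ \<epsilon>]) (auto intro: less_imp_le)
  qed
qed

section \<open>The spectral measure of a functional\<close>

context measure_dynamics
begin

lemma spectral_measure:
  assumes g: "gaussian_measure m" and nd: "non_degenerate m" and wm: "weakly_mixing m T"
    and T: "bounded_linear T" and x: "(x::'b) \<noteq> 0"
  shows "\<exists>M. real_distribution M \<and>
    (\<forall>\<zeta>. cmod \<zeta> = 1 \<longrightarrow> measure M {t. iexp t = \<zeta>} = 0) \<and>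
    (\<forall>n. AE t in M. cmod (iexp t ^ n - 1) \<le> onorm (\<lambda>z. (T ^^ n) z - z))"
proof -
  define \<phi> where "\<phi> = inner x"
  have phi: "bounded_linear \<phi>" unfolding \<phi>_def by (rule bounded_linear_inner_right)
  have phim[measurable]: "\<phi> \<in> borel_measurable borel"
    by (intro borel_measurable_continuous_onI linear_continuous_on phi)
  note gf = gaussian_functional[OF g]
  define c0 where "c0 = (LINT z|m. (\<phi> z)\<^sup>2)"
  \<comment> \<open>Non-degeneracy: \<phi> is non-zero on a non-empty open set, so its variance
    cannot vanish.\<close>
  have "c0 > 0"
  proof -
    have "c0 \<ge> 0" unfolding c0_def by (rule integral_nonneg_AE) auto
    moreover have "c0 \<noteq> 0"
    proof
      assume "c0 = 0"
      then have "AE z in m. (\<phi> z)\<^sup>2 = 0"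
        using integral_nonneg_eq_0_iff_AE[OF gf(3)[OF phi]] by (simp add: c0_def)
      then have AE: "AE z in m. \<phi> z = 0" by simp
      have "open {z. \<phi> z \<noteq> 0}" unfolding \<phi>_def by (intro open_Collect_neq continuous_intros)
      moreover have "x \<in> {z. \<phi> z \<noteq> 0}" using x by (simp add: \<phi>_def)
      ultimately have "emeasure m {z. \<phi> z \<noteq> 0} > 0" using nd unfolding non_degenerate_def by blast
      moreover have "emeasure m {z. \<phi> z \<noteq> 0} = 0"
        using AE by (subst (asm) AE_iff_measurable[OF _ refl]) (auto simp: sets_m space_m)
      ultimately show False by simp
    qed
    ultimately show ?thesis by simp
  qed
  define X where "X j z = \<phi> ((T ^^ j) z) / sqrt c0" for j z
  define c where "c r = (LINT z|m. \<phi> ((T ^^ r) z) * \<phi> z) / c0" for r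
  have bl: "bounded_linear (\<lambda>z. \<phi> ((T ^^ j) z))" for j
    by (rule bounded_linear_compose[OF phi funpow_bounded_linear[OF T]])
  have blm: "(\<lambda>z. \<phi> ((T ^^ j) z)) \<in> borel_measurable m" for j
    by (rule borel_m) measurable
  have int': "integrable m (\<lambda>z. \<phi> ((T ^^ i) z) * \<phi> ((T ^^ j) z))" for i j
    by (intro product_integrable blm gf(3) bl)
  have int: "integrable m (\<lambda>z. X i z * X j z)" for i j
    using int'[of i j] by (simp add: X_def)
  have cov: "(LINT z|m. X i z * X (i + j) z) = c j" for i j
  proof -
    have "(LINT z|m. X i z * X (i + j) z) = (LINT z|m. \<phi> ((T ^^ i) z) * \<phi> ((T ^^ (i + j)) z) / c0)"
      using \<open>c0 > 0\<close> by (simp add: X_def)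
    also have "\<dots> = (LINT z|m. (\<lambda>y. \<phi> y * \<phi> ((T ^^ j) y) / c0) ((T ^^ i) z))"
      by (simp add: add.commute[of i] funpow_add)
    also have "\<dots> = (LINT z|m. \<phi> z * \<phi> ((T ^^ j) z) / c0)"
      by (rule integral_Tn) measurable
    finally show ?thesis by (simp add: c_def mult.commute)
  qed
  have "c 0 = 1" using \<open>c0 > 0\<close> by (simp add: c_def c0_def power2_eq_square)
  then obtain M where M: "real_distribution M" "\<And>r::nat. char M r = c r"
    using herglotz[of m X c, OF int cov] by metis
  interpret M: real_distribution M by (rule M)
  have "cesaro_null (\<lambda>n. (1 / c0) * (LINT z|m. \<phi> ((T ^^ n) z) * \<phi> z))"
    by (intro cesaro_null_cmult cesaro_null_autocovariance wm phim gf phi)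
  then have ces: "cesaro_null c" by (simp add: c_def[abs_def])
  obtain C where C: "C \<ge> 0" "\<And>\<psi> K. bounded_linear \<psi> \<Longrightarrow> K \<ge> 0 \<Longrightarrow> (\<And>z. \<bar>\<psi> z\<bar> \<le> K * norm z) \<Longrightarrow>
    (LINT z|m. (\<psi> z)\<^sup>2) \<le> C * K\<^sup>2"
    using gaussian_second_moment_bound[OF g] by metis
  have "AE t in M. cmod (iexp t ^ n - 1) \<le> onorm (\<lambda>z. (T ^^ n) z - z)" for n
  proof (rule AE_le_of_power_integral_bound)
    let ?D = "\<lambda>z. (T ^^ n) z - z"
    have D: "bounded_linear ?D" by (intro bounded_linear_sub funpow_bounded_linear T bounded_linear_ident)
    show "prob_space M" by (rule M.prob_space_axioms)
    show "(\<lambda>t. cmod (iexp t ^ n - 1)) \<in> borel_measurable M" by measurable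
    show "0 \<le> onorm ?D" by (rule onorm_pos_le[OF D])
    have b2: "cmod (iexp t ^ n - 1) \<le> 2" for t
      using norm_triangle_ineq4[of "iexp t ^ n" 1] by (simp add: norm_power)
    show "integrable M (\<lambda>t. cmod (iexp t ^ n - 1) ^ (2 * J))" for J
      by (rule M.integrable_const_bound[where B="2 ^ (2*J)"]) (auto intro!: power_mono b2)
    fix J
    obtain b :: "nat \<Rightarrow> real" where
      b1: "\<And>w::complex. (w - 1) ^ J = (\<Sum>s\<le>J. complex_of_real (b s) * w ^ s)" and
      b2: "\<And>(S :: 'b \<Rightarrow> 'b) z. linear S \<Longrightarrow> ((\<lambda>x. S x - x) ^^ J) z = (\<Sum>s\<le>J. b s *\<^sub>R (S ^^ s) z)"
      using difference_power_coefficients[of J] by blast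
    \<comment> \<open>The isometry behind the spectral measure: powers of \<open>iexp t\<close> have
      the same inner products under \<open>M\<close> as the variables \<open>X\<close> under
      \<open>m\<close>. The case \<open>s < s'\<close> is reduced to the other one by conjugation,
      the covariances being real.\<close>
    have kk: "(CLINT t|M. (iexp t ^ n) ^ s * cnj ((iexp t ^ n) ^ s')) = (LINT z|m. X (n * s) z * X (n * s') z)" for s s'
    proof -
      have le: "(CLINT t|M. (iexp t ^ n) ^ s * cnj ((iexp t ^ n) ^ s')) = (LINT z|m. X (n * s) z * X (n * s') z)"
        if "s' \<le> s" for s s'
      proof -
        have "(iexp t ^ n) ^ s * cnj ((iexp t ^ n) ^ s') = iexp (real (n * (s - s')) * t)" for t
        proof -
          have "(iexp t ^ n) ^ s * cnj ((iexp t ^ n) ^ s') = iexp (real (n * s) * t) * iexp (- (real (n * s') * t))"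
            unfolding power_mult[symmetric] iexp_power iexp_cnj by (simp add: mult_ac)
          also have "\<dots> = iexp (real (n * s) * t - real (n * s') * t)"
            by (simp only: iexp_add[symmetric]) simp
          also have "real (n * s) * t - real (n * s') * t = real (n * (s - s')) * t"
            using that by (simp add: of_nat_diff algebra_simps)
          finally show ?thesis .
        qed
        then have "(CLINT t|M. (iexp t ^ n) ^ s * cnj ((iexp t ^ n) ^ s')) = char M (n * (s - s'))"
          by (simp add: char_def)
        also have "\<dots> = c (n * (s - s'))" by (rule M(2))
        also have "n * s' + n * (s - s') = n * s" using that by (simp add: algebra_simps)
        then have "c (n * (s - s')) = (LINT z|m. X (n * s) z * X (n * s') z)"
          using cov[of "n * s'" "n * (s - s')"] by (simp add: mult.commute)
        finally show ?thesis .
      qed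
      show ?thesis
      proof (cases "s' \<le> s")
        case False
        then have "(CLINT t|M. cnj ((iexp t ^ n) ^ s' * cnj ((iexp t ^ n) ^ s))) = cnj (complex_of_real (LINT z|m. X (n * s') z * X (n * s) z))"
          using le[of s s'] by (subst Bochner_Integration.integral_cnj) (simp only: nat_le_linear not_le less_imp_le)
        then show ?thesis by (simp add: mult.commute)
      qed (rule le)
    qed
    have i1: "integrable M (\<lambda>t. (iexp t ^ n) ^ s * cnj ((iexp t ^ n) ^ s'))" for s s'
    proof (rule M.integrable_const_bound[where B=1])
      have "(\<lambda>t. (iexp t ^ n) ^ s * cnj ((iexp t ^ n) ^ s')) \<in> borel_measurable borel"
        by (intro borel_measurable_continuous_onI continuous_intros)
      then show "(\<lambda>t. (iexp t ^ n) ^ s * cnj ((iexp t ^ n) ^ s')) \<in> borel_measurable M" by simp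
    qed (auto simp: norm_mult norm_power)
    define \<psi> where "\<psi> z = \<phi> ((?D ^^ J) z)" for z
    have psi: "bounded_linear \<psi>"
      unfolding \<psi>_def by (rule bounded_linear_compose[OF phi funpow_bounded_linear[OF D]])
    have psiX: "\<psi> z / sqrt c0 = (\<Sum>s\<le>J. b s * X (n * s) z)" for z
    proof -
      interpret phi: bounded_linear \<phi> by (rule phi)
      have "linear (T ^^ n)" using funpow_bounded_linear[OF T] by (rule bounded_linear.linear)
      then have "\<psi> z = (\<Sum>s\<le>J. b s * \<phi> (((T ^^ n) ^^ s) z))"
        unfolding \<psi>_def using b2[of "T ^^ n" z] by (simp add: phi.sum phi.scaleR)
      then show ?thesis by (simp add: X_def funpow_mult sum_divide_distrib)
    qed
    have e1: "complex_of_real (cmod (iexp t ^ n - 1) ^ (2 * J))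
      = (\<Sum>s\<le>J. \<Sum>s'\<le>J. complex_of_real (b s * b s') * ((iexp t ^ n) ^ s * cnj ((iexp t ^ n) ^ s')))" for t
    proof -
      have "complex_of_real (cmod (iexp t ^ n - 1) ^ (2 * J)) = complex_of_real ((cmod ((iexp t ^ n - 1) ^ J))\<^sup>2)"
        by (simp add: norm_power power_mult[symmetric] mult.commute)
      also have "\<dots> = (iexp t ^ n - 1) ^ J * cnj ((iexp t ^ n - 1) ^ J)" by (rule complex_norm_square)
      also have "\<dots> = (\<Sum>s\<le>J. \<Sum>s'\<le>J. complex_of_real (b s * b s') * ((iexp t ^ n) ^ s * cnj ((iexp t ^ n) ^ s')))"
        unfolding b1 cnj_sum sum_product by (intro sum.cong refl) (simp add: mult_ac)
      finally show ?thesis .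
    qed
    have e2: "(\<psi> z / sqrt c0)\<^sup>2 = (\<Sum>s\<le>J. \<Sum>s'\<le>J. (b s * b s') * (X (n * s) z * X (n * s') z))" for z
      unfolding psiX power2_eq_square sum_product by (intro sum.cong refl) (simp add: mult_ac)
    have "complex_of_real (LINT t|M. cmod (iexp t ^ n - 1) ^ (2 * J))
      = (CLINT t|M. complex_of_real (cmod (iexp t ^ n - 1) ^ (2 * J)))"
      by (rule integral_complex_of_real[symmetric])
    also have "\<dots> = (\<Sum>s\<le>J. \<Sum>s'\<le>J. complex_of_real (b s * b s') * (LINT z|m. X (n * s) z * X (n * s') z))"
      unfolding e1 using i1 by (simp only: Bochner_Integration.integral_sum integrable_mult_right
        Bochner_Integration.integrable_sum integral_mult_right_zero kk)
    also have "\<dots> = complex_of_real (LINT z|m. (\<psi> z / sqrt c0)\<^sup>2)"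
      unfolding e2 using int by simp
    finally have "(LINT t|M. cmod (iexp t ^ n - 1) ^ (2 * J)) = (LINT z|m. (\<psi> z / sqrt c0)\<^sup>2)"
      by (simp only: of_real_eq_iff)
    also have "\<dots> = (LINT z|m. (\<psi> z)\<^sup>2) / c0"
      using \<open>c0 > 0\<close> by (simp add: power_divide)
    \<comment> \<open>\<open>C\<close> bounds the variance of every functional in terms of its norm
      alone, so it stays the same for all \<open>J\<close>.\<close>
    also have "\<dots> \<le> C * (norm x * onorm ?D ^ J)\<^sup>2 / c0"
    proof (intro divide_right_mono C psi)
      fix z
      have "\<bar>\<psi> z\<bar> \<le> norm x * norm ((?D ^^ J) z)" unfolding \<psi>_def \<phi>_def by (rule Cauchy_Schwarz_ineq2)
      also have "\<dots> \<le> norm x * (onorm ?D ^ J * norm z)"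
        by (intro mult_left_mono onorm_funpow_le D) auto
      finally show "\<bar>\<psi> z\<bar> \<le> norm x * onorm ?D ^ J * norm z" by (simp add: mult_ac)
    qed (use \<open>c0 > 0\<close> onorm_pos_le[OF D] in auto)
    also have "\<dots> = (C * (norm x)\<^sup>2 / c0) * onorm ?D ^ (2 * J)"
      by (simp add: power_mult_distrib power_mult[symmetric] mult_ac)
    finally show "(LINT t|M. cmod (iexp t ^ n - 1) ^ (2 * J)) \<le> (C * (norm x)\<^sup>2 / c0) * onorm ?D ^ (2 * J)" .
  qed auto
  then show ?thesis
    using M(1) spectral_no_atoms[OF M(1) M(2) ces] by blast
qed

end

section \<open>Uncountable sets of unimodular numbers from rigid operators\<close>

lemma uncountable_unimodular_set:
  assumes M: "real_distribution M" and na: "\<And>\<zeta>. cmod \<zeta> = 1 \<Longrightarrow> measure M {t. iexp t = \<zeta>} = 0"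
    and ae: "\<And>k::nat. AE t in M. cmod (iexp t ^ n k - 1) \<le> e k"
  shows "uncountable {z. cmod z = 1 \<and> (\<forall>k. cmod (z ^ n k - 1) \<le> e k)}" (is "uncountable ?K")
proof
  assume K: "countable ?K"
  interpret real_distribution M by (rule M)
  have cl: "{t. iexp t = \<zeta>} \<in> sets M" for \<zeta>
  proof -
    have "closed {t. iexp t = \<zeta>}" by (intro closed_Collect_eq continuous_intros)
    then show ?thesis by simp
  qed
  \<comment> \<open>A countable \<open>?K\<close> would have a null preimage, since single values
    have one; yet almost every \<open>t\<close> is mapped into \<open>?K\<close>.\<close>
  have "(\<Union>\<zeta>\<in>?K. {t. iexp t = \<zeta>}) \<in> null_sets M"
    using K na cl by (intro null_sets_UN') (auto simp: null_sets_def emeasure_eq_measure)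
  then have "AE t in M. t \<notin> (\<Union>\<zeta>\<in>?K. {t. iexp t = \<zeta>})" by (rule AE_not_in)
  moreover have "AE t in M. \<forall>k. cmod (iexp t ^ n k - 1) \<le> e k" using ae by (simp add: AE_all_countable)
  ultimately have "AE t in M. False" by eventually_elim auto
  then show False by simp
qed

lemma uniform_limit_of_norm_bound:
  fixes n :: "nat \<Rightarrow> nat"
  assumes "e \<longlonglongrightarrow> 0" "\<And>z k. z \<in> K \<Longrightarrow> cmod (z ^ n k - 1) \<le> e k"
  shows "uniform_limit K (\<lambda>k z. z ^ n k) (\<lambda>_. 1) sequentially"
proof (rule uniform_limitI)
  fix \<epsilon> :: real assume "\<epsilon> > 0"
  with assms(1) have "\<forall>\<^sub>F k in sequentially. e k < \<epsilon>" by (intro order_tendstoD) auto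
  then show "\<forall>\<^sub>F k in sequentially. \<forall>z\<in>K. dist (z ^ n k) 1 < \<epsilon>"
    by eventually_elim (use assms(2) in \<open>auto simp: dist_norm intro: le_less_trans\<close>)
qed

lemma uncountable_set_of_weakly_mixing:
  fixes T :: "'b::{real_inner,banach} \<Rightarrow> 'b" and n :: "nat \<Rightarrow> nat"
  assumes "bounded_linear T" "gaussian_measure m" "non_degenerate m" "invariant_measure m T"
    "weakly_mixing m T" "(x::'b) \<noteq> 0" and lim: "(\<lambda>k. onorm (\<lambda>x. (T ^^ n k) x - x)) \<longlonglongrightarrow> 0"
  shows "\<exists>K\<subseteq>unit_circle. uncountable K \<and> uniform_limit K (\<lambda>k z. z ^ n k) (\<lambda>_. 1) sequentially"
proof -
  have "T \<in> borel_measurable borel"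
    by (intro borel_measurable_continuous_onI linear_continuous_on assms)
  then interpret measure_dynamics m T
    using assms by unfold_locales (auto simp: gaussian_measure_def)
  obtain M where M: "real_distribution M"
    "\<And>\<zeta>. cmod \<zeta> = 1 \<Longrightarrow> measure M {t. iexp t = \<zeta>} = 0"
    "\<And>n. AE t in M. cmod (iexp t ^ n - 1) \<le> onorm (\<lambda>z. (T ^^ n) z - z)"
    using spectral_measure[OF assms(2,3,5,1,6)] by blast
  show ?thesis
    using uncountable_unimodular_set[OF M(1,2), of n "\<lambda>k. onorm (\<lambda>z. (T ^^ n k) z - z)"] M(3)
    by (intro exI[of _ "{z. cmod z = 1 \<and> (\<forall>k. cmod (z ^ n k - 1) \<le> onorm (\<lambda>z. (T ^^ n k) z - z))}"] conjI
         uniform_limit_of_norm_bound[OF lim]) (auto simp: unit_circle_def)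
qed

lemma uncountable_set_of_eigenvalues:
  fixes T :: "'c::banach \<Rightarrow> 'c" and n :: "nat \<Rightarrow> nat"
  assumes J: "complex_banach_structure J" and T: "bounded_clinear_op J T"
    and unc: "uncountable (point_spectrum J T \<inter> unit_circle)"
    and lim: "(\<lambda>k. onorm (\<lambda>x. (T ^^ n k) x - x)) \<longlonglongrightarrow> 0"
  shows "\<exists>K\<subseteq>unit_circle. uncountable K \<and> uniform_limit K (\<lambda>k z. z ^ n k) (\<lambda>_. 1) sequentially"
proof (intro exI[of _ "point_spectrum J T \<inter> unit_circle"] conjI unc uniform_limit_of_norm_bound[OF lim])
  fix z k assume "z \<in> point_spectrum J T \<inter> unit_circle"
  then obtain x where x: "x \<noteq> 0" "T x = cscale J z x" by (auto simp: point_spectrum_def)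
  have lJ: "linear J" and JJ: "\<And>x. J (J x) = - x" and nJ: "\<And>c x. norm (cscale J c x) = cmod c * norm x"
    using J by (auto simp: complex_banach_structure_def)
  interpret J: linear J by (rule lJ)
  have bT: "bounded_linear T" and TJ: "\<And>x. T (J x) = J (T x)" using T by (auto simp: bounded_clinear_op_def)
  interpret T: bounded_linear T by (rule bT)
  have "T (cscale J c y) = cscale J c (T y)" for c y
    by (simp add: cscale_def T.add T.scaleR TJ)
  moreover have "cscale J c (cscale J d y) = cscale J (c * d) y" for c d y
    by (simp add: cscale_def J.add J.scale JJ algebra_simps)
  ultimately have "(T ^^ j) x = cscale J (z ^ j) x" for j
    by (induction j) (simp_all add: x mult.commute, simp add: cscale_def)
  then have "(T ^^ n k) x - x = cscale J (z ^ n k - 1) x"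
    by (simp add: cscale_def algebra_simps)
  then have "cmod (z ^ n k - 1) * norm x = norm ((T ^^ n k) x - x)" by (simp add: nJ)
  also have "\<dots> \<le> onorm (\<lambda>x. (T ^^ n k) x - x) * norm x"
    by (rule onorm) (intro bounded_linear_sub funpow_bounded_linear bT bounded_linear_ident)
  finally show "cmod (z ^ n k - 1) \<le> onorm (\<lambda>x. (T ^^ n k) x - x)" using x(1) by simp
qed auto

section \<open>Complex orthonormal bases\<close>

locale complex_hilbert =
  fixes J :: "'b::{real_inner,banach} \<Rightarrow> 'b"
  assumes chs: "complex_hilbert_structure J"
begin

sublocale J: linear J using chs by (simp add: complex_hilbert_structure_def)

lemma JJ[simp]: "J (J x) = - x" using chs by (simp add: complex_hilbert_structure_def)

lemma inner_J_J[simp]: "inner (J x) (J y) = inner x y" using chs by (simp add: complex_hilbert_structure_def)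

lemma inner_J_left: "inner (J x) y = - inner x (J y)"
  using inner_J_J[of x "J y"] by simp

lemma inner_J_self[simp]: "inner x (J x) = 0" "inner (J x) x = 0"
  using inner_J_left[of x x] by (simp_all add: inner_commute)

lemma norm_J[simp]: "norm (J x) = norm x" by (simp add: norm_eq_sqrt_inner)

lemma bounded_linear_J: "bounded_linear J"
  by (rule bounded_linear_intro[where K=1]) (auto simp: J.add J.scale)

lemma norm_cscale: "norm (cscale J c x) = cmod c * norm x"
proof -
  have "inner (cscale J c x) (cscale J c x) = ((Re c)\<^sup>2 + (Im c)\<^sup>2) * inner x x"
    by (simp add: cscale_def inner_add_left inner_add_right power2_eq_square algebra_simps)
  then have "(norm (cscale J c x))\<^sup>2 = (cmod c * norm x)\<^sup>2"
    by (simp add: power2_norm_eq_inner[of "cscale J c x"] power2_norm_eq_inner[of x] power_mult_distrib cmod_power2)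
  then show ?thesis by simp
qed

lemma banach_structure: "complex_banach_structure J"
  unfolding complex_banach_structure_def using J.linear_axioms norm_cscale by simp

lemma cscale_right: "cscale J c (x + y) = cscale J c x + cscale J c y" "cscale J c (x - y) = cscale J c x - cscale J c y"
   "cscale J c (- x) = - cscale J c x" "cscale J c 0 = 0"
  by (simp_all add: cscale_def J.add J.diff J.neg J.zero algebra_simps)

lemma cscale_left: "cscale J (c + d) x = cscale J c x + cscale J d x" "cscale J (c - d) x = cscale J c x - cscale J d x"
   "cscale J 0 x = 0" "cscale J 1 x = x" "cscale J \<i> x = J x" "cscale J (complex_of_real a) x = a *\<^sub>R x"
  by (simp_all add: cscale_def algebra_simps)

lemma cscale_cscale: "cscale J c (cscale J d x) = cscale J (c * d) x"
  by (simp add: cscale_def J.add J.scale algebra_simps)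

lemma J_cscale: "J (cscale J c x) = cscale J (\<i> * c) x"
  by (simp add: cscale_def J.add J.scale)

lemma cscale_scaleR: "cscale J c (r *\<^sub>R x) = r *\<^sub>R cscale J c x"
  by (simp add: cscale_def J.scale algebra_simps)

lemma clinear_cscale:
  assumes "bounded_linear A" "\<And>x. A (J x) = J (A x)"
  shows "A (cscale J c x) = cscale J c (A x)"
proof -
  interpret A: bounded_linear A by fact
  show ?thesis by (simp add: cscale_def A.add A.scaleR assms(2))
qed

text \<open>Orthonormality for the complex inner product with real part \<open>inner x y\<close> and
  imaginary part \<open>inner x (J y)\<close>.\<close>

definition J_orthonormal :: "'b set \<Rightarrow> bool" where
  "J_orthonormal S \<longleftrightarrow> (\<forall>x\<in>S. norm x = 1) \<and> (\<forall>x\<in>S. \<forall>y\<in>S. x \<noteq> y \<longrightarrow> inner x y = 0) \<and>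
     (\<forall>x\<in>S. \<forall>y\<in>S. inner x (J y) = 0)"

text \<open>Zorn's lemma: a non-zero vector orthogonal to \<open>S\<close> and to its image under
  \<open>J\<close> could be normalised and adjoined.\<close>

lemma maximal_J_orthonormal:
  obtains S where "J_orthonormal S"
    "\<And>z. (\<And>x. x \<in> S \<Longrightarrow> inner z x = 0) \<Longrightarrow> (\<And>x. x \<in> S \<Longrightarrow> inner z (J x) = 0) \<Longrightarrow> z = 0"
proof -
  have "\<exists>S\<in>Collect J_orthonormal. \<forall>X\<in>Collect J_orthonormal. S \<subseteq> X \<longrightarrow> X = S"
  proof (rule subset_Zorn')
    fix C assume C: "subset.chain (Collect J_orthonormal) C"
    have ex: "\<exists>Z\<in>C. x \<in> Z \<and> y \<in> Z" if "x \<in> \<Union>C" "y \<in> \<Union>C" for x y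
      using that C unfolding subset_chain_def by blast
    show "\<Union>C \<in> Collect J_orthonormal"
      unfolding mem_Collect_eq J_orthonormal_def
    proof (intro conjI ballI impI)
      fix x y assume xy: "x \<in> \<Union>C" "y \<in> \<Union>C"
      then obtain Z where Z: "Z \<in> C" "x \<in> Z" "y \<in> Z" using ex by blast
      then have "J_orthonormal Z" using C by (auto simp: subset_chain_def)
      then show "x \<noteq> y \<Longrightarrow> inner x y = 0" "inner x (J y) = 0"
        using Z by (auto simp: J_orthonormal_def)
    next
      fix x assume "x \<in> \<Union>C"
      then obtain Z where Z: "Z \<in> C" "x \<in> Z" by blast
      then have "J_orthonormal Z" using C by (auto simp: subset_chain_def)
      then show "norm x = 1" using Z by (auto simp: J_orthonormal_def)
    qed
  qed
  then obtain S where S: "J_orthonormal S" "\<And>X. J_orthonormal X \<Longrightarrow> S \<subseteq> X \<Longrightarrow> X = S" by auto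
  show ?thesis
  proof (rule that[OF S(1)])
    fix z assume z: "\<And>x. x \<in> S \<Longrightarrow> inner z x = 0" "\<And>x. x \<in> S \<Longrightarrow> inner z (J x) = 0"
    show "z = 0"
    proof (rule ccontr)
      assume nz: "z \<noteq> 0"
      define u where "u = z /\<^sub>R norm z"
      have u: "norm u = 1" "\<And>x. x \<in> S \<Longrightarrow> inner u x = 0" "\<And>x. x \<in> S \<Longrightarrow> inner u (J x) = 0"
        using nz z by (simp_all add: u_def)
      have "inner x (J u) = 0" if "x \<in> S" for x
        using u(3)[OF that] inner_J_left[of x u] by (simp add: inner_commute)
      then have "J_orthonormal (insert u S)"
        using S(1) u unfolding J_orthonormal_def by (auto simp: inner_commute)
      then have "insert u S = S" by (rule S(2)) auto
      then have "u \<in> S" by auto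
      then have "inner u u = 0" using u(2) by blast
      then show False using u(1) by (simp add: norm_eq_sqrt_inner)
    qed
  qed
qed

text \<open>Separability makes a maximal system countable, since orthonormal vectors have distance
  sqrt 2 and dense points within 1/2 of them are distinct. Infinite dimension makes it infinite: a
  finite \<open>S\<close> would span the whole space together with its image under
  \<open>J\<close>.\<close>

lemma orthonormal_basis_exists:
  assumes sep: "separable_type TYPE('b)" and inf: "\<forall>B::'b set. finite B \<longrightarrow> span B \<noteq> UNIV"
  shows "\<exists>e :: nat \<Rightarrow> 'b. (\<forall>i j. inner (e i) (e j) = of_bool (i = j)) \<and> (\<forall>i j. inner (e i) (J (e j)) = 0) \<and>
    (\<forall>z. (\<forall>i. inner z (e i) = 0 \<and> inner z (J (e i)) = 0) \<longrightarrow> z = 0)"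
proof -
  obtain S where S: "J_orthonormal S"
    and total: "\<And>z. (\<And>x. x \<in> S \<Longrightarrow> inner z x = 0) \<Longrightarrow> (\<And>x. x \<in> S \<Longrightarrow> inner z (J x) = 0) \<Longrightarrow> z = 0"
    using maximal_J_orthonormal by blast
  have n1: "\<And>x. x \<in> S \<Longrightarrow> inner x x = 1" using S by (simp add: J_orthonormal_def norm_eq_sqrt_inner)
  obtain D :: "'b set" where D: "countable D" "closure D = UNIV" using sep by (rule separable_typeE)
  have "countable S"
  proof -
    have "\<exists>d\<in>D. dist d x < 1/2" for x
      using D(2) closure_approachable[of x D] by (metis UNIV_I half_gt_zero zero_less_one)
    then obtain f where f: "\<And>x. f x \<in> D" "\<And>x. dist (f x) x < 1/2" by metis
    have "inj_on f S"
    proof (rule inj_onI, rule ccontr)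
      fix x y assume xy: "x \<in> S" "y \<in> S" "f x = f y" "x \<noteq> y"
      have "dist x y < 1" using f(2)[of x] f(2)[of y] xy(3) dist_triangle2[of x y "f x"] by (simp add: dist_commute)
      moreover have "(dist x y)\<^sup>2 = 2"
        using S xy n1 unfolding dist_norm power2_norm_eq_inner J_orthonormal_def
        by (simp add: inner_diff_left inner_diff_right inner_commute)
      ultimately show False
        by (metis abs_square_less_1 abs_of_nonneg zero_le_dist not_less one_le_numeral)
    qed
    moreover have "countable (f ` S)" using D(1) f(1) by (meson countable_subset image_subsetI)
    ultimately show ?thesis using countable_image_inj_on by blast
  qed
  moreover have "infinite S"
  proof
    assume fin: "finite S"
    have "z \<in> span (S \<union> J ` S)" for z
    proof -
      \<comment> \<open>The orthogonal projection of \<open>z\<close>; the residual is orthogonal to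
        \<open>S\<close> and its image, so it vanishes by maximality.\<close>
      define p where "p = (\<Sum>x\<in>S. inner z x *\<^sub>R x + inner z (J x) *\<^sub>R J x)"
      have "p \<in> span (S \<union> J ` S)"
        unfolding p_def by (intro span_sum span_add span_scale span_base) auto
      have s1: "(\<Sum>x\<in>S. inner (inner z x *\<^sub>R x + inner z (J x) *\<^sub>R J x) w) = h" if "y \<in> S"
        "\<And>x. x \<in> S \<Longrightarrow> inner (inner z x *\<^sub>R x + inner z (J x) *\<^sub>R J x) w = (if x = y then h else 0)" for w h y
        using that fin by (simp add: sum.delta)
      have "inner (z - p) y = 0" if "y \<in> S" for y
      proof -
        have "inner p y = inner z y"
          unfolding p_def inner_sum_left
          by (rule s1[OF that]) (use S n1 that in \<open>auto simp: J_orthonormal_def inner_add_left inner_J_left\<close>)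
        then show ?thesis by (simp add: inner_diff_left)
      qed
      moreover have "inner (z - p) (J y) = 0" if "y \<in> S" for y
      proof -
        have "inner p (J y) = inner z (J y)"
          unfolding p_def inner_sum_left
          by (rule s1[OF that]) (use S n1 that in \<open>auto simp: J_orthonormal_def inner_add_left\<close>)
        then show ?thesis by (simp add: inner_diff_left)
      qed
      ultimately have "z - p = 0" by (rule total)
      then show ?thesis using \<open>p \<in> _\<close> by simp
    qed
    then have "UNIV = span (S \<union> J ` S)" by (rule UNIV_eq_I)
    then show False using inf[rule_format, of "S \<union> J ` S"] fin by simp
  qed
  ultimately have bij: "bij_betw (from_nat_into S) UNIV S" by (rule bij_betw_from_nat_into)
  define e where "e = from_nat_into S"
  have eS: "e i \<in> S" "range e = S" "inj e" for i
    using bij by (auto simp: e_def bij_betw_def)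
  show ?thesis
  proof (intro exI[of _ e] conjI allI impI)
    fix i j show "inner (e i) (e j) = of_bool (i = j)"
      using S n1 eS(1) eS(3) by (auto simp: J_orthonormal_def inj_eq)
    show "inner (e i) (J (e j)) = 0" using S eS(1) by (auto simp: J_orthonormal_def)
  next
    fix z assume z: "\<forall>i. inner z (e i) = 0 \<and> inner z (J (e i)) = 0"
    then have "\<And>x. x \<in> S \<Longrightarrow> inner z x = 0" "\<And>x. x \<in> S \<Longrightarrow> inner z (J x) = 0" using eS(2) by auto
    then show "z = 0" by (rule total)
  qed
qed

end

section \<open>Coordinates and operators in an orthonormal basis\<close>

locale complex_onb = complex_hilbert J for J :: "'b::{real_inner,banach} \<Rightarrow> 'b" +
  fixes e :: "nat \<Rightarrow> 'b"
  assumes inner_e: "inner (e i) (e j) = of_bool (i = j)" and inner_e_J: "inner (e i) (J (e j)) = 0"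
    and total_e: "(\<And>i. inner z (e i) = 0) \<Longrightarrow> (\<And>i. inner z (J (e i)) = 0) \<Longrightarrow> z = 0"
begin

text \<open>The complex inner product of \<open>z\<close> with \<open>e j\<close>, linear in
  \<open>z\<close>.\<close>

definition coord :: "nat \<Rightarrow> 'b \<Rightarrow> complex" where
  "coord j z = Complex (inner z (e j)) (inner z (J (e j)))"

lemma norm_e[simp]: "norm (e i) = 1" by (simp add: norm_eq_sqrt_inner inner_e)

lemma coord_linear: "coord j (x + y) = coord j x + coord j y" "coord j (x - y) = coord j x - coord j y"
  "coord j (r *\<^sub>R x) = complex_of_real r * coord j x" "coord j (J x) = \<i> * coord j x"
  by (simp_all add: coord_def complex_eq_iff inner_add_left inner_diff_left inner_J_left)

lemma coord_e: "coord j (e k) = of_bool (j = k)"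
  by (auto simp: coord_def inner_e inner_e_J complex_eq_iff)

lemma inner_cscale_e:
  "inner (cscale J a (e i)) (cscale J b (e j)) = (if i = j then Re (a * cnj b) else 0)"
  by (auto simp: cscale_def inner_add_left inner_add_right inner_e inner_e_J inner_J_left algebra_simps)

lemma inner_cscale_e_right: "inner z (cscale J a (e j)) = Re (coord j z * cnj a)"
  by (simp add: cscale_def coord_def inner_add_right)

lemma norm_sum_cscale_e:
  assumes "finite F" shows "(norm (\<Sum>j\<in>F. cscale J (a j) (e j)))\<^sup>2 = (\<Sum>j\<in>F. (cmod (a j))\<^sup>2)"
proof -
  have "(norm (\<Sum>j\<in>F. cscale J (a j) (e j)))\<^sup>2 = (\<Sum>i\<in>F. \<Sum>j\<in>F. (if i = j then Re (a i * cnj (a j)) else 0))"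
    unfolding power2_norm_eq_inner inner_sum_left inner_sum_right inner_cscale_e by (rule sum.swap)
  also have "\<dots> = (\<Sum>i\<in>F. Re (a i * cnj (a i)))" using assms by (simp add: sum.delta)
  also have "\<dots> = (\<Sum>j\<in>F. (cmod (a j))\<^sup>2)"
    by (intro sum.cong refl) (simp add: complex_mult_cnj cmod_power2)
  finally show ?thesis .
qed

lemma bessel: "(\<Sum>j<N. (cmod (coord j z))\<^sup>2) \<le> (norm z)\<^sup>2"
proof -
  define p where "p = (\<Sum>j<N. cscale J (coord j z) (e j))"
  have p: "inner p p = (\<Sum>j<N. (cmod (coord j z))\<^sup>2)"
    using norm_sum_cscale_e[of "{..<N}" "\<lambda>j. coord j z"] by (simp add: p_def power2_norm_eq_inner)
  have zp: "inner z p = (\<Sum>j<N. (cmod (coord j z))\<^sup>2)"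
    unfolding p_def inner_sum_right inner_cscale_e_right
    by (intro sum.cong refl) (simp add: complex_mult_cnj cmod_power2)
  have "0 \<le> inner (z - p) (z - p)" by simp
  also have "\<dots> = inner z z - inner z p - inner p z + inner p p" by (simp add: inner_diff_left inner_diff_right)
  also have "\<dots> = (norm z)\<^sup>2 - (\<Sum>j<N. (cmod (coord j z))\<^sup>2)"
    using p zp by (simp add: inner_commute power2_norm_eq_inner)
  finally show ?thesis by simp
qed

lemma coord_le: "cmod (coord j z) \<le> norm z"
proof -
  have "(cmod (coord j z))\<^sup>2 \<le> (\<Sum>i<Suc j. (cmod (coord i z))\<^sup>2)" by (simp add: sum_nonneg)
  also have "\<dots> \<le> (norm z)\<^sup>2" by (rule bessel)
  finally show ?thesis by (rule power2_le_imp_le) simp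
qed

lemma bounded_linear_coord: "bounded_linear (coord j)"
  by (rule bounded_linear_intro[where K=1]) (auto simp: coord_linear scaleR_conv_of_real coord_le)

lemma coord_cscale: "coord j (cscale J c x) = c * coord j x"
  by (simp add: cscale_def coord_linear complex_eq_iff)

lemma summable_coord: "summable (\<lambda>j. (cmod (coord j z))\<^sup>2)"
proof (rule bounded_imp_summable[where B="(norm z)\<^sup>2"])
  show "(\<Sum>k\<le>n. (cmod (coord k z))\<^sup>2) \<le> (norm z)\<^sup>2" for n
    unfolding lessThan_Suc_atMost[symmetric] by (rule bessel)
qed simp

lemma summable_cscale_e:
  assumes "summable (\<lambda>j. (cmod (a j))\<^sup>2)"
  shows "summable (\<lambda>j. cscale J (a j) (e j))"
  unfolding summable_Cauchy
proof (intro allI impI)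
  fix \<epsilon> :: real assume "\<epsilon> > 0"
  then have "\<epsilon>\<^sup>2 > 0" by simp
  with assms obtain N where N: "\<And>m n. m \<ge> N \<Longrightarrow> norm (\<Sum>j=m..<n. (cmod (a j))\<^sup>2) < \<epsilon>\<^sup>2"
    unfolding summable_Cauchy by blast
  have cau: "norm (\<Sum>j=m..<n. cscale J (a j) (e j)) < \<epsilon>" if "m \<ge> N" for m n
  proof -
    have "(norm (\<Sum>j=m..<n. cscale J (a j) (e j)))\<^sup>2 < \<epsilon>\<^sup>2"
      using N[OF that, of n] by (simp add: norm_sum_cscale_e sum_nonneg)
    then show ?thesis using \<open>\<epsilon> > 0\<close> by (intro power2_less_imp_less[of _ \<epsilon>]) auto
  qed
  show "\<exists>N. \<forall>m\<ge>N. \<forall>n. norm (\<Sum>j=m..<n. cscale J (a j) (e j)) < \<epsilon>"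
    by (intro exI[of _ N] allI impI) (rule cau)
qed

lemma norm_suminf_cscale_e_le:
  assumes a: "summable (\<lambda>j. (cmod (a j))\<^sup>2)" and B: "\<And>N. (\<Sum>j<N. (cmod (a j))\<^sup>2) \<le> B\<^sup>2" "B \<ge> 0"
  shows "norm (\<Sum>j. cscale J (a j) (e j)) \<le> B"
proof -
  have lim: "(\<lambda>N. norm (\<Sum>j<N. cscale J (a j) (e j))) \<longlonglongrightarrow> norm (\<Sum>j. cscale J (a j) (e j))"
    by (rule tendsto_norm, rule summable_LIMSEQ, rule summable_cscale_e, rule a)
  have "norm (\<Sum>j<N. cscale J (a j) (e j)) \<le> B" for N
  proof (rule power2_le_imp_le[OF _ B(2)])
    show "(norm (\<Sum>j<N. cscale J (a j) (e j)))\<^sup>2 \<le> B\<^sup>2"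
      using B(1)[of N] norm_sum_cscale_e[of "{..<N}" a] by simp
  qed
  then show ?thesis by (intro LIMSEQ_le_const2[OF lim] exI[of _ 0]) auto
qed

lemma coord_suminf:
  assumes a: "summable (\<lambda>j. (cmod (a j))\<^sup>2)"
  shows "coord k (\<Sum>j. cscale J (a j) (e j)) = a k"
proof -
  have "(\<lambda>j. coord k (cscale J (a j) (e j))) sums coord k (\<Sum>j. cscale J (a j) (e j))"
    by (rule bounded_linear.sums[OF bounded_linear_coord summable_sums[OF summable_cscale_e[OF a]]])
  moreover have "(\<lambda>j. coord k (cscale J (a j) (e j))) = (\<lambda>j. if j = k then a j else 0)"
    by (auto simp: coord_cscale coord_e)
  ultimately have "(\<lambda>j. if j = k then a j else 0) sums coord k (\<Sum>j. cscale J (a j) (e j))" by simp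
  then show ?thesis by (rule sums_unique2) (rule sums_single)
qed

lemma expansion: "(\<lambda>j. cscale J (coord j z) (e j)) sums z"
proof -
  let ?y = "\<Sum>j. cscale J (coord j z) (e j)"
  have "coord k (z - ?y) = 0" for k
    by (simp add: coord_linear coord_suminf[OF summable_coord])
  then have "z - ?y = 0" by (intro total_e) (auto simp: coord_def complex_eq_iff)
  then show ?thesis using summable_sums[OF summable_cscale_e[OF summable_coord[of z]]] by simp
qed

lemma bounded_clinear_eqI:
  assumes A: "bounded_clinear_op J A" and B: "bounded_clinear_op J B" and eq: "\<And>k. A (e k) = B (e k)"
  shows "A = B"
proof
  fix z
  have bl: "bounded_linear A" "bounded_linear B" and AJ: "\<And>x. A (J x) = J (A x)" "\<And>x. B (J x) = J (B x)"
    using A B by (auto simp: bounded_clinear_op_def)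
  have "(\<lambda>j. A (cscale J (coord j z) (e j))) sums A z"
    by (rule bounded_linear.sums[OF bl(1) expansion])
  moreover have "(\<lambda>j. B (cscale J (coord j z) (e j))) sums B z"
    by (rule bounded_linear.sums[OF bl(2) expansion])
  moreover have "A (cscale J c (e j)) = B (cscale J c (e j))" for c j
    using clinear_cscale[OF bl(1) AJ(1)] clinear_cscale[OF bl(2) AJ(2)] eq by simp
  ultimately show "A z = B z" by (simp add: sums_unique2)
qed

definition diag_op :: "(nat \<Rightarrow> complex) \<Rightarrow> 'b \<Rightarrow> 'b" where
  "diag_op \<alpha> z = (\<Sum>j. cscale J (\<alpha> j * coord j z) (e j))"

text \<open>Meant as the operator that sends \<open>e j\<close> to \<open>r j\<close>; summability
  of the norms of \<open>r\<close> makes it nuclear and bounds its norm by their sum.\<close>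

definition nuclear_op :: "(nat \<Rightarrow> 'b) \<Rightarrow> 'b \<Rightarrow> 'b" where
  "nuclear_op r z = (\<Sum>j. cscale J (coord j z) (r j))"

lemma diag_op:
  assumes \<alpha>: "\<And>j. cmod (\<alpha> j) \<le> B"
  shows "bounded_clinear_op J (diag_op \<alpha>)" "norm (diag_op \<alpha> z) \<le> B * norm z" "diag_op \<alpha> (e k) = cscale J (\<alpha> k) (e k)"
proof -
  have B: "B \<ge> 0" using \<alpha>[of 0] norm_ge_zero order_trans by blast
  have le: "(cmod (\<alpha> j * coord j z))\<^sup>2 \<le> B\<^sup>2 * (cmod (coord j z))\<^sup>2" for j z
    unfolding norm_mult power_mult_distrib by (intro mult_right_mono power_mono \<alpha>) auto
  have s: "summable (\<lambda>j. (cmod (\<alpha> j * coord j z))\<^sup>2)" for z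
    by (rule summable_comparison_test'[OF summable_mult[OF summable_coord[of z], of "B\<^sup>2"]]) (use le in auto)
  note s' = summable_cscale_e[OF s]
  have n: "norm (diag_op \<alpha> z) \<le> B * norm z" for z
    unfolding diag_op_def
  proof (rule norm_suminf_cscale_e_le[OF s])
    fix N
    have "(\<Sum>j<N. (cmod (\<alpha> j * coord j z))\<^sup>2) \<le> B\<^sup>2 * (\<Sum>j<N. (cmod (coord j z))\<^sup>2)"
      unfolding sum_distrib_left by (intro sum_mono le)
    also have "\<dots> \<le> B\<^sup>2 * (norm z)\<^sup>2" by (intro mult_left_mono bessel) auto
    finally show "(\<Sum>j<N. (cmod (\<alpha> j * coord j z))\<^sup>2) \<le> (B * norm z)\<^sup>2" by (simp add: power_mult_distrib)
  qed (use B in auto)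
  show "norm (diag_op \<alpha> z) \<le> B * norm z" by (rule n)
  have "bounded_linear (diag_op \<alpha>)"
  proof (rule bounded_linear_intro[where K=B])
    show "diag_op \<alpha> (x + y) = diag_op \<alpha> x + diag_op \<alpha> y" for x y
      unfolding diag_op_def using suminf_add[OF s'[of x] s'[of y]]
      by (simp add: coord_linear distrib_left cscale_left)
    show "diag_op \<alpha> (r *\<^sub>R x) = r *\<^sub>R diag_op \<alpha> x" for r x
    proof -
      have "cscale J (\<alpha> j * coord j (r *\<^sub>R x)) (e j) = r *\<^sub>R cscale J (\<alpha> j * coord j x) (e j)" for j
        by (simp add: coord_linear cscale_def algebra_simps)
      then show ?thesis unfolding diag_op_def using suminf_scaleR_right[OF s'[of x], of r] by simp
    qed
    show "norm (diag_op \<alpha> x) \<le> norm x * B" for x using n[of x] by (simp add: mult.commute)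
  qed
  moreover have "diag_op \<alpha> (J x) = J (diag_op \<alpha> x)" for x
    unfolding diag_op_def using bounded_linear.suminf[OF bounded_linear_J s'[of x]]
    by (simp add: coord_linear J_cscale mult.left_commute)
  ultimately show "bounded_clinear_op J (diag_op \<alpha>)" by (simp add: bounded_clinear_op_def)
  have "(\<lambda>j. cscale J (\<alpha> j * coord j (e k)) (e j)) = (\<lambda>j. if j = k then cscale J (\<alpha> j) (e j) else 0)"
    by (auto simp: coord_e cscale_left)
  then show "diag_op \<alpha> (e k) = cscale J (\<alpha> k) (e k)"
    unfolding diag_op_def using sums_single[of k "\<lambda>j. cscale J (\<alpha> j) (e j)"] by (simp add: sums_iff)
qed

lemma nuclear_op:
  assumes r: "summable (\<lambda>j. norm (r j))"
  shows "bounded_clinear_op J (nuclear_op r)" "norm (nuclear_op r z) \<le> (\<Sum>j. norm (r j)) * norm z" "nuclear_op r (e k) = r k"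
proof -
  have le: "norm (cscale J (coord j z) (r j)) \<le> norm z * norm (r j)" for j z
    unfolding norm_cscale by (intro mult_right_mono coord_le) auto
  have sn: "summable (\<lambda>j. norm (cscale J (coord j z) (r j)))" for z
    by (rule summable_comparison_test'[OF summable_mult[OF r, of "norm z"]]) (use le in auto)
  note s' = summable_norm_cancel[OF sn]
  have n: "norm (nuclear_op r z) \<le> (\<Sum>j. norm (r j)) * norm z" for z
  proof -
    have "norm (nuclear_op r z) \<le> (\<Sum>j. norm (cscale J (coord j z) (r j)))"
      unfolding nuclear_op_def by (rule summable_norm[OF sn])
    also have "\<dots> \<le> (\<Sum>j. norm z * norm (r j))" by (intro suminf_le le sn summable_mult r)
    also have "\<dots> = (\<Sum>j. norm (r j)) * norm z" using r by (simp add: suminf_mult mult.commute)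
    finally show ?thesis .
  qed
  show "norm (nuclear_op r z) \<le> (\<Sum>j. norm (r j)) * norm z" by (rule n)
  have "bounded_linear (nuclear_op r)"
  proof (rule bounded_linear_intro[where K="\<Sum>j. norm (r j)"])
    show "nuclear_op r (x + y) = nuclear_op r x + nuclear_op r y" for x y
      unfolding nuclear_op_def using suminf_add[OF s'[of x] s'[of y]]
      by (simp add: coord_linear cscale_left)
    show "nuclear_op r (c *\<^sub>R x) = c *\<^sub>R nuclear_op r x" for c x
    proof -
      have "cscale J (coord j (c *\<^sub>R x)) (r j) = c *\<^sub>R cscale J (coord j x) (r j)" for j
        by (simp add: coord_linear cscale_def algebra_simps)
      then show ?thesis unfolding nuclear_op_def using suminf_scaleR_right[OF s'[of x], of c] by simp
    qed
    show "norm (nuclear_op r x) \<le> norm x * (\<Sum>j. norm (r j))" for x using n[of x] by (simp add: mult.commute)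
  qed
  moreover have "nuclear_op r (J x) = J (nuclear_op r x)" for x
    unfolding nuclear_op_def using bounded_linear.suminf[OF bounded_linear_J s'[of x]]
    by (simp add: coord_linear J_cscale)
  ultimately show "bounded_clinear_op J (nuclear_op r)" by (simp add: bounded_clinear_op_def)
  have "(\<lambda>j. cscale J (coord j (e k)) (r j)) = (\<lambda>j. if j = k then r j else 0)"
    by (auto simp: coord_e cscale_left)
  then show "nuclear_op r (e k) = r k"
    unfolding nuclear_op_def using sums_single[of k r] by (simp add: sums_iff)
qed

lemma bounded_clinear_add:
  assumes "bounded_clinear_op J A" "bounded_clinear_op J B"
  shows "bounded_clinear_op J (\<lambda>z. A z + B z)"
  using assms by (auto simp: bounded_clinear_op_def J.add intro: bounded_linear_add)

text \<open>A bounded complex-linear operator is determined on the basis, so its values there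
  identify \<open>T\<close> as a diagonal plus a nuclear operator. Applied to the difference of
  \<open>T ^^ n k\<close> and the identity, this avoids expanding powers of a sum of
  operators.\<close>

lemma onorm_diag_nuclear_le:
  assumes T: "bounded_clinear_op J T" and eq: "\<And>k. T (e k) = cscale J (\<alpha> k) (e k) + r k"
    and \<alpha>: "\<And>j. cmod (\<alpha> j) \<le> B" and r: "summable (\<lambda>j. norm (r j))"
  shows "onorm T \<le> B + (\<Sum>j. norm (r j))"
proof -
  have "T = (\<lambda>z. diag_op \<alpha> z + nuclear_op r z)"
    by (rule bounded_clinear_eqI[OF T bounded_clinear_add[OF diag_op(1)[OF \<alpha>] nuclear_op(1)[OF r]]])
      (simp add: eq diag_op(3)[OF \<alpha>] nuclear_op(3)[OF r])
  moreover have "norm (diag_op \<alpha> z + nuclear_op r z) \<le> (B + (\<Sum>j. norm (r j))) * norm z" for z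
    using norm_triangle_ineq[of "diag_op \<alpha> z" "nuclear_op r z"] diag_op(2)[of \<alpha> B z, OF \<alpha>] nuclear_op(2)[OF r, where z=z]
    by (simp add: algebra_simps)
  moreover have "B + (\<Sum>j. norm (r j)) \<ge> 0"
    using \<alpha>[of 0] norm_ge_zero[of "\<alpha> 0"] suminf_nonneg[OF r] by (meson add_nonneg_nonneg norm_ge_zero order_trans)
  ultimately show ?thesis by (intro onorm_bound) auto
qed

end

section \<open>The tree of eigenvalues\<close>

text \<open>The binary tree: the nodes of level \<open>L\<close> are the numbers below \<open>2 ^ L\<close>, and node \<open>i\<close> of level \<open>L\<close> has
  the two successors \<open>i\<close> and \<open>2 ^ L + i\<close> in level \<open>L + 1\<close>.  Thus the parent drops the leading binary
  digit, and the ancestor of \<open>i\<close> in level \<open>l\<close> is \<open>i mod 2 ^ l\<close>.\<close>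

definition par :: "nat \<Rightarrow> nat" where
  "par j = j - 2 ^ floor_log j"

lemma par_less: "j > 0 \<Longrightarrow> par j < j"
  by (simp add: par_def)

lemma par_add_power:
  assumes "i < 2 ^ L" shows "par (2 ^ L + i) = i" "floor_log (2 ^ L + i) = L"
proof -
  show "floor_log (2 ^ L + i) = L" using assms by (intro floor_log_eqI) auto
  then show "par (2 ^ L + i) = i" by (simp add: par_def)
qed

text \<open>Removing the leading binary digit leaves the digits below position \<open>l\<close>
  alone, as long as the leading one is not among them.\<close>

lemma par_mod:
  assumes "2 ^ l \<le> j" shows "par j mod 2 ^ l = j mod 2 ^ l"
proof -
  have j: "j > 0" using assms by (metis gr0I not_le zero_less_power zero_less_numeral)
  have "l \<le> floor_log j"
    using floor_log_le_iff[OF assms] by simp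
  then have "(2::nat) ^ l dvd 2 ^ floor_log j" by (rule le_imp_power_dvd)
  moreover have "par j + 2 ^ floor_log j = j" using floor_log_exp2_le[OF j] by (simp add: par_def)
  ultimately show ?thesis by (metis mod_add_right_eq add_0_right dvd_imp_mod_0)
qed

text \<open>Telescoping over the path from \<open>i\<close> to its ancestor in level
  \<open>l\<close>: indices strictly increase along the path, so the jumps \<open>(1/2) ^ j\<close>
  sum to at most 1.\<close>

lemma branch_bound:
  fixes f :: "nat \<Rightarrow> 'x::real_normed_vector"
  assumes f: "\<And>j. j \<ge> 2 ^ l \<Longrightarrow> norm (f j - f (par j)) \<le> B * (1/2) ^ j" and B: "B \<ge> 0"
  shows "norm (f i - f (i mod 2 ^ l)) \<le> B"
proof -
  \<comment> \<open>Strengthened for the induction: since \<open>par i < i\<close>, the bound at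
    \<open>par i\<close> leaves room for twice \<open>(1/2) ^ i\<close>.\<close>
  have "norm (f i - f (i mod 2 ^ l)) \<le> B * (1 - (1/2) ^ i)"
  proof (induction i rule: less_induct)
    case (less i)
    show ?case
    proof (cases "i < 2 ^ l")
      case True
      then show ?thesis using B by (simp add: power_le_one)
    next
      case False
      then have i: "2 ^ l \<le> i" by simp
      then have i0: "i > 0" by (metis gr0I not_le zero_less_power zero_less_numeral)
      note pl = par_less[OF i0]
      have "norm (f i - f (i mod 2 ^ l)) \<le> norm (f i - f (par i)) + norm (f (par i) - f (par i mod 2 ^ l))"
        using norm_triangle_ineq[of "f i - f (par i)" "f (par i) - f (par i mod 2 ^ l)"] by (simp add: par_mod[OF i])
      also have "\<dots> \<le> B * (1/2) ^ i + B * (1 - (1/2) ^ par i)"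
        by (intro add_mono f i less pl)
      also have "\<dots> = B * (1 + (1/2) ^ i - (1/2) ^ par i)" by (simp add: algebra_simps)
      also have "\<dots> \<le> B * (1 - (1/2) ^ i)"
      proof (intro mult_left_mono B)
        have "(1/2::real) ^ (i - 1) \<le> (1/2) ^ par i" using pl by (intro power_decreasing) auto
        moreover have "(1/2::real) ^ (i - 1) = 2 * (1/2) ^ i" using i0 by (cases i) auto
        ultimately show "1 + (1/2) ^ i - (1/2) ^ par i \<le> 1 - (1/2::real) ^ i" by linarith
      qed
      finally show ?thesis .
    qed
  qed
  also have "\<dots> \<le> B * 1" using B by (intro mult_left_mono) auto
  finally show ?thesis by simp
qed

section \<open>Choice of the eigenvalues\<close>

lemma uncountable_condensation:
  fixes K :: "'a::second_countable_topology set"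
  assumes "uncountable K"
  shows "\<exists>K'\<subseteq>K. K' \<noteq> {} \<and> (\<forall>x\<in>K'. \<forall>U. open U \<longrightarrow> x \<in> U \<longrightarrow> infinite (U \<inter> K'))"
proof -
  obtain B :: "'a set set" where B: "countable B" "topological_basis B" using ex_countable_basis by blast
  \<comment> \<open>The points of \<open>K\<close> that are not condensation points: those with a
    basic neighbourhood meeting \<open>K\<close> in a countable set. The countable basis makes
    \<open>N\<close> countable, so removing it does not spoil the uncountable neighbourhoods of the
    other points.\<close>
  define N where "N = \<Union>{U \<in> B. countable (U \<inter> K)} \<inter> K"
  have N: "countable N"
  proof -
    have eq: "N = (\<Union>U\<in>{U \<in> B. countable (U \<inter> K)}. U \<inter> K)" unfolding N_def by auto
    show ?thesis unfolding eq using B(1) by (intro countable_UN countable_Collect) auto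
  qed
  show ?thesis
  proof (intro exI[of _ "K - N"] conjI ballI allI impI)
    show "K - N \<noteq> {}" using assms N by (metis Diff_eq_empty_iff countable_subset)
    fix x U assume x: "x \<in> K - N" and U: "open U" "x \<in> U"
    obtain V where V: "V \<in> B" "x \<in> V" "V \<subseteq> U" using B(2) U by (metis topological_basisE)
    have "uncountable (V \<inter> K)" using x V by (auto simp: N_def)
    then have "uncountable (V \<inter> K - N)" using N by (simp add: uncountable_minus_countable)
    then have "infinite (V \<inter> K - N)" using countable_finite by blast
    then show "infinite (U \<inter> (K - N))" using V(3) by (metis (no_types, lifting) Diff_Int_distrib2 Int_Diff Int_mono infinite_super order_refl)
  qed auto
qed

text \<open>From some index \<open>k0\<close> on both powers lie within \<open>\<delta> / 2\<close>
  of 1, uniformly on \<open>K\<close>; continuity of finitely many power maps handles the other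
  \<open>k\<close>.\<close>

lemma uniformly_close_powers:
  fixes n :: "nat \<Rightarrow> nat"
  assumes lim: "e \<longlonglongrightarrow> 0" and e: "\<And>z k. z \<in> K \<Longrightarrow> cmod (z ^ n k - 1) \<le> e k" and x: "x \<in> K" and d: "\<delta> > 0"
  shows "\<exists>U. open U \<and> x \<in> U \<and> (\<forall>y\<in>U \<inter> K. cmod (y - x) \<le> \<delta> \<and> (\<forall>k. cmod (y ^ n k - x ^ n k) \<le> \<delta>))"
proof -
  have "\<forall>\<^sub>F k in sequentially. e k < \<delta> / 2" using lim d by (intro order_tendstoD) auto
  then obtain k0 where k0: "\<And>k. k \<ge> k0 \<Longrightarrow> e k < \<delta> / 2" by (auto simp: eventually_sequentially)
  define U where "U = ball x \<delta> \<inter> (\<Inter>k\<in>{..<k0}. {y. cmod (y ^ n k - x ^ n k) < \<delta>})"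
  have "open U" unfolding U_def
    by (intro open_Int open_ball open_INT finite_lessThan ballI open_Collect_less continuous_intros)
  moreover have "x \<in> U" using d by (simp add: U_def)
  moreover have "cmod (y - x) \<le> \<delta> \<and> (\<forall>k. cmod (y ^ n k - x ^ n k) \<le> \<delta>)" if "y \<in> U \<inter> K" for y
  proof (intro conjI allI)
    show "cmod (y - x) \<le> \<delta>" using that by (auto simp: U_def dist_norm norm_minus_commute)
    fix k show "cmod (y ^ n k - x ^ n k) \<le> \<delta>"
    proof (cases "k < k0")
      case True
      then show ?thesis using that by (auto simp: U_def intro: less_imp_le)
    next
      case False
      have "cmod (y ^ n k - x ^ n k) \<le> cmod (y ^ n k - 1) + cmod (x ^ n k - 1)"
        using norm_triangle_ineq4[of "y ^ n k - 1" "x ^ n k - 1"] by simp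
      also have "\<dots> \<le> e k + e k" using that x by (intro add_mono e) auto
      also have "\<dots> \<le> \<delta>" using k0[of k] False by simp
      finally show ?thesis .
    qed
  qed
  ultimately show ?thesis by blast
qed

text \<open>Node by node, a new point is chosen near its parent, and the closer the smaller the
  distances between the points already chosen. Descendants then stay near their ancestors on the
  scale of that separation, so distinct nodes of a level have separated subtrees.\<close>

lemma eigenvalue_tree_exists:
  fixes n :: "nat \<Rightarrow> nat"
  assumes unc: "uncountable K" and lim: "e \<longlonglongrightarrow> 0" and e: "\<And>z k. z \<in> K \<Longrightarrow> cmod (z ^ n k - 1) \<le> e k"
  shows "\<exists>lam :: nat \<Rightarrow> complex. (\<forall>j. lam j \<in> K) \<and>
     (\<forall>j>0. cmod (lam j - lam (par j)) \<le> (1/16) ^ j \<and> (\<forall>k. cmod (lam j ^ n k - lam (par j) ^ n k) \<le> (1/16) ^ j)) \<and>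
     (\<exists>\<sigma>. \<forall>l. \<sigma> l > 0 \<and> (\<forall>i i'. i mod 2 ^ l \<noteq> i' mod 2 ^ l \<longrightarrow> cmod (lam i - lam i') \<ge> \<sigma> l))"
proof -
  obtain K' where K': "K' \<subseteq> K" "K' \<noteq> {}" "\<And>x U. x \<in> K' \<Longrightarrow> open U \<Longrightarrow> x \<in> U \<Longrightarrow> infinite (U \<inter> K')"
    using uncountable_condensation[OF unc] by blast
  \<comment> \<open>The least distance between two of the first \<open>j\<close> values; the 1 keeps
    the minimum meaningful when there are no pairs.\<close>
  define sep where "sep f j = Min (insert 1 ((\<lambda>(i, i'). cmod (f i - f i')) ` {(i, i'). i < i' \<and> i' < j}))" for f :: "nat \<Rightarrow> complex" and j
  have fin: "finite {(i, i'). i < i' \<and> i' < (j::nat)}" for j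
    by (rule finite_subset[of _ "{..<j} \<times> {..<j}"]) auto
  \<comment> \<open>The factor \<open>(1/2) ^ j\<close> is the one of \<open>branch_bound\<close>;
    the divisor 8 keeps the total drift below a node so small that two drifts leave at least half of
    the separation. Only values of \<open>f\<close> below \<open>j\<close> occur, as recursion on
    \<open>j\<close> demands.\<close>
  define P where "P f j r \<longleftrightarrow> r \<in> K' \<and> (\<forall>i<j. r \<noteq> f i) \<and> (j > 0 \<longrightarrow>
     cmod (r - f (par j)) \<le> min ((1/16) ^ j) (sep f j / 8 * (1/2) ^ j) \<and> (\<forall>k. cmod (r ^ n k - f (par j) ^ n k) \<le> (1/16) ^ j))" for f j r
  have "\<exists>lam. \<forall>j. P lam j (lam j)"
  proof (rule dependent_wf_choice[OF wf_less])
    fix f g :: "nat \<Rightarrow> complex" and j r assume eq: "\<And>z. (z, j) \<in> {(x, y). x < y} \<Longrightarrow> f z = g z"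
    then have "sep f j = sep g j" unfolding sep_def
      by (intro arg_cong[of _ _ Min] arg_cong2[of _ _ _ _ insert] refl image_cong) auto
    then show "P f j r = P g j r" using eq par_less[of j] by (auto simp: P_def)
  next
    fix j f assume IH: "\<And>y. (y, j) \<in> {(x, y). x < y} \<Longrightarrow> P f y (f y)"
    show "\<exists>r. P f j r"
    proof (cases "j = 0")
      case True
      then show ?thesis using K'(2) by (auto simp: P_def)
    next
      case False
      then have p: "par j < j" by (intro par_less) simp
      have x: "f (par j) \<in> K'" using IH[of "par j"] p by (simp add: P_def)
      have dist: "f i \<noteq> f i'" if "i < i'" "i' < j" for i i' using IH[of i'] that unfolding P_def by fastforce
      have "sep f j > 0" unfolding sep_def
        by (subst Min_gr_iff) (use fin dist in auto)
      then have "min ((1/16) ^ j) (sep f j / 8 * (1/2) ^ j) > 0" by simp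
      from uniformly_close_powers[OF lim, of K n, OF e _ this, of "f (par j)"] x K'(1)
      obtain U where U: "open U" "f (par j) \<in> U"
        "\<And>y. y \<in> U \<inter> K \<Longrightarrow> cmod (y - f (par j)) \<le> min ((1/16) ^ j) (sep f j / 8 * (1/2) ^ j) \<and>
          (\<forall>k. cmod (y ^ n k - f (par j) ^ n k) \<le> min ((1/16) ^ j) (sep f j / 8 * (1/2) ^ j))"
        by (metis (no_types, lifting) subsetD)
      \<comment> \<open>Condensation gives infinitely many candidates, so the finitely many values
        already used can be avoided.\<close>
      have "infinite (U \<inter> K' - f ` {..<j})" using K'(3)[OF x U(1,2)] by (simp add: Diff_infinite_finite)
      then obtain r where r: "r \<in> U \<inter> K' - f ` {..<j}" by (metis ex_in_conv finite.emptyI)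
      then have "r \<in> U \<inter> K" using K'(1) by auto
      from U(3)[OF this] r have "P f j r" by (auto simp: P_def)
      then show ?thesis by blast
    qed
  qed
  then obtain lam where lam: "\<And>j. P lam j (lam j)" by blast
  have neq: "lam i \<noteq> lam i'" if "i < i'" for i i' using lam[of i'] that unfolding P_def by fastforce
  have sep0: "sep lam j > 0" for j unfolding sep_def
    by (subst Min_gr_iff) (use fin neq in auto)
  have sep_le: "sep lam j \<le> cmod (lam i - lam i')" if "i < j" "i' < j" "i \<noteq> i'" for i i' j
  proof -
    have *: "sep lam j \<le> cmod (lam i - lam i')" if "i < i'" "i' < j" for i i'
      unfolding sep_def by (intro Min_le) (use fin that in auto)
    show ?thesis using *[of i i'] *[of i' i] that by (cases i i' rule: linorder_cases) (auto simp: norm_minus_commute)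
  qed
  have sep_mono: "sep lam j' \<le> sep lam j" if "j \<le> j'" for j j'
    unfolding sep_def using fin that by (intro Min_antimono) auto
  have close: "cmod (lam i - lam (i mod 2 ^ l)) \<le> sep lam (2 ^ l) / 8" for i l
  proof (rule branch_bound)
    show "norm (lam j - lam (par j)) \<le> sep lam (2 ^ l) / 8 * (1/2) ^ j" if j: "j \<ge> 2 ^ l" for j
    proof -
      have "j > 0" using j by (metis gr0I not_le zero_less_power zero_less_numeral)
      then have "cmod (lam j - lam (par j)) \<le> sep lam j / 8 * (1/2) ^ j" using lam[of j] by (simp add: P_def)
      also have "\<dots> \<le> sep lam (2 ^ l) / 8 * (1/2) ^ j" using sep_mono[OF j] by (intro mult_right_mono) auto
      finally show ?thesis .
    qed
  qed (use sep0[of "2 ^ l"] in auto)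
  have "cmod (lam i - lam i') \<ge> sep lam (2 ^ l) / 2" if "i mod 2 ^ l \<noteq> i' mod 2 ^ l" for i i' l
  proof -
    let ?a = "lam (i mod 2 ^ l)" and ?b = "lam (i' mod 2 ^ l)"
    have "sep lam (2 ^ l) \<le> cmod (?a - ?b)" using that by (intro sep_le) auto
    also have "?a - ?b = (lam i - lam i') - (lam i - ?a) + (lam i' - ?b)" by simp
    also have "cmod \<dots> \<le> cmod (lam i - lam i') + cmod (lam i - ?a) + cmod (lam i' - ?b)"
      by (intro order_trans[OF norm_triangle_ineq] add_right_mono norm_triangle_ineq4)
    finally show ?thesis using close[of i l] close[of i' l] sep0[of "2 ^ l"] by linarith
  qed
  then have "\<exists>\<sigma>. \<forall>l. \<sigma> l > 0 \<and> (\<forall>i i'. i mod 2 ^ l \<noteq> i' mod 2 ^ l \<longrightarrow> cmod (lam i - lam i') \<ge> \<sigma> l)"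
    using sep0 by (intro exI[of _ "\<lambda>l. sep lam (2 ^ l) / 2"]) simp
  moreover have "lam j \<in> K" for j using lam[of j] K'(1) by (auto simp: P_def)
  ultimately show ?thesis using lam unfolding P_def by (intro exI[of _ lam]) auto
qed

section \<open>The operator\<close>

locale eigen_tree = complex_onb J e for J :: "'b::{real_inner,banach} \<Rightarrow> 'b" and e +
  fixes lam :: "nat \<Rightarrow> complex" and n :: "nat \<Rightarrow> nat" and eps :: "nat \<Rightarrow> real" and \<sigma> :: "nat \<Rightarrow> real"
  assumes unimod: "cmod (lam j) = 1"
    and eps_lim: "eps \<longlonglongrightarrow> 0" and eps: "cmod (lam j ^ n k - 1) \<le> eps k"
    and close: "j > 0 \<Longrightarrow> cmod (lam j - lam (par j)) \<le> (1/16) ^ j"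
    and close_power: "j > 0 \<Longrightarrow> cmod (lam j ^ n k - lam (par j) ^ n k) \<le> (1/16) ^ j"
    and sep_pos: "\<sigma> l > 0"
    and sep: "i mod 2 ^ l \<noteq> i' mod 2 ^ l \<Longrightarrow> cmod (lam i - lam i') \<ge> \<sigma> l"
begin

text \<open>The weights \<open>(1/4) ^ j\<close> keep all \<open>u j\<close> within 1/2 of
  \<open>e 0\<close>, so that limits along branches cannot vanish, and yet are large compared with
  the eigenvalue gaps \<open>(1/16) ^ j\<close>, which makes the operator bounded.\<close>

function u :: "nat \<Rightarrow> 'b" where
  "u j = (if j = 0 then e 0 else u (par j) + (1/4) ^ j *\<^sub>R e j)"
  by auto
termination by (relation "{(x, y). x < y}") (auto simp: par_less wf_less)

declare u.simps[simp del]

lemma u_0: "u 0 = e 0" by (simp add: u.simps)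

lemma u_pos: "j > 0 \<Longrightarrow> u j = u (par j) + (1/4) ^ j *\<^sub>R e j" by (subst u.simps) simp

lemma power_decay: "j \<ge> 2 ^ l \<Longrightarrow> (1/4::real) ^ j \<le> (1/2) ^ 2 ^ l * (1/2) ^ j"
proof -
  assume "j \<ge> 2 ^ l"
  then have "(1/2::real) ^ j \<le> (1/2) ^ 2 ^ l" by (intro power_decreasing) auto
  moreover have "(1/4::real) ^ j = (1/2) ^ j * (1/2) ^ j" by (simp flip: power_mult_distrib)
  ultimately show ?thesis by simp
qed

lemma ge_power_pos: "j \<ge> 2 ^ l \<Longrightarrow> j > (0::nat)"
  by (metis gr0I not_le zero_less_power zero_less_numeral)

text \<open>The rate is exponential in \<open>2 ^ l\<close>, the number of nodes in level
  \<open>l\<close>, and not merely in \<open>l\<close>; this makes the Haar coefficients summable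
  over all nodes.\<close>

lemma u_branch: "norm (u i - u (i mod 2 ^ l)) \<le> (1/2) ^ 2 ^ l"
proof (rule branch_bound)
  fix j :: nat assume "j \<ge> 2 ^ l"
  then show "norm (u j - u (par j)) \<le> (1/2) ^ 2 ^ l * (1/2) ^ j"
    using power_decay[of l j] ge_power_pos[of l j] by (simp add: u_pos)
qed simp

lemma lam_branch: "cmod (lam i - lam (i mod 2 ^ l)) \<le> (1/2) ^ 2 ^ l"
proof (rule branch_bound)
  fix j :: nat assume j: "j \<ge> 2 ^ l"
  have "(1/16::real) ^ j \<le> (1/4) ^ j" by (intro power_mono) auto
  then show "norm (lam j - lam (par j)) \<le> (1/2) ^ 2 ^ l * (1/2) ^ j"
    using power_decay[OF j] close[OF ge_power_pos[OF j]] by linarith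
qed simp

lemma u_e0: "norm (u i - e 0) \<le> 1/2"
  using u_branch[of i 0] by (simp add: u_0)

lemma norm_u: "norm (u i) \<le> 2"
proof -
  have "norm (u i) \<le> norm (u i - e 0) + norm (e 0)" using norm_triangle_ineq[of "u i - e 0" "e 0"] by simp
  then show ?thesis using u_e0[of i] by simp
qed

text \<open>The off-diagonal part of \<open>T ^^ N\<close>: since \<open>e j = 4 ^ j (u j - u (par j))\<close> and both \<open>u j\<close> and \<open>u (par j)\<close>
  are eigenvectors, \<open>(T ^^ N) (e j)\<close> differs from \<open>lam j ^ N\<close> times \<open>e j\<close> by a multiple of \<open>u (par j)\<close>.\<close>

definition r :: "nat \<Rightarrow> nat \<Rightarrow> 'b" where
  "r N j = (if j = 0 then 0 else cscale J ((lam j ^ N - lam (par j) ^ N) * 4 ^ j) (u (par j)))"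

definition T :: "'b \<Rightarrow> 'b" where
  "T z = diag_op lam z + nuclear_op (r 1) z"

lemma norm_r: "norm (r N j) \<le> 2 * 4 ^ j * cmod (lam j ^ N - lam (par j) ^ N)"
proof -
  have "cmod (lam j ^ N - lam (par j) ^ N) * 4 ^ j * norm (u (par j)) \<le> cmod (lam j ^ N - lam (par j) ^ N) * 4 ^ j * 2"
    by (intro mult_left_mono norm_u) auto
  then show ?thesis by (simp add: r_def norm_cscale norm_mult norm_power mult_ac)
qed

text \<open>The factor \<open>4 ^ j\<close> against a gap of \<open>(1/16) ^ j\<close> leaves
  \<open>(1/4) ^ j\<close>. For \<open>n k\<close> the bound is uniform in \<open>k\<close>, as
  Tannery's theorem requires.\<close>

lemma norm_r_1: "norm (r 1 j) \<le> 2 * (1/4) ^ j" and norm_r_n: "norm (r (n k) j) \<le> 2 * (1/4) ^ j"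
proof -
  have b: "2 * 4 ^ j * x \<le> 2 * (1/4) ^ j" if "x \<le> (1/16) ^ j" for x :: real
  proof -
    have "2 * 4 ^ j * x \<le> 2 * 4 ^ j * (1/16) ^ j" using that by (intro mult_left_mono) auto
    also have "\<dots> = 2 * (4 * (1/16)) ^ j" by (simp only: power_mult_distrib mult.assoc)
    finally show ?thesis by simp
  qed
  show "norm (r 1 j) \<le> 2 * (1/4) ^ j"
    using order_trans[OF norm_r[of 1 j] b] close[of j] by (cases "j = 0") (auto simp: r_def)
  show "norm (r (n k) j) \<le> 2 * (1/4) ^ j"
    using order_trans[OF norm_r[of "n k" j] b] close_power[of j k] by (cases "j = 0") (auto simp: r_def)
qed

lemma summable_quarter: "summable (\<lambda>j. 2 * (1/4::real) ^ j)"
  by (intro summable_mult summable_geometric) simp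

lemma summable_r: "summable (\<lambda>j. norm (r 1 j))" "summable (\<lambda>j. norm (r (n k) j))"
  by (rule summable_comparison_test'[OF summable_quarter]; use norm_r_1 norm_r_n in simp)+

lemma T_clinear: "bounded_clinear_op J T"
proof -
  have "\<And>j. cmod (lam j) \<le> 1" by (simp add: unimod)
  then show ?thesis unfolding T_def[abs_def]
    by (intro bounded_clinear_add diag_op nuclear_op summable_r)
qed

lemma T_bounded_linear: "bounded_linear T" and T_J: "T (J x) = J (T x)"
  using T_clinear by (auto simp: bounded_clinear_op_def)

sublocale T: bounded_linear T by (rule T_bounded_linear)

lemma T_e: "T (e k) = cscale J (lam k) (e k) + r 1 k"
proof -
  have le: "\<And>j. cmod (lam j) \<le> 1" by (simp add: unimod)
  show ?thesis unfolding T_def diag_op(3)[OF le] nuclear_op(3)[OF summable_r(1)] ..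
qed

lemma T_u: "T (u j) = cscale J (lam j) (u j)"
proof (induction j rule: less_induct)
  case (less j)
  show ?case
  proof (cases "j = 0")
    case True
    then show ?thesis using T_e[of 0] by (simp add: u_0 r_def)
  next
    case False
    have s: "(1/4) ^ j *\<^sub>R cscale J (a * 4 ^ j) x = cscale J a x" for a x
      by (simp add: cscale_def scaleR_add_right power_one_over)
    have "T (u j) = T (u (par j)) + (1/4) ^ j *\<^sub>R T (e j)"
      using False by (simp add: u_pos T.add T.scaleR)
    also have "T (u (par j)) = cscale J (lam (par j)) (u (par j))"
      using less par_less False by simp
    also have "(1/4) ^ j *\<^sub>R T (e j) = cscale J (lam j) ((1/4) ^ j *\<^sub>R e j) + cscale J (lam j - lam (par j)) (u (par j))"
      unfolding T_e scaleR_add_right using False s[of "lam j - lam (par j)"] by (simp add: r_def cscale_scaleR)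
    finally show ?thesis using False by (simp add: u_pos cscale_right cscale_left)
  qed
qed

lemma T_cscale: "T (cscale J c x) = cscale J c (T x)"
  by (rule clinear_cscale[OF T_bounded_linear T_J])

lemma Tn_bounded_linear: "bounded_linear (T ^^ N)"
  by (rule funpow_bounded_linear[OF T_bounded_linear])

lemma Tn_J: "(T ^^ N) (J x) = J ((T ^^ N) x)"
  by (induction N) (simp_all add: T_J)

lemma Tn_u: "(T ^^ N) (u j) = cscale J (lam j ^ N) (u j)"
  by (induction N) (simp_all add: cscale_left T_cscale T_u cscale_cscale mult.commute)

lemma Tn_e: "(T ^^ N) (e j) = cscale J (lam j ^ N) (e j) + r N j"
proof (cases "j = 0")
  case True
  then show ?thesis using Tn_u[of N 0] by (simp add: u_0 r_def)
next
  case False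
  interpret Tn: bounded_linear "T ^^ N" by (rule Tn_bounded_linear)
  have ej: "e j = 4 ^ j *\<^sub>R (u j - u (par j))" using False by (simp add: u_pos power_one_over)
  have "(T ^^ N) (e j) = 4 ^ j *\<^sub>R (cscale J (lam j ^ N) (u j) - cscale J (lam (par j) ^ N) (u (par j)))"
    by (subst ej) (simp add: Tn.scaleR Tn.diff Tn_u)
  also have "cscale J (lam j ^ N) (u j) - cscale J (lam (par j) ^ N) (u (par j))
     = cscale J (lam j ^ N) (u j - u (par j)) + cscale J (lam j ^ N - lam (par j) ^ N) (u (par j))"
    by (simp add: cscale_right cscale_left)
  also have "4 ^ j *\<^sub>R \<dots> = cscale J (lam j ^ N) (e j) + 4 ^ j *\<^sub>R cscale J (lam j ^ N - lam (par j) ^ N) (u (par j))"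
    unfolding scaleR_add_right by (simp only: cscale_scaleR[symmetric] ej[symmetric])
  also have "4 ^ j *\<^sub>R cscale J (lam j ^ N - lam (par j) ^ N) (u (par j)) = r N j"
    using False by (simp add: r_def cscale_def scaleR_add_right mult.commute)
  finally show ?thesis .
qed

text \<open>Each summand is bounded by a multiple of \<open>eps k\<close>, though with a factor
  \<open>4 ^ j\<close>; the domination uniform in \<open>k\<close> allows interchanging limit and
  sum.\<close>

lemma r_norm_sum_lim: "(\<lambda>k. \<Sum>j. norm (r (n k) j)) \<longlonglongrightarrow> 0"
proof -
  have "((\<lambda>k. \<Sum>j. norm (r (n k) j)) \<longlongrightarrow> (\<Sum>j. 0)) sequentially"
  proof (rule tannerys_theorem[THEN conjunct2, THEN conjunct2])
    show "(\<lambda>k. norm (r (n k) j)) \<longlonglongrightarrow> 0" for j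
    proof (rule Lim_null_comparison)
      show "\<forall>\<^sub>F k in sequentially. norm (norm (r (n k) j)) \<le> 2 * 4 ^ j * (2 * eps k)"
      proof (rule always_eventually, rule allI)
        fix k
        have "cmod (lam j ^ n k - lam (par j) ^ n k) \<le> cmod (lam j ^ n k - 1) + cmod (lam (par j) ^ n k - 1)"
          using norm_triangle_ineq4[of "lam j ^ n k - 1" "lam (par j) ^ n k - 1"] by simp
        also have "\<dots> \<le> 2 * eps k" using eps[of j k] eps[of "par j" k] by simp
        finally have "2 * 4 ^ j * cmod (lam j ^ n k - lam (par j) ^ n k) \<le> 2 * 4 ^ j * (2 * eps k)"
          by (intro mult_left_mono) auto
        from order_trans[OF norm_r this]
        show "norm (norm (r (n k) j)) \<le> 2 * 4 ^ j * (2 * eps k)" by (simp only: real_norm_def abs_norm_cancel)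
      qed
      show "(\<lambda>k. 2 * 4 ^ j * (2 * eps k)) \<longlonglongrightarrow> 0"
        using tendsto_mult_left[OF tendsto_mult_left[OF eps_lim, of 2], of "2 * 4 ^ j"] by simp
    qed
    show "\<forall>\<^sub>F (j, k) in at_top \<times>\<^sub>F sequentially. norm (norm (r (n k) j)) \<le> 2 * (1/4) ^ j"
      using norm_r_n by (intro always_eventually) auto
    show "summable (\<lambda>j. 2 * (1/4::real) ^ j)" by (rule summable_quarter)
  qed simp
  then show ?thesis by simp
qed

lemma T_rigid: "(\<lambda>k. onorm (\<lambda>x. (T ^^ n k) x - x)) \<longlonglongrightarrow> 0"
proof (rule Lim_null_comparison)
  have bl: "bounded_linear (\<lambda>x. (T ^^ n k) x - x)" for k
    by (intro bounded_linear_sub Tn_bounded_linear bounded_linear_ident)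
  show "\<forall>\<^sub>F k in sequentially. norm (onorm (\<lambda>x. (T ^^ n k) x - x)) \<le> eps k + (\<Sum>j. norm (r (n k) j))"
  proof (rule always_eventually, rule allI)
    fix k
    have "onorm (\<lambda>x. (T ^^ n k) x - x) \<le> eps k + (\<Sum>j. norm (r (n k) j))"
    proof (rule onorm_diag_nuclear_le)
      show "bounded_clinear_op J (\<lambda>x. (T ^^ n k) x - x)"
        using bl by (simp add: bounded_clinear_op_def Tn_J J.diff)
      show "(T ^^ n k) (e j) - e j = cscale J (lam j ^ n k - 1) (e j) + r (n k) j" for j
        by (simp add: Tn_e cscale_left)
    qed (rule eps summable_r)+
    then show "norm (onorm (\<lambda>x. (T ^^ n k) x - x)) \<le> eps k + (\<Sum>j. norm (r (n k) j))"
      using onorm_pos_le[OF bl] by simp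
  qed
  show "(\<lambda>k. eps k + (\<Sum>j. norm (r (n k) j))) \<longlonglongrightarrow> 0"
    using tendsto_add[OF eps_lim r_norm_sum_lim] by simp
qed

text \<open>The branches of the tree are the subsets of \<open>\<nat>\<close>, given by their indicator as binary digits.\<close>

definition idx :: "nat set \<Rightarrow> nat \<Rightarrow> nat" where
  "idx A L = (\<Sum>l<L. if l \<in> A then 2 ^ l else 0)"

lemma idx_Suc: "idx A (Suc L) = idx A L + (if L \<in> A then 2 ^ L else 0)"
  by (simp add: idx_def)

lemma idx_less: "idx A L < 2 ^ L"
  by (induction L) (auto simp: idx_Suc idx_def)

lemma idx_mod: "L \<le> M \<Longrightarrow> idx A M mod 2 ^ L = idx A L"
proof (induction M rule: dec_induct)
  case base
  then show ?case by (simp add: idx_less)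
next
  case (step M)
  have "(2::nat) ^ L dvd (if M \<in> A then 2 ^ M else 0)" using step by (auto simp: le_imp_power_dvd)
  then show ?case using step by (metis idx_Suc mod_add_right_eq add_0_right dvd_imp_mod_0)
qed

lemma idx_neq:
  assumes "A \<noteq> B" shows "\<exists>l. idx A l \<noteq> idx B l"
proof (rule ccontr)
  assume "\<not> ?thesis"
  then have eq: "\<And>l. idx A l = idx B l" by simp
  have "l \<in> A \<longleftrightarrow> l \<in> B" for l
    using idx_Suc[of A l] idx_Suc[of B l] eq[of l] eq[of "Suc l"] by (auto split: if_splits)
  then show False using assms by auto
qed

lemma branch_convergent:
  fixes f :: "nat \<Rightarrow> 'x::banach"
  assumes "\<And>i l. norm (f i - f (i mod 2 ^ l)) \<le> (1/2) ^ 2 ^ l"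
  shows "convergent (\<lambda>L. f (idx A L))"
proof -
  have "Cauchy (\<lambda>L. f (idx A L))"
  proof (rule metric_CauchyI)
    fix \<epsilon> :: real assume "\<epsilon> > 0"
    then obtain l where l: "(1/2::real) ^ l < \<epsilon> / 2" using real_arch_pow_inv[of "\<epsilon>/2" "1/2"] by auto
    have p: "(1/2::real) ^ 2 ^ l \<le> (1/2) ^ l" by (intro power_decreasing) (auto simp: less_imp_le)
    have d: "dist (f (idx A L)) (f (idx A l)) < \<epsilon> / 2" if "L \<ge> l" for L
    proof -
      have "dist (f (idx A L)) (f (idx A l)) \<le> (1/2) ^ 2 ^ l"
        using assms[of "idx A L" l] idx_mod[OF that, of A] by (simp add: dist_norm)
      then show ?thesis using l p by linarith
    qed
    have "dist (f (idx A L)) (f (idx A M)) < \<epsilon>" if "L \<ge> l" "M \<ge> l" for L M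
      using d[OF that(1)] d[OF that(2)] by (rule dist_triangle_half_l)
    then show "\<exists>l. \<forall>L\<ge>l. \<forall>M\<ge>l. dist (f (idx A L)) (f (idx A M)) < \<epsilon>" by blast
  qed
  then show ?thesis by (simp add: Cauchy_convergent_iff)
qed

definition branch_u where "branch_u A = lim (\<lambda>L. u (idx A L))"
definition branch_lam where "branch_lam A = lim (\<lambda>L. lam (idx A L))"

lemma branch_u: "(\<lambda>L. u (idx A L)) \<longlonglongrightarrow> branch_u A"
  unfolding branch_u_def convergent_LIMSEQ_iff[symmetric] by (rule branch_convergent[OF u_branch])

lemma branch_lam: "(\<lambda>L. lam (idx A L)) \<longlonglongrightarrow> branch_lam A"
  unfolding branch_lam_def convergent_LIMSEQ_iff[symmetric] by (rule branch_convergent[OF lam_branch])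

lemma branch_eigen: "branch_lam A \<in> point_spectrum J T \<inter> unit_circle"
proof -
  have "cmod (branch_lam A) = 1"
    using LIMSEQ_unique[OF tendsto_norm[OF branch_lam[of A]]] by (simp add: unimod tendsto_const)
  moreover have "branch_u A \<noteq> 0"
  proof
    assume "branch_u A = 0"
    then have "(\<lambda>L. norm (u (idx A L) - e 0)) \<longlonglongrightarrow> norm (0 - e 0)"
      using tendsto_norm[OF tendsto_diff[OF branch_u[of A] tendsto_const[of "e 0"]]] by simp
    then have "norm (0 - e 0) \<le> 1/2" by (rule LIMSEQ_le_const2) (use u_e0 in auto)
    then show False by simp
  qed
  moreover have "T (branch_u A) = cscale J (branch_lam A) (branch_u A)"
  proof (rule LIMSEQ_unique)
    show "(\<lambda>L. T (u (idx A L))) \<longlonglongrightarrow> T (branch_u A)" by (rule T.tendsto[OF branch_u])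
    show "(\<lambda>L. T (u (idx A L))) \<longlonglongrightarrow> cscale J (branch_lam A) (branch_u A)"
      unfolding T_u cscale_def
      by (intro tendsto_intros branch_u branch_lam bounded_linear.tendsto[OF bounded_linear_J])
  qed
  ultimately show ?thesis by (auto simp: point_spectrum_def unit_circle_def)
qed

text \<open>Two different branches pass through different nodes of some level \<open>l\<close>, and
  below these the eigenvalues keep the distance \<open>\<sigma> l\<close>, which survives the
  limit.\<close>

lemma inj_branch_lam: "inj branch_lam"
proof (rule injI, rule ccontr)
  fix A B assume eq: "branch_lam A = branch_lam B" and ne: "A \<noteq> B"
  obtain l where l: "idx A l \<noteq> idx B l" using idx_neq[OF ne] by blast
  have "(\<lambda>L. cmod (lam (idx A L) - lam (idx B L))) \<longlonglongrightarrow> cmod (branch_lam A - branch_lam B)"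
    by (intro tendsto_norm tendsto_diff branch_lam)
  moreover have "\<sigma> l \<le> cmod (lam (idx A L) - lam (idx B L))" if "L \<ge> l" for L
    using sep idx_mod[OF that, of A] idx_mod[OF that, of B] l by simp
  ultimately have "\<sigma> l \<le> cmod (branch_lam A - branch_lam B)"
    by (intro LIMSEQ_le_const[of "\<lambda>L. cmod (lam (idx A L) - lam (idx B L))"]) blast+
  then show False using sep_pos[of l] eq by simp
qed

lemma uncountable_spectrum: "uncountable (point_spectrum J T \<inter> unit_circle)"
proof
  assume "countable (point_spectrum J T \<inter> unit_circle)"
  then have "countable (range branch_lam)" using branch_eigen by (meson countable_subset image_subsetI)
  then have "countable (UNIV :: nat set set)" using inj_branch_lam countable_image_inj_on by blast
  then have "range (from_nat_into (UNIV :: nat set set)) = UNIV" by (intro range_from_nat_into) auto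
  moreover have "\<not> (\<exists>f :: nat \<Rightarrow> nat set. f ` UNIV = Pow UNIV)" using Cantors_theorem[of "UNIV :: nat set"] by blast
  ultimately show False by (metis Pow_UNIV)
qed

end

section \<open>The invariant Gaussian measure\<close>

context eigen_tree
begin

text \<open>\<open>w L i\<close> is the mean of the limit eigenvectors over all branches through node \<open>i\<close> of level \<open>L\<close>,
  and the vectors \<open>v j\<close> below are the Haar coefficients of the field of limit eigenvectors.\<close>

definition avg :: "nat \<Rightarrow> nat \<Rightarrow> nat \<Rightarrow> 'b" where
  "avg L M i = (1 / 2 ^ M) *\<^sub>R (\<Sum>q<2 ^ M. u (i + 2 ^ L * q))"

definition w :: "nat \<Rightarrow> nat \<Rightarrow> 'b" where
  "w L i = lim (\<lambda>M. avg L M i)"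

text \<open>For \<open>i\<close> in level \<open>L\<close>, the parity of \<open>q\<close> is the
  binary digit in position \<open>L\<close>, which decides between the two successors of
  \<open>i\<close>.\<close>

lemma avg_Suc: "avg L (Suc M) i = (1/2) *\<^sub>R (avg (Suc L) M i + avg (Suc L) M (i + 2 ^ L))"
proof -
  have "(\<Sum>q<2 ^ Suc M. u (i + 2 ^ L * q)) = (\<Sum>q<2 ^ M. u (i + 2 ^ L * (2 * q))) + (\<Sum>q<2 ^ M. u (i + 2 ^ L * (2 * q + 1)))"
  proof -
    have "(\<Sum>q<2 * m. f q) = (\<Sum>q<m. f (2 * q)) + (\<Sum>q<m. f (2 * q + 1))" for f :: "nat \<Rightarrow> 'b" and m
      by (induction m) (simp_all add: algebra_simps)
    from this[of "\<lambda>q. u (i + 2 ^ L * q)" "2 ^ M"] show ?thesis by simp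
  qed
  then show ?thesis
    by (simp add: avg_def algebra_simps)
qed

lemma avg_u: assumes "i < 2 ^ L" shows "norm (avg L M i - u i) \<le> (1/2) ^ 2 ^ L"
proof -
  have "avg L M i - u i = (1 / 2 ^ M) *\<^sub>R (\<Sum>q<2 ^ M. u (i + 2 ^ L * q) - u i)"
    by (simp add: avg_def sum_subtractf scaleR_diff_right sum_constant_scaleR)
  also have "norm \<dots> \<le> (1 / 2 ^ M) * (\<Sum>q<(2::nat) ^ M. (1/2) ^ 2 ^ L)"
    unfolding norm_scaleR
  proof (intro mult_mono sum_norm_le)
    fix q
    show "norm (u (i + 2 ^ L * q) - u i) \<le> (1/2) ^ 2 ^ L" using u_branch[of "i + 2 ^ L * q" L] assms by simp
  qed (auto simp: sum_nonneg)
  also have "\<dots> = (1/2) ^ 2 ^ L" by simp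
  finally show ?thesis .
qed

text \<open>Here the sum is split by the leading digit: \<open>i + 2 ^ L * (q + 2 ^ M)\<close> is a
  successor of the node \<open>i + 2 ^ L * q\<close> of level \<open>L + M\<close>, hence
  \<open>u\<close> takes nearby values at the two.\<close>

lemma avg_step: assumes "i < 2 ^ L" shows "norm (avg L (Suc M) i - avg L M i) \<le> (1/2) ^ M"
proof -
  have "(\<Sum>q<2 ^ Suc M. u (i + 2 ^ L * q)) = (\<Sum>q<2 ^ M. u (i + 2 ^ L * q)) + (\<Sum>q<2 ^ M. u (i + 2 ^ L * (q + 2 ^ M)))"
  proof -
    have "(\<Sum>q<m + k. f q) = (\<Sum>q<m. f q) + (\<Sum>q<k. f (q + m))" for f :: "nat \<Rightarrow> 'b" and m k
      by (induction k) (simp_all add: algebra_simps)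
    from this[of "\<lambda>q. u (i + 2 ^ L * q)" "2 ^ M" "2 ^ M"] show ?thesis by (simp add: mult_2)
  qed
  then have "avg L (Suc M) i - avg L M i
      = (1 / 2 ^ Suc M) *\<^sub>R (\<Sum>q<2 ^ M. u (i + 2 ^ L * (q + 2 ^ M)) - u (i + 2 ^ L * q))"
    unfolding avg_def sum_subtractf by (simp add: algebra_simps flip: scaleR_add_left)
  also have "norm \<dots> \<le> (1 / 2 ^ Suc M) * (\<Sum>q<(2::nat) ^ M. (1/2) ^ M)"
    unfolding norm_scaleR
  proof (intro mult_mono sum_norm_le)
    fix q :: nat assume q: "q \<in> {..<2 ^ M}"
    have "i + 2 ^ L * q < 2 ^ (L + M)"
    proof -
      have "i + 2 ^ L * q < 2 ^ L * (q + 1)" using assms by simp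
      also have "\<dots> \<le> 2 ^ L * 2 ^ M" using q by (intro mult_left_mono) auto
      finally show ?thesis by (simp add: power_add)
    qed
    then have "(i + 2 ^ L * (q + 2 ^ M)) mod 2 ^ (L + M) = i + 2 ^ L * q"
      by (simp add: distrib_left power_add add.assoc[symmetric])
    then have "norm (u (i + 2 ^ L * (q + 2 ^ M)) - u (i + 2 ^ L * q)) \<le> (1/2) ^ 2 ^ (L + M)"
      using u_branch[of "i + 2 ^ L * (q + 2 ^ M)" "L + M"] by simp
    also have "\<dots> \<le> (1/2) ^ M"
    proof (rule power_decreasing)
      have "M < 2 ^ M" by simp
      also have "\<dots> \<le> 2 ^ (L + M)" by (intro power_increasing) auto
      finally show "M \<le> 2 ^ (L + M)" by simp
    qed auto
    finally show "norm (u (i + 2 ^ L * (q + 2 ^ M)) - u (i + 2 ^ L * q)) \<le> (1/2) ^ M" .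
  qed (auto simp: sum_nonneg)
  also have "\<dots> \<le> (1/2) ^ M" by simp
  finally show ?thesis .
qed

lemma avg_lim: assumes "i < 2 ^ L" shows "(\<lambda>M. avg L M i) \<longlonglongrightarrow> w L i"
proof -
  have "summable (\<lambda>M. avg L (Suc M) i - avg L M i)"
    by (rule summable_comparison_test'[OF summable_geometric[of "1/2"]]) (use avg_step[OF assms] in auto)
  then have "convergent (\<lambda>N. \<Sum>M<N. avg L (Suc M) i - avg L M i)" by (simp add: summable_iff_convergent)
  moreover have "(\<Sum>M<N. avg L (Suc M) i - avg L M i) = avg L N i - avg L 0 i" for N
    by (rule sum_lessThan_telescope)
  ultimately have "convergent (\<lambda>N. avg L N i - avg L 0 i)" by simp
  then have "convergent (\<lambda>N. (avg L N i - avg L 0 i) + avg L 0 i)"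
    by (rule convergent_add) (rule convergent_const)
  then show ?thesis unfolding w_def by (simp add: convergent_LIMSEQ_iff)
qed

lemma w_half: assumes "i < 2 ^ L" shows "w L i = (1/2) *\<^sub>R (w (Suc L) i + w (Suc L) (i + 2 ^ L))"
proof (rule LIMSEQ_unique)
  show "(\<lambda>M. avg L (Suc M) i) \<longlonglongrightarrow> w L i" by (rule LIMSEQ_Suc[OF avg_lim[OF assms]])
  show "(\<lambda>M. avg L (Suc M) i) \<longlonglongrightarrow> (1/2) *\<^sub>R (w (Suc L) i + w (Suc L) (i + 2 ^ L))"
    unfolding avg_Suc using assms by (intro tendsto_intros avg_lim) auto
qed

lemma w_u: assumes "i < 2 ^ L" shows "norm (w L i - u i) \<le> (1/2) ^ 2 ^ L"
  by (rule LIMSEQ_le_const2[OF tendsto_norm[OF tendsto_diff[OF avg_lim[OF assms] tendsto_const]]])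
    (use avg_u[OF assms] in auto)

definition v :: "nat \<Rightarrow> 'b" where
  "v j = (if j = 0 then w 0 0 else
     (1 / (2 * sqrt (2 ^ floor_log j))) *\<^sub>R (w (Suc (floor_log j)) (par j) - w (Suc (floor_log j)) j))"

lemma v_add_power: "i < 2 ^ L \<Longrightarrow> v (2 ^ L + i) = (1 / (2 * sqrt (2 ^ L))) *\<^sub>R (w (Suc L) i - w (Suc L) (2 ^ L + i))"
  by (simp add: v_def par_add_power)

text \<open>Each of the two means is compared with the vector at its node, and the two nodes are
  parent and child. As \<open>j < 2 ^ Suc (floor_log j)\<close>, an error doubly exponential in the
  level decays geometrically in \<open>j\<close> itself.\<close>

lemma norm_v: "j > 0 \<Longrightarrow> norm (v j) \<le> 3 * (1/2) ^ j"
proof -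
  assume j: "j > 0"
  let ?L = "floor_log j"
  have jl: "j < 2 ^ Suc ?L" using floor_log_exp2_gt[of j] by simp
  then have pl: "par j < 2 ^ Suc ?L" using par_less[OF j] by simp
  have d: "(1/2::real) ^ 2 ^ Suc ?L \<le> (1/2) ^ j" using jl by (intro power_decreasing) auto
  have "norm (w (Suc ?L) (par j) - w (Suc ?L) j)
      = norm ((w (Suc ?L) (par j) - u (par j)) - (w (Suc ?L) j - u j) - (u j - u (par j)))" by (simp add: algebra_simps)
  also have "\<dots> \<le> norm (w (Suc ?L) (par j) - u (par j)) + norm (w (Suc ?L) j - u j) + norm (u j - u (par j))"
    by (intro order_trans[OF norm_triangle_ineq4] add_right_mono norm_triangle_ineq4)
  also have "\<dots> \<le> (1/2) ^ j + (1/2) ^ j + (1/2) ^ j"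
  proof (intro add_mono order_trans[OF w_u d] pl jl)
    show "norm (u j - u (par j)) \<le> (1/2) ^ j" using j by (simp add: u_pos power_mono)
  qed
  finally have a: "norm (w (Suc ?L) (par j) - w (Suc ?L) j) \<le> 3 * (1/2) ^ j" by simp
  have "1 / (2 * sqrt (2 ^ ?L)) \<le> 1"
  proof -
    have "1 \<le> sqrt (2 ^ ?L)" by simp
    then have "1 \<le> 2 * sqrt (2 ^ ?L)" by linarith
    then show ?thesis by simp
  qed
  then have "1 / (2 * sqrt (2 ^ ?L)) * norm (w (Suc ?L) (par j) - w (Suc ?L) j) \<le> 1 * (3 * (1/2) ^ j)"
    using a by (intro mult_mono) auto
  then show ?thesis using j by (simp add: v_def)
qed

text \<open>In the Gaussian series \<open>v j\<close> and \<open>J (v j)\<close> receive independent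
  real coefficients, that is, \<open>v j\<close> receives a complex one. The covariance is thereby
  invariant under unimodular scalars.\<close>

definition f :: "nat \<Rightarrow> 'b" where
  "f k = (if even k then v (k div 2) else J (v (k div 2)))"

lemma f_even: "f (2 * j) = v j" and f_odd: "f (Suc (2 * j)) = J (v j)"
  by (simp_all add: f_def)

lemma summable_f: "summable (\<lambda>k. norm (f k))"
proof -
  have sv: "summable (\<lambda>j. norm (v j))"
  proof (rule summable_comparison_test_ev)
    show "\<forall>\<^sub>F j in sequentially. norm (norm (v j)) \<le> 3 * (1/2) ^ j"
      by (rule eventually_sequentiallyI[of 1]) (simp add: norm_v)
  qed (intro summable_mult summable_geometric, simp)
  have "(\<Sum>k<N. norm (f k)) \<le> 2 * (\<Sum>j. norm (v j))" for N
  proof -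
    have "(\<Sum>k<N. norm (f k)) \<le> (\<Sum>k<2 * N. norm (f k))" by (intro sum_mono2) auto
    also have "\<dots> = 2 * (\<Sum>j<N. norm (v j))"
      by (induction N) (simp_all add: f_even f_odd)
    also have "\<dots> \<le> 2 * (\<Sum>j. norm (v j))" by (intro mult_left_mono sum_le_suminf sv) auto
    finally show ?thesis .
  qed
  then show ?thesis by (intro summableI_nonneg_bounded) auto
qed

text \<open>Inverse Haar transform: the means at the two successors are the mean at the node plus
  and minus a multiple of its Haar coefficient.\<close>

lemma w_in_span: "i < 2 ^ L \<Longrightarrow> w L i \<in> span (range f)"
proof (induction L arbitrary: i)
  case 0
  have "w 0 0 = f (2 * 0)" unfolding f_even by (simp add: v_def)
  then show ?case using 0 by (auto intro: span_base)
next
  case (Suc L)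
  have main: "w (Suc L) i \<in> span (range f) \<and> w (Suc L) (2 ^ L + i) \<in> span (range f)" if i: "i < 2 ^ L" for i
  proof -
    define s where "s = sqrt (2 ^ L)"
    have s: "s > 0" by (simp add: s_def)
    have "v (2 ^ L + i) \<in> span (range f)" by (metis f_even rangeI span_base)
    then have "s *\<^sub>R v (2 ^ L + i) \<in> span (range f)" by (rule span_scale)
    moreover have sv: "s *\<^sub>R v (2 ^ L + i) = (1/2) *\<^sub>R (w (Suc L) i - w (Suc L) (2 ^ L + i))"
      unfolding v_add_power[OF i] s_def[symmetric] using s by simp
    moreover have wl: "w L i = (1/2) *\<^sub>R (w (Suc L) i + w (Suc L) (2 ^ L + i))"
      using w_half[OF i] by (simp add: add.commute)
    moreover have "w (Suc L) i = w L i + s *\<^sub>R v (2 ^ L + i)"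
      unfolding sv wl by (simp add: algebra_simps flip: scaleR_add_left)
    moreover have "w (Suc L) (2 ^ L + i) = w L i - s *\<^sub>R v (2 ^ L + i)"
      unfolding sv wl by (simp add: algebra_simps flip: scaleR_add_left)
    ultimately show ?thesis using Suc.IH[OF i] span_add span_diff by metis
  qed
  show ?case
  proof (cases "i < 2 ^ L")
    case True
    then show ?thesis using main by blast
  next
    case False
    then show ?thesis using main[of "i - 2 ^ L"] Suc.prems by simp
  qed
qed

lemma u_in_closure: "u i \<in> closure (span (range f))"
proof -
  have lim: "(\<lambda>L. w L i) \<longlonglongrightarrow> u i"
  proof (rule LIM_zero_cancel, rule Lim_null_comparison)
    show "\<forall>\<^sub>F L in sequentially. norm (w L i - u i) \<le> (1/2) ^ L"
    proof (rule eventually_sequentiallyI[of i])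
      fix L assume "i \<le> L"
      also have "L < 2 ^ L" by simp
      finally have "norm (w L i - u i) \<le> (1/2) ^ 2 ^ L" by (rule w_u)
      also have "\<dots> \<le> (1/2) ^ L" by (intro power_decreasing) (auto simp: less_imp_le)
      finally show "norm (w L i - u i) \<le> (1/2) ^ L" .
    qed
    show "(\<lambda>L. (1/2::real) ^ L) \<longlonglongrightarrow> 0" by (rule LIMSEQ_realpow_zero) auto
  qed
  have "\<forall>\<^sub>F L in sequentially. w L i \<in> closure (span (range f))"
  proof (rule eventually_sequentiallyI[of i])
    fix L assume "i \<le> L"
    also have "L < 2 ^ L" by simp
    finally show "w L i \<in> closure (span (range f))"
      by (rule subsetD[OF closure_subset w_in_span])
  qed
  then show ?thesis using Lim_in_closed_set[OF closed_closure _ _ lim] by simp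
qed

text \<open>The closed span contains every \<open>u i\<close>, hence every \<open>e j\<close> as a
  multiple of a difference, and it is invariant under \<open>J\<close> because \<open>f\<close>
  lists each \<open>v j\<close> along with \<open>J (v j)\<close>.\<close>

lemma dense_f: "closure (span (range f)) = UNIV"
proof -
  let ?C = "closure (span (range f))"
  have sub: "subspace ?C" 
  proof (rule subspaceI)
    show "0 \<in> ?C" by (rule subsetD[OF closure_subset span_zero])
    fix x assume "x \<in> ?C"
    then obtain a where a: "\<And>i. a i \<in> span (range f)" "a \<longlonglongrightarrow> x" unfolding closure_sequential by auto
    have "c *\<^sub>R a i \<in> span (range f)" for c i by (rule span_scale[OF a(1)])
    moreover have "(\<lambda>i. c *\<^sub>R a i) \<longlonglongrightarrow> c *\<^sub>R x" for c by (rule tendsto_scaleR[OF tendsto_const a(2)])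
    ultimately show "c *\<^sub>R x \<in> ?C" for c
      unfolding closure_sequential by (intro exI[of _ "\<lambda>i. c *\<^sub>R a i"]) auto
    fix y assume "y \<in> ?C"
    then obtain b where b: "\<And>i. b i \<in> span (range f)" "b \<longlonglongrightarrow> y" unfolding closure_sequential by auto
    have "a i + b i \<in> span (range f)" for i by (rule span_add[OF a(1) b(1)])
    moreover have "(\<lambda>i. a i + b i) \<longlonglongrightarrow> x + y" by (rule tendsto_add[OF a(2) b(2)])
    ultimately show "x + y \<in> ?C"
      unfolding closure_sequential by (intro exI[of _ "\<lambda>i. a i + b i"]) auto
  qed
  have fJ: "J (f k) \<in> span (range f)" for k
  proof (cases "even k")
    case True
    then have "J (f k) = f (Suc k)" by (simp add: f_def)
    then show ?thesis by (simp add: span_base)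
  next
    case False
    then have "J (f k) = - f (k - 1)" by (auto simp: f_def elim!: oddE)
    then show ?thesis by (simp add: span_base span_neg)
  qed
  have "J x \<in> span (range f)" if "x \<in> span (range f)" for x
    using that by (induction rule: span_induct_alt) (auto simp: J.zero J.add J.scale intro!: span_add span_scale span_zero fJ)
  then have Jsub: "J ` span (range f) \<subseteq> ?C" by (intro image_subsetI subsetD[OF closure_subset])
  then have JC: "J x \<in> ?C" if "x \<in> ?C" for x
    using image_closure_subset[OF linear_continuous_on[OF bounded_linear_J] closed_closure Jsub] that by blast
  have eC: "e j \<in> ?C" for j
  proof (cases "j = 0")
    case True
    then show ?thesis using u_in_closure[of 0] by (simp add: u_0)
  next
    case False
    then have "e j = 4 ^ j *\<^sub>R (u j - u (par j))" by (simp add: u_pos power_one_over)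
    then show ?thesis using sub u_in_closure by (simp add: subspace_diff subspace_scale)
  qed
  have "z \<in> ?C" for z
  proof (rule Lim_in_closed_set[OF closed_closure _ _ expansion[of z, unfolded sums_def]])
    show "\<forall>\<^sub>F N in sequentially. (\<Sum>j<N. cscale J (coord j z) (e j)) \<in> ?C"
      unfolding cscale_def using sub eC JC
      by (intro always_eventually allI subspace_sum subspace_add subspace_scale) auto
  qed simp
  then show ?thesis by auto
qed

end

text \<open>From \<open>\<bar>a n\<bar> \<le> (a n)\<^sup>2 / \<epsilon> + \<epsilon>\<close>.
  Squares are what expanding a trigonometric sum controls.\<close>

lemma cesaro_null_of_square:
  assumes "cesaro_null (\<lambda>n. (a n)\<^sup>2)" shows "cesaro_null a"
proof (rule cesaro_null_approx)
  fix \<epsilon> :: real assume \<epsilon>: "\<epsilon> > 0"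
  have "\<bar>a n\<bar> \<le> \<bar>(1/\<epsilon>) * (a n)\<^sup>2\<bar> + \<epsilon>" for n
  proof (cases "\<bar>a n\<bar> \<le> \<epsilon>")
    case False
    then have "\<epsilon> * \<bar>a n\<bar> \<le> \<bar>a n\<bar> * \<bar>a n\<bar>" by (intro mult_right_mono) auto
    then have "\<bar>a n\<bar> \<le> (1/\<epsilon>) * (a n)\<^sup>2" using \<epsilon> by (simp add: field_simps power2_eq_square)
    then show ?thesis using \<epsilon> by linarith
  qed (simp add: add_increasing)
  then show "\<exists>b. cesaro_null b \<and> (\<forall>n. \<bar>a n\<bar> \<le> \<bar>b n\<bar> + \<epsilon>)"
    by (intro exI[of _ "\<lambda>n. (1/\<epsilon>) * (a n)\<^sup>2"] conjI cesaro_null_cmult assms allI)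
qed

lemma exp_minus_lipschitz:
  fixes x y :: real
  assumes "x \<ge> 0" "y \<ge> 0" shows "\<bar>exp (- x) - exp (- y)\<bar> \<le> \<bar>x - y\<bar>"
proof -
  have *: "exp (- x) - exp (- y) \<le> y - x" if "0 \<le> x" "x \<le> y" for x y :: real
  proof -
    have "exp (- x) - exp (- y) = exp (- x) * (1 - exp (- (y - x)))"
      by (simp add: right_diff_distrib flip: exp_add)
    also have "\<dots> \<le> 1 * (y - x)"
    proof (rule mult_mono)
      show "1 - exp (- (y - x)) \<le> y - x" using exp_ge_add_one_self[of "- (y - x)"] by linarith
    qed (use that in auto)
    finally show ?thesis by simp
  qed
  show ?thesis
  proof (cases "x \<le> y")
    case True
    then show ?thesis using *[of x y] assms by simp
  next
    case False
    then show ?thesis using *[of y x] assms by simp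
  qed
qed

lemma card_residue_class_le:
  fixes l L a :: nat
  assumes "l \<le> L" shows "card {i \<in> {..<2 ^ L}. i mod 2 ^ l = a} \<le> 2 ^ (L - l)"
proof -
  have "{i \<in> {..<2 ^ L}. i mod 2 ^ l = a} \<subseteq> (\<lambda>q. a + 2 ^ l * q) ` {..<2 ^ (L - l)}"
  proof
    fix i assume i: "i \<in> {i \<in> {..<(2::nat) ^ L}. i mod 2 ^ l = a}"
    then have "i div 2 ^ l < 2 ^ (L - l)"
      using assms by (intro less_mult_imp_div_less) (simp flip: power_add)
    moreover have "i = a + 2 ^ l * (i div 2 ^ l)" using i by auto
    ultimately show "i \<in> (\<lambda>q. a + 2 ^ l * q) ` {..<2 ^ (L - l)}" by blast
  qed
  then have "card {i \<in> {..<2 ^ L}. i mod 2 ^ l = a} \<le> card ((\<lambda>q. a + 2 ^ l * q) ` {..<(2::nat) ^ (L - l)})"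
    by (intro card_mono) auto
  also have "\<dots> \<le> card {..<(2::nat) ^ (L - l)}" by (rule card_image_le) simp
  finally show ?thesis by simp
qed

section \<open>Averages over branches and the covariance form\<close>

context eigen_tree
begin

text \<open>Wiener's lemma at a finite level: expanding the square gives geometric sums of
  \<open>lam i * cnj (lam i')\<close>. Pairs with different ancestors in level \<open>l\<close>
  contribute at most \<open>2 / \<sigma> l\<close> each, and pairs with a common ancestor are a
  fraction \<open>(1/2) ^ l\<close> of all. The bound does not involve \<open>L\<close>.\<close>

lemma mean_square_bound:
  assumes F: "\<And>i. cmod (F i) \<le> B" and l: "l \<le> L" and N: "N > 0"
  shows "(\<Sum>k=1..N. ((1 / 2 ^ L) * (\<Sum>i<2 ^ L. Re (lam i ^ k * F i)))\<^sup>2) / real N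
     \<le> B\<^sup>2 * ((1/2) ^ l + 2 / \<sigma> l / real N)"
proof -
  have B: "B \<ge> 0" using F[of 0] norm_ge_zero order_trans by blast
  define S where "S k = (\<Sum>i<(2::nat) ^ L. lam i ^ k * F i)" for k
  define G where "G i i' = (\<Sum>k=1..N. (lam i * cnj (lam i')) ^ k)" for i i'
  define g where "g i i' = (if i' mod 2 ^ l = i mod 2 ^ l then real N else 2 / \<sigma> l)" for i i' :: nat
  have ll: "lam i * cnj (lam i) = 1" for i using complex_norm_square[of "lam i"] unimod by simp
  have Gg: "cmod (G i i') \<le> g i i'" for i i'
  proof (cases "i' mod 2 ^ l = i mod 2 ^ l")
    case True
    have "cmod (G i i') \<le> (\<Sum>k=1..N. 1)" unfolding G_def
      by (intro sum_norm_le) (simp add: norm_power norm_mult unimod)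
    then show ?thesis using True by (simp add: g_def)
  next
    case False
    have "1 - lam i * cnj (lam i') = (lam i' - lam i) * cnj (lam i')" by (simp add: algebra_simps ll)
    then have "cmod (1 - lam i * cnj (lam i')) = cmod (lam i' - lam i)" by (simp add: norm_mult unimod)
    also have "\<dots> \<ge> \<sigma> l" by (rule sep[OF False])
    finally have d: "\<sigma> l \<le> cmod (1 - lam i * cnj (lam i'))" .
    then have "lam i * cnj (lam i') \<noteq> 1" using sep_pos[of l] by auto
    then have "cmod (G i i') \<le> 2 / cmod (1 - lam i * cnj (lam i'))"
      unfolding G_def by (intro norm_geometric_sum_le) (simp add: norm_mult unimod)
    also have "\<dots> \<le> 2 / \<sigma> l" using d sep_pos[of l]
      by (intro divide_left_mono mult_pos_pos) auto
    finally show ?thesis using False by (simp add: g_def)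
  qed
  have "complex_of_real (\<Sum>k=1..N. (cmod (S k))\<^sup>2) = (\<Sum>k=1..N. S k * cnj (S k))"
    unfolding of_real_sum complex_norm_square ..
  also have "\<dots> = (\<Sum>k=1..N. \<Sum>i<2 ^ L. \<Sum>i'<2 ^ L. F i * cnj (F i') * (lam i * cnj (lam i')) ^ k)"
    unfolding S_def cnj_sum sum_product by (intro sum.cong refl) (simp add: power_mult_distrib mult_ac)
  also have "\<dots> = (\<Sum>i<2 ^ L. \<Sum>k=1..N. \<Sum>i'<2 ^ L. F i * cnj (F i') * (lam i * cnj (lam i')) ^ k)"
    by (rule sum.swap)
  also have "\<dots> = (\<Sum>i<2 ^ L. \<Sum>i'<2 ^ L. F i * cnj (F i') * G i i')"
    unfolding G_def sum_distrib_left by (intro sum.cong refl sum.swap)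
  finally have "(\<Sum>k=1..N. (cmod (S k))\<^sup>2) = cmod (\<Sum>i<2 ^ L. \<Sum>i'<2 ^ L. F i * cnj (F i') * G i i')"
    by (metis (no_types, lifting) norm_of_real abs_of_nonneg sum_nonneg zero_le_power2)
  also have "\<dots> \<le> (\<Sum>i<2 ^ L. \<Sum>i'<2 ^ L. B * B * g i i')"
    using F Gg B by (intro sum_norm_le) (auto simp: norm_mult intro!: mult_mono)
  also have "\<dots> \<le> (\<Sum>i<(2::nat) ^ L. B * B * (2 ^ (L - l) * real N + 2 ^ L * (2 / \<sigma> l)))"
  proof (rule sum_mono)
    fix i
    have "(\<Sum>i'<(2::nat) ^ L. g i i') \<le> (\<Sum>i'<(2::nat) ^ L. (if i' mod 2 ^ l = i mod 2 ^ l then real N else 0) + 2 / \<sigma> l)"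
      using sep_pos[of l] by (intro sum_mono) (auto simp: g_def)
    also have "\<dots> = real (card {i' \<in> {..<(2::nat) ^ L}. i' mod 2 ^ l = i mod 2 ^ l}) * real N + 2 ^ L * (2 / \<sigma> l)"
      by (simp add: sum.distrib sum.If_cases Int_def conj_commute)
    also have "\<dots> \<le> 2 ^ (L - l) * real N + 2 ^ L * (2 / \<sigma> l)"
    proof (intro add_right_mono mult_right_mono)
      have "real (card {i' \<in> {..<(2::nat) ^ L}. i' mod 2 ^ l = i mod 2 ^ l}) \<le> real (2 ^ (L - l))"
        using card_residue_class_le[OF l] by (simp only: of_nat_le_iff)
      then show "real (card {i' \<in> {..<(2::nat) ^ L}. i' mod 2 ^ l = i mod 2 ^ l}) \<le> 2 ^ (L - l)" by simp
    qed simp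
    finally show "(\<Sum>i'<2 ^ L. B * B * g i i') \<le> B * B * (2 ^ (L - l) * real N + 2 ^ L * (2 / \<sigma> l))"
      unfolding sum_distrib_left[symmetric] using B by (intro mult_left_mono) auto
  qed
  also have "\<dots> = 2 ^ L * (B * B * (2 ^ (L - l) * real N + 2 ^ L * (2 / \<sigma> l)))" by simp
  also have "2 ^ (L - l) = 2 ^ L * (1/2::real) ^ l" using l by (simp add: power_diff power_one_over)
  finally have S2: "(\<Sum>k=1..N. (cmod (S k))\<^sup>2) \<le> (2 ^ L * 2 ^ L) * (B * B * ((1/2) ^ l * real N + 2 / \<sigma> l))"
    by (simp add: algebra_simps)
  have "(\<Sum>k=1..N. ((1 / 2 ^ L) * (\<Sum>i<2 ^ L. Re (lam i ^ k * F i)))\<^sup>2) \<le> (\<Sum>k=1..N. (1 / (2 ^ L * 2 ^ L)) * (cmod (S k))\<^sup>2)"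
  proof (rule sum_mono)
    fix k
    have "(\<Sum>i<2 ^ L. Re (lam i ^ k * F i)) = Re (S k)" by (simp add: S_def)
    moreover have "(Re (S k))\<^sup>2 \<le> (cmod (S k))\<^sup>2" by (simp add: cmod_power2)
    ultimately show "((1 / 2 ^ L) * (\<Sum>i<2 ^ L. Re (lam i ^ k * F i)))\<^sup>2 \<le> (1 / (2 ^ L * 2 ^ L)) * (cmod (S k))\<^sup>2"
      by (simp add: power_mult_distrib power_divide power2_eq_square[of "2 ^ L"] divide_right_mono)
  qed
  also have "\<dots> = (1 / (2 ^ L * 2 ^ L)) * (\<Sum>k=1..N. (cmod (S k))\<^sup>2)" by (simp add: sum_distrib_left)
  also have "\<dots> \<le> (1 / (2 ^ L * 2 ^ L)) * ((2 ^ L * 2 ^ L) * (B * B * ((1/2) ^ l * real N + 2 / \<sigma> l)))"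
    by (intro mult_left_mono S2) auto
  also have "\<dots> = B * B * ((1/2) ^ l * real N + 2 / \<sigma> l)" by simp
  finally have "(\<Sum>k=1..N. ((1 / 2 ^ L) * (\<Sum>i<2 ^ L. Re (lam i ^ k * F i)))\<^sup>2) / real N
     \<le> B * B * ((1/2) ^ l * real N + 2 / \<sigma> l) / real N"
    by (intro divide_right_mono) auto
  also have "\<dots> = B\<^sup>2 * ((1/2) ^ l + 2 / \<sigma> l / real N)"
    using N by (simp add: power2_eq_square add_divide_distrib distrib_left)
  finally show ?thesis .
qed

text \<open>The bound is uniform in \<open>L\<close>, so \<open>L\<close> tends to infinity first;
  then \<open>l\<close> is chosen large, and \<open>N\<close> large depending on
  \<open>l\<close>.\<close>

lemma cesaro_null_limit:
  assumes F: "\<And>i. cmod (F i) \<le> B"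
    and E: "\<And>k. (\<lambda>L. (1 / 2 ^ L) * (\<Sum>i<2 ^ L. Re (lam i ^ k * F i))) \<longlonglongrightarrow> E k"
  shows "cesaro_null E"
proof (rule cesaro_null_of_square)
  have bound: "(\<Sum>k=1..N. (E k)\<^sup>2) / real N \<le> B\<^sup>2 * ((1/2) ^ l + 2 / \<sigma> l / real N)" if N: "N > 0" for N l
  proof (rule LIMSEQ_le_const2)
    show "(\<lambda>L. (\<Sum>k=1..N. ((1 / 2 ^ L) * (\<Sum>i<2 ^ L. Re (lam i ^ k * F i)))\<^sup>2) / real N)
      \<longlonglongrightarrow> (\<Sum>k=1..N. (E k)\<^sup>2) / real N"
      using N by (intro tendsto_divide tendsto_sum tendsto_power E tendsto_const) auto
    show "\<exists>L0. \<forall>L\<ge>L0. (\<Sum>k=1..N. ((1 / 2 ^ L) * (\<Sum>i<2 ^ L. Re (lam i ^ k * F i)))\<^sup>2) / real N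
      \<le> B\<^sup>2 * ((1/2) ^ l + 2 / \<sigma> l / real N)"
      by (intro exI[of _ l] allI impI mean_square_bound F N)
  qed
  show "cesaro_null (\<lambda>k. (E k)\<^sup>2)"
    unfolding cesaro_null_def
  proof (rule LIMSEQ_I)
    fix \<epsilon> :: real assume \<epsilon>: "\<epsilon> > 0"
    have "(\<lambda>l. B\<^sup>2 * (1/2::real) ^ l) \<longlonglongrightarrow> B\<^sup>2 * 0"
      by (intro tendsto_mult tendsto_const LIMSEQ_realpow_zero) auto
    then have "\<forall>\<^sub>F l in sequentially. B\<^sup>2 * (1/2) ^ l < \<epsilon> / 2" using \<epsilon> by (intro order_tendstoD) auto
    then obtain l where l: "B\<^sup>2 * (1/2) ^ l < \<epsilon> / 2" by (auto simp: eventually_sequentially)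
    have "(\<lambda>N. B\<^sup>2 * (2 / \<sigma> l / real N)) \<longlonglongrightarrow> B\<^sup>2 * 0"
      by (intro tendsto_mult tendsto_const lim_const_over_n)
    then have "\<forall>\<^sub>F N in sequentially. B\<^sup>2 * (2 / \<sigma> l / real N) < \<epsilon> / 2" using \<epsilon> by (intro order_tendstoD) auto
    then obtain N0 where N0: "\<And>N. N \<ge> N0 \<Longrightarrow> B\<^sup>2 * (2 / \<sigma> l / real N) < \<epsilon> / 2" by (auto simp: eventually_sequentially)
    have "norm ((\<Sum>k=1..N. \<bar>(E k)\<^sup>2\<bar>) / real N - 0) < \<epsilon>" if "N \<ge> max N0 1" for N
    proof -
      have "(\<Sum>k=1..N. (E k)\<^sup>2) / real N \<le> B\<^sup>2 * (1/2) ^ l + B\<^sup>2 * (2 / \<sigma> l / real N)"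
        using bound[of N l] that by (simp add: distrib_left)
      also have "\<dots> < \<epsilon>" using l N0[of N] that by simp
      finally show ?thesis by (simp add: sum_nonneg)
    qed
    then show "\<exists>no. \<forall>N\<ge>no. norm ((\<Sum>k=1..N. \<bar>(E k)\<^sup>2\<bar>) / real N - 0) < \<epsilon>" by blast
  qed
qed

text \<open>\<open>sq \<phi> x\<close> is the squared modulus at \<open>x\<close> of the complex-linear functional with real part \<open>\<phi>\<close>.\<close>

definition sq :: "('b \<Rightarrow> real) \<Rightarrow> 'b \<Rightarrow> real" where
  "sq \<phi> x = (\<phi> x)\<^sup>2 + (\<phi> (J x))\<^sup>2"

text \<open>The variance of \<open>\<phi>\<close> under the Gaussian measure to be constructed.\<close>

definition Q :: "('b \<Rightarrow> real) \<Rightarrow> real" where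
  "Q \<phi> = (\<Sum>k. (\<phi> (f k))\<^sup>2)"

text \<open>Parseval's identity for functions constant on the nodes of level \<open>L\<close>, by
  induction through the parallelogram law. The factor \<open>1 / (2 * sqrt (2 ^ L))\<close> in
  \<open>v\<close> is the height \<open>sqrt (2 ^ L)\<close> of a normalised Haar function times the
  mass \<open>1 / 2 ^ (L + 1)\<close> of each half of its support.\<close>

lemma parseval_level:
  assumes phi: "bounded_linear \<phi>"
  shows "(\<Sum>j<2 ^ L. sq \<phi> (v j)) = (1 / 2 ^ L) * (\<Sum>i<2 ^ L. sq \<phi> (w L i))"
proof (induction L)
  case 0
  show ?case by (simp add: v_def)
next
  case (Suc L)
  interpret phi: bounded_linear \<phi> by (rule phi)
  have split: "(\<Sum>j<2 ^ Suc L. h j) = (\<Sum>i<2 ^ L. h i + h (2 ^ L + i))" for h :: "nat \<Rightarrow> real"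
  proof -
    have "(\<Sum>q<m + k. h q) = (\<Sum>q<m. h q) + (\<Sum>q<k. h (m + q))" for m k :: nat
      by (induction k) (simp_all add: algebra_simps)
    from this[of "2 ^ L" "2 ^ L"] show ?thesis by (simp add: mult_2 sum.distrib)
  qed
  have "(\<Sum>j<2 ^ Suc L. sq \<phi> (v j)) = (\<Sum>j<2 ^ L. sq \<phi> (v j)) + (\<Sum>i<2 ^ L. sq \<phi> (v (2 ^ L + i)))"
    by (simp only: split sum.distrib)
  also have "\<dots> = (\<Sum>i<2 ^ L. (1 / 2 ^ L) * sq \<phi> (w L i) + sq \<phi> (v (2 ^ L + i)))"
    by (simp add: Suc sum.distrib sum_distrib_left)
  also have "\<dots> = (\<Sum>i<2 ^ L. (1 / 2 ^ Suc L) * (sq \<phi> (w (Suc L) i) + sq \<phi> (w (Suc L) (2 ^ L + i))))"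
  proof (rule sum.cong[OF refl])
    fix i :: nat assume "i \<in> {..<2 ^ L}"
    then have i: "i < 2 ^ L" by simp
    define a b where "a = \<phi> (w (Suc L) i)" and "b = \<phi> (w (Suc L) (2 ^ L + i))"
    define a' b' where "a' = \<phi> (J (w (Suc L) i))" and "b' = \<phi> (J (w (Suc L) (2 ^ L + i)))"
    define s where "s = sqrt (2 ^ L)"
    have s: "s\<^sup>2 = 2 ^ L" "s \<noteq> 0" by (simp_all add: s_def)
    have "sq \<phi> (w L i) = ((a + b) / 2)\<^sup>2 + ((a' + b') / 2)\<^sup>2"
      using w_half[OF i] by (simp add: sq_def a_def b_def a'_def b'_def J.add J.scale phi.add phi.scaleR add.commute[of i])
    moreover have "sq \<phi> (v (2 ^ L + i)) = ((a - b) / (2 * s))\<^sup>2 + ((a' - b') / (2 * s))\<^sup>2"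
      unfolding v_add_power[OF i] s_def[symmetric]
      by (simp add: sq_def a_def b_def a'_def b'_def J.diff J.scale phi.diff phi.scaleR)
    moreover have "((a - b) / (2 * s))\<^sup>2 = (1 / 2 ^ L) * ((a - b) / 2)\<^sup>2" for a b
      using s by (simp add: power_divide power_mult_distrib)
    ultimately have "(1 / 2 ^ L) * sq \<phi> (w L i) + sq \<phi> (v (2 ^ L + i))
       = (1 / 2 ^ L) * (((a + b) / 2)\<^sup>2 + ((a' + b') / 2)\<^sup>2 + ((a - b) / 2)\<^sup>2 + ((a' - b') / 2)\<^sup>2)"
      by (simp only: distrib_left add.assoc)
    also have "((a + b) / 2)\<^sup>2 + ((a' + b') / 2)\<^sup>2 + ((a - b) / 2)\<^sup>2 + ((a' - b') / 2)\<^sup>2 = (a\<^sup>2 + a'\<^sup>2 + (b\<^sup>2 + b'\<^sup>2)) / 2"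
      by (simp add: power2_eq_square field_simps)
    also have "\<dots> = (sq \<phi> (w (Suc L) i) + sq \<phi> (w (Suc L) (2 ^ L + i))) / 2"
      by (simp add: sq_def a_def b_def a'_def b'_def)
    finally show "(1 / 2 ^ L) * sq \<phi> (w L i) + sq \<phi> (v (2 ^ L + i))
       = (1 / 2 ^ Suc L) * (sq \<phi> (w (Suc L) i) + sq \<phi> (w (Suc L) (2 ^ L + i)))" by simp
  qed
  also have "\<dots> = (1 / 2 ^ Suc L) * (\<Sum>i<2 ^ Suc L. sq \<phi> (w (Suc L) i))"
    by (simp only: split sum_distrib_left)
  finally show ?case .
qed

lemma sq_diff_le:
  assumes phi: "bounded_linear \<phi>" and K: "\<And>z. \<bar>\<phi> z\<bar> \<le> K * norm z" and K0: "K \<ge> 0"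
  shows "\<bar>sq \<phi> x - sq \<phi> y\<bar> \<le> 2 * (K * norm (x - y) * (K * (norm x + norm y)))"
proof -
  interpret phi: bounded_linear \<phi> by (rule phi)
  have *: "\<bar>(\<phi> x)\<^sup>2 - (\<phi> y)\<^sup>2\<bar> \<le> K * norm (x - y) * (K * (norm x + norm y))" for x y
  proof -
    have "(\<phi> x)\<^sup>2 - (\<phi> y)\<^sup>2 = \<phi> (x - y) * \<phi> (x + y)"
      by (simp add: phi.diff phi.add power2_eq_square algebra_simps)
    then have "\<bar>(\<phi> x)\<^sup>2 - (\<phi> y)\<^sup>2\<bar> = \<bar>\<phi> (x - y)\<bar> * \<bar>\<phi> (x + y)\<bar>" by (simp add: abs_mult)
    also have "\<dots> \<le> (K * norm (x - y)) * (K * norm (x + y))" using K0 by (intro mult_mono K) auto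
    also have "\<dots> \<le> (K * norm (x - y)) * (K * (norm x + norm y))"
      using K0 by (intro mult_left_mono norm_triangle_ineq) auto
    finally show ?thesis .
  qed
  have "\<bar>sq \<phi> x - sq \<phi> y\<bar> \<le> \<bar>(\<phi> x)\<^sup>2 - (\<phi> y)\<^sup>2\<bar> + \<bar>(\<phi> (J x))\<^sup>2 - (\<phi> (J y))\<^sup>2\<bar>"
    unfolding sq_def by linarith
  also have "\<dots> \<le> 2 * (K * norm (x - y) * (K * (norm x + norm y)))"
    using *[of x y] *[of "J x" "J y"] by (simp flip: J.diff)
  finally show ?thesis .
qed

lemma bounded_linear_bound:
  assumes "bounded_linear (\<phi> :: 'b \<Rightarrow> real)"
  shows "\<exists>K\<ge>0. \<forall>z. \<bar>\<phi> z\<bar> \<le> K * norm z"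
  using bounded_linear.nonneg_bounded[OF assms] by (auto simp: mult.commute)

text \<open>The covariance form is the mean of \<open>sq \<phi>\<close> over the branches:
  Parseval's identity gives this with \<open>w\<close>, along the partial sums of length
  \<open>2 * 2 ^ L\<close>, and \<open>u\<close> is uniformly close to \<open>w\<close>.\<close>

lemma Q_lim:
  assumes sept: "separable_type TYPE('b)" and phi: "bounded_linear \<phi>"
  shows "(\<lambda>L. (1 / 2 ^ L) * (\<Sum>i<2 ^ L. sq \<phi> (u i))) \<longlonglongrightarrow> Q \<phi>"
proof -
  obtain K where K: "K \<ge> 0" "\<And>z. \<bar>\<phi> z\<bar> \<le> K * norm z" using bounded_linear_bound[OF phi] by blast
  have "(\<lambda>N. \<Sum>k<N. (\<phi> (f k))\<^sup>2) \<longlonglongrightarrow> Q \<phi>"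
    unfolding Q_def by (rule summable_LIMSEQ[OF series_rv_char(1)[OF sept summable_f phi]])
  moreover have "strict_mono (\<lambda>L. 2 * 2 ^ L :: nat)" by (simp add: strict_mono_def)
  ultimately have "((\<lambda>N. \<Sum>k<N. (\<phi> (f k))\<^sup>2) \<circ> (\<lambda>L. 2 * 2 ^ L)) \<longlonglongrightarrow> Q \<phi>"
    by (rule LIMSEQ_subseq_LIMSEQ)
  moreover have "(\<Sum>k<2 * M. (\<phi> (f k))\<^sup>2) = (\<Sum>j<M. sq \<phi> (v j))" for M
    by (induction M) (simp_all add: f_even f_odd sq_def)
  ultimately have l1: "(\<lambda>L. (1 / 2 ^ L) * (\<Sum>i<2 ^ L. sq \<phi> (w L i))) \<longlonglongrightarrow> Q \<phi>"
    by (simp add: comp_def parseval_level[OF phi])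
  have "(\<lambda>L. (1 / 2 ^ L) * (\<Sum>i<2 ^ L. sq \<phi> (u i)) - (1 / 2 ^ L) * (\<Sum>i<2 ^ L. sq \<phi> (w L i))) \<longlonglongrightarrow> 0"
  proof (rule Lim_null_comparison)
    show "\<forall>\<^sub>F L in sequentially. norm ((1 / 2 ^ L) * (\<Sum>i<2 ^ L. sq \<phi> (u i)) - (1 / 2 ^ L) * (\<Sum>i<2 ^ L. sq \<phi> (w L i)))
      \<le> 10 * K * K * (1/2) ^ L"
    proof (rule always_eventually, rule allI)
      fix L
      have "(1 / 2 ^ L) * (\<Sum>i<2 ^ L. sq \<phi> (u i)) - (1 / 2 ^ L) * (\<Sum>i<2 ^ L. sq \<phi> (w L i))
        = (1 / 2 ^ L) * (\<Sum>i<2 ^ L. sq \<phi> (u i) - sq \<phi> (w L i))"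
        by (simp add: sum_subtractf right_diff_distrib)
      also have "norm \<dots> \<le> (1 / 2 ^ L) * (\<Sum>i<(2::nat) ^ L. 10 * K * K * (1/2) ^ L)"
        unfolding norm_mult
      proof (intro mult_mono sum_norm_le)
        fix i :: nat assume "i \<in> {..<2 ^ L}"
        then have i: "i < 2 ^ L" by simp
        have "(1/2::real) ^ 2 ^ L \<le> (1/2) ^ L" by (intro power_decreasing) (auto simp: less_imp_le)
        then have d: "norm (u i - w L i) \<le> (1/2) ^ L"
          using order_trans[OF w_u[OF i]] by (simp only: norm_minus_commute)
        have "(1/2::real) ^ L \<le> 1" by (simp add: power_le_one)
        then have "norm (w L i) \<le> 3"
          using d norm_triangle_ineq2[of "w L i" "u i"] norm_u[of i] norm_minus_commute[of "w L i" "u i"] by linarith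
        then have n: "norm (u i) + norm (w L i) \<le> 5" using norm_u[of i] by simp
        have "\<bar>sq \<phi> (u i) - sq \<phi> (w L i)\<bar> \<le> 2 * (K * norm (u i - w L i) * (K * (norm (u i) + norm (w L i))))"
          by (rule sq_diff_le[OF phi K(2,1)])
        also have "\<dots> \<le> 2 * (K * (1/2) ^ L * (K * 5))"
          using K(1) d n by (intro mult_left_mono mult_mono) auto
        finally show "norm (sq \<phi> (u i) - sq \<phi> (w L i)) \<le> 10 * K * K * (1/2) ^ L" by (simp add: mult_ac)
      qed (use K in \<open>auto intro!: sum_nonneg\<close>)
      also have "\<dots> = 10 * K * K * (1/2) ^ L" by simp
      finally show "norm ((1 / 2 ^ L) * (\<Sum>i<2 ^ L. sq \<phi> (u i)) - (1 / 2 ^ L) * (\<Sum>i<2 ^ L. sq \<phi> (w L i)))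
        \<le> 10 * K * K * (1/2) ^ L" .
    qed
    have "(\<lambda>L. 10 * K * K * (1/2) ^ L) \<longlonglongrightarrow> 10 * K * K * 0"
      by (intro tendsto_mult tendsto_const LIMSEQ_realpow_zero) auto
    then show "(\<lambda>L. 10 * K * K * (1/2) ^ L) \<longlonglongrightarrow> 0" by simp
  qed
  from tendsto_add[OF this l1] show ?thesis by simp
qed

lemma functional_cscale:
  assumes "bounded_linear (\<phi> :: 'b \<Rightarrow> real)"
  shows "\<phi> (cscale J a x) = Re a * \<phi> x + Im a * \<phi> (J x)" "\<phi> (J (cscale J a x)) = Re a * \<phi> (J x) - Im a * \<phi> x"
proof -
  interpret phi: bounded_linear \<phi> by fact
  show "\<phi> (cscale J a x) = Re a * \<phi> x + Im a * \<phi> (J x)" "\<phi> (J (cscale J a x)) = Re a * \<phi> (J x) - Im a * \<phi> x"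
    by (simp_all add: cscale_def J.add J.scale phi.add phi.scaleR phi.neg phi.diff)
qed

lemma bounded_linear_functional_Tn:
  "bounded_linear \<phi> \<Longrightarrow> bounded_linear (\<lambda>z. \<phi> ((T ^^ N) z))"
  by (rule bounded_linear_compose[OF _ Tn_bounded_linear])

text \<open>On the eigenvectors \<open>u i\<close> the operator acts by unimodular scalars, which
  \<open>sq\<close> does not see.\<close>

lemma Q_Tn:
  assumes sept: "separable_type TYPE('b)" and phi: "bounded_linear \<phi>"
  shows "Q (\<lambda>z. \<phi> ((T ^^ N) z)) = Q \<phi>"
proof (rule LIMSEQ_unique[OF Q_lim[OF sept bounded_linear_functional_Tn[OF phi]]])
  have "sq (\<lambda>z. \<phi> ((T ^^ N) z)) (u i) = sq \<phi> (u i)" for i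
  proof -
    let ?a = "lam i ^ N"
    have "(Re ?a)\<^sup>2 + (Im ?a)\<^sup>2 = 1" using unimod[of i] by (simp add: norm_power flip: cmod_power2)
    moreover have "sq (\<lambda>z. \<phi> ((T ^^ N) z)) (u i) = ((Re ?a)\<^sup>2 + (Im ?a)\<^sup>2) * sq \<phi> (u i)"
      unfolding sq_def Tn_J Tn_u functional_cscale[OF phi] by (simp add: power2_eq_square algebra_simps)
    ultimately show ?thesis by simp
  qed
  then show "(\<lambda>L. (1 / 2 ^ L) * (\<Sum>i<2 ^ L. sq (\<lambda>z. \<phi> ((T ^^ N) z)) (u i))) \<longlonglongrightarrow> Q \<phi>"
    using Q_lim[OF sept phi] by simp
qed

lemma cesaro_null_covariance:
  assumes sept: "separable_type TYPE('b)" and phi: "bounded_linear \<phi>" and psi: "bounded_linear \<psi>"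
  shows "cesaro_null (\<lambda>N. (Q (\<lambda>z. \<phi> ((T ^^ N) z) + \<psi> z) - Q \<phi> - Q \<psi>) / 2)"
proof -
  \<comment> \<open>With the complex-linear functional \<open>\<phi> x - \<i> * \<phi> (J x)\<close>
    and its analogue for \<psi>, this is the value of the first at \<open>u i\<close> times the
    conjugate of the value of the second.\<close>
  define F where "F i = Complex (\<phi> (u i) * \<psi> (u i) + \<phi> (J (u i)) * \<psi> (J (u i)))
     (\<phi> (u i) * \<psi> (J (u i)) - \<phi> (J (u i)) * \<psi> (u i))" for i
  obtain K where K: "K \<ge> 0" "\<And>z. \<bar>\<phi> z\<bar> \<le> K * norm z" using bounded_linear_bound[OF phi] by blast
  obtain K' where K': "K' \<ge> 0" "\<And>z. \<bar>\<psi> z\<bar> \<le> K' * norm z" using bounded_linear_bound[OF psi] by blast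
  have b1: "\<bar>\<phi> (u i)\<bar> \<le> 2 * K" "\<bar>\<phi> (J (u i))\<bar> \<le> 2 * K" for i
    using K(2)[of "u i"] K(2)[of "J (u i)"] mult_left_mono[OF norm_u[of i] K(1)] by simp_all
  have b2: "\<bar>\<psi> (u i)\<bar> \<le> 2 * K'" "\<bar>\<psi> (J (u i))\<bar> \<le> 2 * K'" for i
    using K'(2)[of "u i"] K'(2)[of "J (u i)"] mult_left_mono[OF norm_u[of i] K'(1)] by simp_all
  have pr: "\<bar>x * y\<bar> \<le> (2 * K) * (2 * K')" if "\<bar>x\<bar> \<le> 2 * K" "\<bar>y\<bar> \<le> 2 * K'" for x y
    unfolding abs_mult using that K(1) by (intro mult_mono) auto
  define B where "B = 4 * ((2 * K) * (2 * K'))"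
  have FB: "cmod (F i) \<le> B" for i
  proof -
    have "cmod (F i) \<le> \<bar>Re (F i)\<bar> + \<bar>Im (F i)\<bar>" by (rule cmod_le)
    also have "\<dots> \<le> B"
      using pr[OF b1(1)[of i] b2(1)[of i]] pr[OF b1(2)[of i] b2(2)[of i]] pr[OF b1(1)[of i] b2(2)[of i]] pr[OF b1(2)[of i] b2(1)[of i]]
      unfolding F_def B_def complex.sel by linarith
    finally show ?thesis .
  qed
  have sum_bl: "bounded_linear (\<lambda>z. \<phi> ((T ^^ N) z) + \<psi> z)" for N
    by (intro bounded_linear_add bounded_linear_functional_Tn phi psi)
  \<comment> \<open>Polarisation of a squared modulus: in the cross term the factor
    \<open>lam i ^ N\<close> remains.\<close>
  have pt: "sq (\<lambda>z. \<phi> ((T ^^ N) z) + \<psi> z) (u i) - sq (\<lambda>z. \<phi> ((T ^^ N) z)) (u i) - sq \<psi> (u i)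
     = 2 * Re (lam i ^ N * F i)" for N i
    unfolding sq_def Tn_J Tn_u functional_cscale[OF phi] F_def
    by (simp add: power2_eq_square algebra_simps)
  have lim: "(\<lambda>L. (1 / 2 ^ L) * (\<Sum>i<2 ^ L. Re (lam i ^ N * F i)))
     \<longlonglongrightarrow> (Q (\<lambda>z. \<phi> ((T ^^ N) z) + \<psi> z) - Q \<phi> - Q \<psi>) / 2" for N
  proof -
    have "(\<lambda>L. ((1 / 2 ^ L) * (\<Sum>i<2 ^ L. sq (\<lambda>z. \<phi> ((T ^^ N) z) + \<psi> z) (u i))
        - (1 / 2 ^ L) * (\<Sum>i<2 ^ L. sq (\<lambda>z. \<phi> ((T ^^ N) z)) (u i)) - (1 / 2 ^ L) * (\<Sum>i<2 ^ L. sq \<psi> (u i))) / 2)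
       \<longlonglongrightarrow> (Q (\<lambda>z. \<phi> ((T ^^ N) z) + \<psi> z) - Q (\<lambda>z. \<phi> ((T ^^ N) z)) - Q \<psi>) / 2"
      by (intro tendsto_divide tendsto_diff Q_lim sept sum_bl bounded_linear_functional_Tn phi psi tendsto_const) simp
    moreover have "((1 / 2 ^ L) * (\<Sum>i<2 ^ L. sq (\<lambda>z. \<phi> ((T ^^ N) z) + \<psi> z) (u i))
        - (1 / 2 ^ L) * (\<Sum>i<2 ^ L. sq (\<lambda>z. \<phi> ((T ^^ N) z)) (u i)) - (1 / 2 ^ L) * (\<Sum>i<2 ^ L. sq \<psi> (u i))) / 2
      = (1 / 2 ^ L) * (\<Sum>i<2 ^ L. Re (lam i ^ N * F i))" for L
      unfolding right_diff_distrib[symmetric] sum_subtractf[symmetric] pt sum_distrib_left[symmetric] by simp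
    ultimately show ?thesis unfolding Q_Tn[OF sept phi] by simp
  qed
  show ?thesis by (rule cesaro_null_limit[OF FB lim])
qed

text \<open>A product of characters of \<open>\<phi> \<circ> T ^^ N\<close> and \<psi> is the
  character of their sum, so the correlation is a difference of two explicit exponentials and is
  bounded by the covariance. Invariance of the measure is invariance of \<open>Q\<close> combined
  with uniqueness of the characteristic functional.\<close>

lemma gaussian_weakly_mixing_measure:
  assumes sept: "separable_type TYPE('b)"
  shows "\<exists>m. gaussian_measure m \<and> non_degenerate m \<and> invariant_measure m T \<and> weakly_mixing m T"
proof -
  have "\<exists>m :: 'b measure. borel_prob m \<and> non_degenerate m \<and>
     (\<forall>\<phi>. bounded_linear \<phi> \<longrightarrow> (CLINT z|m. iexp (\<phi> z)) = complex_of_real (exp (- Q \<phi> / 2)))"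
  proof (rule gaussian_series_measure[OF sept summable_f dense_f])
    fix m :: "'b measure"
    assume "borel_prob m" "non_degenerate m" "\<And>\<phi>. bounded_linear \<phi> \<Longrightarrow>
      (CLINT z|m. iexp (\<phi> z)) = complex_of_real (exp (- (\<Sum>i. (\<phi> (f i))\<^sup>2) / 2))"
    then show ?thesis unfolding Q_def by blast
  qed
  then obtain m :: "'b measure" where m: "borel_prob m" "non_degenerate m"
    and ch: "\<And>\<phi>. bounded_linear \<phi> \<Longrightarrow> (CLINT z|m. iexp (\<phi> z)) = complex_of_real (exp (- Q \<phi> / 2))"
    by blast
  have Q0: "Q \<phi> \<ge> 0" if "bounded_linear \<phi>" for \<phi>
    unfolding Q_def by (intro suminf_nonneg series_rv_char(1)[OF sept summable_f that]) simp
  have g: "gaussian_measure m"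
  proof (rule char_functional_gaussian[OF m(1) Q0 ch])
    fix \<phi> :: "'b \<Rightarrow> real" and t :: real assume phi: "bounded_linear \<phi>"
    show "Q (\<lambda>z. t * \<phi> z) = t\<^sup>2 * Q \<phi>"
      unfolding Q_def power_mult_distrib
      by (rule suminf_mult[OF series_rv_char(1)[OF sept summable_f phi]])
  qed
  have Tm: "T \<in> borel_measurable borel"
    by (intro borel_measurable_continuous_onI linear_continuous_on T_bounded_linear)
  have sets: "sets m = sets borel" using m(1) by (simp add: borel_prob_def)
  have Tm': "T \<in> borel_measurable m" using Tm sets by (simp cong: measurable_cong_sets)
  have dm: "distr m borel T = m"
  proof (rule measure_eq_of_char_functional[OF sept _ m(1)])
    show "borel_prob (distr m borel T)"
      using m(1) Tm' by (auto simp: borel_prob_def intro: prob_space.prob_space_distr)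
    fix \<phi> :: "'b \<Rightarrow> real" assume phi: "bounded_linear \<phi>"
    have pm: "\<phi> \<in> borel_measurable borel"
      by (intro borel_measurable_continuous_onI linear_continuous_on phi)
    have "(\<lambda>z. iexp (\<phi> z)) \<in> borel_measurable borel" using pm by measurable
    then have "(CLINT z|distr m borel T. iexp (\<phi> z)) = (CLINT z|m. iexp (\<phi> (T z)))"
      by (rule integral_distr[OF Tm'])
    also have "\<dots> = complex_of_real (exp (- Q (\<lambda>z. \<phi> ((T ^^ 1) z)) / 2))"
      using ch[OF bounded_linear_functional_Tn[OF phi, of 1]] by simp
    also have "\<dots> = (CLINT z|m. iexp (\<phi> z))" unfolding Q_Tn[OF sept phi] ch[OF phi] ..
    finally show "(CLINT z|distr m borel T. iexp (\<phi> z)) = (CLINT z|m. iexp (\<phi> z))" .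
  qed
  have inv: "invariant_measure m T"
    unfolding invariant_measure_def
  proof
    fix A assume "A \<in> sets m"
    then have "emeasure (distr m borel T) A = emeasure m (T -` A \<inter> space m)"
      using Tm' sets by (intro emeasure_distr) auto
    then show "emeasure m (T -` A) = emeasure m A"
      using dm sets_eq_imp_space_eq[OF sets] by simp
  qed
  interpret measure_dynamics m T by unfold_locales (rule m(1) Tm inv)+
  have "weakly_mixing m T"
  proof (rule weakly_mixing_of_characters[OF sept])
    fix \<phi> \<psi> :: "'b \<Rightarrow> real" assume phi: "bounded_linear \<phi>" and psi: "bounded_linear \<psi>"
    show "cesaro_null (\<lambda>N. cmod (corr (\<lambda>z. iexp (\<phi> z)) (\<lambda>z. iexp (\<psi> z)) N))"
    proof (rule cesaro_null_mono[OF cesaro_null_covariance[OF sept phi psi]])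
      fix N
      let ?\<chi> = "\<lambda>z. \<phi> ((T ^^ N) z) + \<psi> z"
      have bl: "bounded_linear ?\<chi>" by (intro bounded_linear_add bounded_linear_functional_Tn phi psi)
      have "(CLINT z|m. iexp (\<phi> ((T ^^ N) z)) * iexp (\<psi> z)) = (CLINT z|m. iexp (?\<chi> z))"
        by (simp only: iexp_add)
      then have "corr (\<lambda>z. iexp (\<phi> z)) (\<lambda>z. iexp (\<psi> z)) N
         = complex_of_real (exp (- Q ?\<chi> / 2)) - complex_of_real (exp (- Q \<phi> / 2)) * complex_of_real (exp (- Q \<psi> / 2))"
        unfolding corr_def by (simp only: ch[OF bl] ch[OF phi] ch[OF psi])
      also have "\<dots> = complex_of_real (exp (- (Q ?\<chi> / 2)) - exp (- (Q \<phi> / 2 + Q \<psi> / 2)))"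
        by (simp flip: of_real_mult exp_add)
      finally have "cmod (corr (\<lambda>z. iexp (\<phi> z)) (\<lambda>z. iexp (\<psi> z)) N) = \<bar>exp (- (Q ?\<chi> / 2)) - exp (- (Q \<phi> / 2 + Q \<psi> / 2))\<bar>"
        by (simp only: norm_of_real)
      also have "\<dots> \<le> \<bar>Q ?\<chi> / 2 - (Q \<phi> / 2 + Q \<psi> / 2)\<bar>"
        using Q0[OF bl] Q0[OF phi] Q0[OF psi] by (intro exp_minus_lipschitz) auto
      also have "Q ?\<chi> / 2 - (Q \<phi> / 2 + Q \<psi> / 2) = (Q ?\<chi> - Q \<phi> - Q \<psi>) / 2" by (simp add: field_simps)
      finally show "\<bar>cmod (corr (\<lambda>z. iexp (\<phi> z)) (\<lambda>z. iexp (\<psi> z)) N)\<bar> \<le> \<bar>(Q ?\<chi> - Q \<phi> - Q \<psi>) / 2\<bar>"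
        by simp
    qed
  qed
  with g m(2) inv show ?thesis by blast
qed

end

section \<open>Assembly of the equivalence\<close>

lemma uniform_limit_powers_rate:
  fixes n :: "nat \<Rightarrow> nat"
  assumes K: "K \<subseteq> unit_circle" "K \<noteq> {}" and ul: "uniform_limit K (\<lambda>k z. z ^ n k) (\<lambda>_. 1) sequentially"
  shows "\<exists>eps. eps \<longlonglongrightarrow> 0 \<and> (\<forall>z\<in>K. \<forall>k. cmod (z ^ n k - 1) \<le> eps k)"
proof -
  \<comment> \<open>The exact rate of uniform convergence; it is finite because powers of unimodular
    numbers lie within 2 of 1.\<close>
  define eps where "eps k = (SUP z\<in>K. cmod (z ^ n k - 1))" for k
  have bdd: "bdd_above ((\<lambda>z. cmod (z ^ n k - 1)) ` K)" for k
  proof (rule bdd_aboveI2)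
    fix z assume "z \<in> K"
    then have "cmod z = 1" using K by (auto simp: unit_circle_def)
    then show "cmod (z ^ n k - 1) \<le> 2" using norm_triangle_ineq4[of "z ^ n k" 1] by (simp add: norm_power)
  qed
  have up: "cmod (z ^ n k - 1) \<le> eps k" if "z \<in> K" for z k
    unfolding eps_def by (rule cSUP_upper[OF that bdd])
  obtain z0 where z0: "z0 \<in> K" using K(2) by blast
  have "eps \<longlonglongrightarrow> 0"
  proof (rule tendstoI)
    fix \<epsilon> :: real assume "\<epsilon> > 0"
    then have "\<forall>\<^sub>F k in sequentially. \<forall>z\<in>K. dist (z ^ n k) 1 < \<epsilon> / 2"
      using uniform_limitD[OF ul, of "\<epsilon> / 2"] by simp
    then show "\<forall>\<^sub>F k in sequentially. dist (eps k) 0 < \<epsilon>"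
    proof eventually_elim
      case (elim k)
      have "eps k \<le> \<epsilon> / 2"
        unfolding eps_def using elim K(2) by (intro cSUP_least) (auto simp: dist_norm intro: less_imp_le)
      moreover have "0 \<le> eps k" by (rule order_trans[OF norm_ge_zero up[OF z0]])
      ultimately show ?case using \<open>\<epsilon> > 0\<close> by simp
    qed
  qed
  with up show ?thesis by blast
qed

lemma rigid_operator_exists:
  fixes J :: "'b::{real_inner,banach} \<Rightarrow> 'b" and n :: "nat \<Rightarrow> nat"
  assumes sept: "separable_type TYPE('b)" and chs: "complex_hilbert_structure J"
    and inf: "\<forall>B::'b set. finite B \<longrightarrow> span B \<noteq> UNIV"
    and K: "K \<subseteq> unit_circle" "uncountable K" "uniform_limit K (\<lambda>k z. z ^ n k) (\<lambda>_. 1) sequentially"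
  shows "\<exists>T. bounded_clinear_op J T \<and> uncountable (point_spectrum J T \<inter> unit_circle) \<and>
    (\<lambda>k. onorm (\<lambda>x. (T ^^ n k) x - x)) \<longlonglongrightarrow> 0 \<and>
    (\<exists>m. gaussian_measure m \<and> non_degenerate m \<and> invariant_measure m T \<and> weakly_mixing m T)"
proof -
  interpret complex_hilbert J by unfold_locales (rule chs)
  obtain e :: "nat \<Rightarrow> 'b" where e: "\<forall>i j. inner (e i) (e j) = of_bool (i = j)" "\<forall>i j. inner (e i) (J (e j)) = 0"
    "\<forall>z. (\<forall>i. inner z (e i) = 0 \<and> inner z (J (e i)) = 0) \<longrightarrow> z = 0"
    using orthonormal_basis_exists[OF sept inf] by blast
  have "K \<noteq> {}" using K(2) by auto
  then obtain eps where eps: "\<And>z k. z \<in> K \<Longrightarrow> cmod (z ^ n k - 1) \<le> eps k" "eps \<longlonglongrightarrow> 0"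
    using uniform_limit_powers_rate[OF K(1) _ K(3)] by blast
  obtain lam \<sigma> where lam: "\<forall>j. lam j \<in> K"
    "\<forall>j>0. cmod (lam j - lam (par j)) \<le> (1/16) ^ j \<and> (\<forall>k. cmod (lam j ^ n k - lam (par j) ^ n k) \<le> (1/16) ^ j)"
    "\<forall>l. \<sigma> l > 0 \<and> (\<forall>i i'. i mod 2 ^ l \<noteq> i' mod 2 ^ l \<longrightarrow> cmod (lam i - lam i') \<ge> \<sigma> l)"
    using eigenvalue_tree_exists[OF K(2) eps(2), of n, OF eps(1)] by blast
  interpret eigen_tree J e lam n eps \<sigma>
  proof unfold_locales
    show "inner (e i) (e j) = of_bool (i = j)" for i j using e(1) by blast
    show "inner (e i) (J (e j)) = 0" for i j using e(2) by blast
    show "z = 0" if "\<And>i. inner z (e i) = 0" "\<And>i. inner z (J (e i)) = 0" for z using e(3) that by blast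
    show "cmod (lam j) = 1" for j using lam(1) K(1) by (auto simp: unit_circle_def)
    show "eps \<longlonglongrightarrow> 0" by (rule eps)
    show "cmod (lam j ^ n k - 1) \<le> eps k" for j k using lam(1) eps(1) by blast
    show "cmod (lam j - lam (par j)) \<le> (1/16) ^ j" if "j > 0" for j using lam(2) that by blast
    show "cmod (lam j ^ n k - lam (par j) ^ n k) \<le> (1/16) ^ j" if "j > 0" for j k using lam(2) that by blast
    show "\<sigma> l > 0" for l using lam(3) by blast
    show "cmod (lam i - lam i') \<ge> \<sigma> l" if "i mod 2 ^ l \<noteq> i' mod 2 ^ l" for i i' l using lam(3) that by blast
  qed
  show ?thesis
    using T_clinear uncountable_spectrum T_rigid gaussian_weakly_mixing_measure[OF sept] by blast
qed

text \<open>Spaces are types, so the equivalence is split: an operator of either kind on some space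
  yields the set, and the set yields both kinds on every prescribed infinite-dimensional separable
  complex Hilbert space. \<open>P3\<close> demands a non-zero vector because on the zero space its
  other conditions can be met trivially.\<close>

theorem theorem1p6:
  fixes n :: "nat \<Rightarrow> nat"
  assumes "strict_mono n" and "\<And>k. n k > 0"
  defines "P1 \<equiv> \<exists>K\<subseteq>unit_circle. uncountable K \<and>
                   uniform_limit K (\<lambda>k z. z ^ n k) (\<lambda>_. 1) sequentially"
  defines "P2 \<equiv> \<lambda>(J::'c::banach \<Rightarrow> 'c) T. separable_type TYPE('c) \<and>
                   complex_banach_structure J \<and> bounded_clinear_op J T \<and>
                   uncountable (point_spectrum J T \<inter> unit_circle) \<and>
                   (\<lambda>k. onorm (\<lambda>x. (T ^^ n k) x - x)) \<longlonglongrightarrow> 0"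
  defines "P3 \<equiv> \<lambda>(J::'b::{real_inner,banach} \<Rightarrow> 'b) T m. separable_type TYPE('b) \<and>
                   complex_hilbert_structure J \<and> (\<exists>x::'b. x \<noteq> 0) \<and>
                   bounded_clinear_op J T \<and> gaussian_measure m \<and> non_degenerate m \<and>
                   invariant_measure m T \<and> weakly_mixing m T \<and>
                   (\<lambda>k. onorm (\<lambda>x. (T ^^ n k) x - x)) \<longlonglongrightarrow> 0"
  defines "P2' \<equiv> \<lambda>(J::'b \<Rightarrow> 'b) T. separable_type TYPE('b) \<and>
                   complex_banach_structure J \<and> bounded_clinear_op J T \<and>
                   uncountable (point_spectrum J T \<inter> unit_circle) \<and>
                   (\<lambda>k. onorm (\<lambda>x. (T ^^ n k) x - x)) \<longlonglongrightarrow> 0"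
  shows
    "((\<exists>J T. P2 J T) \<longrightarrow> P1)
     \<and> ((\<exists>J T m. P3 J T m) \<longrightarrow> P1)
     \<and> (\<forall>J::'b \<Rightarrow> 'b. separable_type TYPE('b) \<and> complex_hilbert_structure J \<and>
            (\<forall>B::'b set. finite B \<longrightarrow> span B \<noteq> UNIV) \<longrightarrow>
          P1 \<longrightarrow> (\<exists>T. P2' J T) \<and> (\<exists>T m. P3 J T m))"
proof (intro conjI impI allI)
  assume "\<exists>J T. P2 J T"
  then show P1
    unfolding P1_def P2_def using uncountable_set_of_eigenvalues[where n=n] by blast
next
  assume "\<exists>J T m. P3 J T m"
  then obtain J :: "'b \<Rightarrow> 'b" and T m x where "bounded_clinear_op J T" "gaussian_measure m" "non_degenerate m"
    "invariant_measure m T" "weakly_mixing m T" "(x::'b) \<noteq> 0" "(\<lambda>k. onorm (\<lambda>x. (T ^^ n k) x - x)) \<longlonglongrightarrow> 0"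
    unfolding P3_def by blast
  then show P1
    unfolding P1_def bounded_clinear_op_def by (intro uncountable_set_of_weakly_mixing) blast+
next
  fix J :: "'b \<Rightarrow> 'b"
  assume H: "separable_type TYPE('b) \<and> complex_hilbert_structure J \<and> (\<forall>B::'b set. finite B \<longrightarrow> span B \<noteq> UNIV)"
    and P1
  then obtain K where K: "K \<subseteq> unit_circle" "uncountable K" "uniform_limit K (\<lambda>k z. z ^ n k) (\<lambda>_. 1) sequentially"
    unfolding P1_def by blast
  obtain T m where T: "bounded_clinear_op J T" "uncountable (point_spectrum J T \<inter> unit_circle)"
    "(\<lambda>k. onorm (\<lambda>x. (T ^^ n k) x - x)) \<longlonglongrightarrow> 0"
    "gaussian_measure m" "non_degenerate m" "invariant_measure m T" "weakly_mixing m T"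
    using rigid_operator_exists[of J, OF _ _ _ K] H by blast
  interpret complex_hilbert J by unfold_locales (use H in blast)
  have nz: "\<exists>x::'b. x \<noteq> 0"
  proof (rule ccontr)
    assume "\<not> ?thesis"
    then have "(UNIV :: 'b set) = span {}" by auto
    then show False using H by blast
  qed
  show "\<exists>T. P2' J T" unfolding P2'_def using H T banach_structure by blast
  show "\<exists>T m. P3 J T m" unfolding P3_def using H T nz by blast
qed

end
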